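(* Let $G_0=\sum_{i=1}^{K_0}\tilde\alpha_i^0\delta_{\theta_i^0}\in\mathcal{E}_{K_0}$. Then: (a) $\mathfrak{N}_1(G_0)\le 2K_0-1$, and $\mathfrak{N}_2(G_0,K)\le K_0+K-1$ for every $K>K_0$. (b) If $\theta_1^0,\dots,\theta_{K_0}^0$ are linearly independent, then $\mathfrak{N}_1(G_0)\le3$ and $\mathfrak{N}_2(G_0)\le4$. (c) If $\theta_1^0,\dots,\theta_{K_0}^0$ satisfy the anchor-word condition, then $\mathfrak{N}_1(G_0)\le2$.
   Context: $\Delta^{D-1}$ is the set of probability vectors in $\mathbb{R}^D$. $\mathcal{E}_K$ is the set of discrete probability measures on $\Delta^{V-1}$ with exactly $K$ atoms (distinct atoms, positive weights), and $\mathcal{O}_K=\bigcup_{k=1}^K\mathcal{E}_k$. A concentration parameter $\overline{\alpha}>0$ is known and fixed throughout. For $G=\sum_{k}\tilde\alpha_k\delta_{\theta_k}$ and document length $N$, the LDA probability mass function on $\{1,\dots,V\}^N$ is $$p^{\mathscr{L}}_{G,N}(x)=\mathbb{E}_{q\sim\mathrm{Dir}_{\overline{\alpha}\tilde\alpha}}\prod_{j=1}^N\Big(\sum_{k}q_k\theta_{kx_j}\Big).$$ $d_{TV}(p,p')=\frac12\sum_x|p(x)-p'(x)|$. For $r\ge1$, $W_r$ is the Wasserstein-$r$ distance: for $G=\sum_{i=1}^K\tilde\alpha_i\delta_{\theta_i}$ and $G'=\sum_{j=1}^{K'}\tilde\alpha'_j\delta_{\theta'_j}$, $W_r^r(G,G')=\inf_q\sum_{i,j}q_{ij}\|\theta_i-\theta_j'\|^r$,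 the infimum being over couplings $q$ of $\tilde\alpha$ and $\tilde\alpha'$, with $\|\cdot\|$ the Euclidean norm. The inverse bound with exponent $r$ on a class $\mathcal{C}$ of measures is the statement that there is a constant $c>0$ such that $$d_{TV}(p^{\mathscr{L}}_{G_0,N},p^{\mathscr{L}}_{G,N})\ge c\,W_r^r(G,G_0)\quad\text{for all }G\in\mathcal{C},$$ where $c$ does not depend on $G$ (it may depend on $G_0$ and $K$). $\mathfrak{N}_1(G_0)$ is the smallest $N$ such that the inverse bound holds on $\mathcal{E}_{K_0}$ with $r=1$. For $K>K_0$, $\mathfrak{N}_2(G_0,K)$ is the smallest $N$ such that the inverse bound holds on $\mathcal{O}_K$ with $r=2$. $\mathfrak{N}_2(G_0)$ is the smallest $N$ such that the inverse bound with $r=2$ holds on $\mathcal{O}_K$ for every $K\ge K_0$ (with constant allowed to depend on $K$). The anchor-word condition: for every $k\in\{1,\dots,K_0\}$ there is $v=v(k)\in\{1,\dots,V\}$ with $\theta^0_{kv}>0$ and $\theta^0_{k'v}=0$ for all $k'\ne k$. *)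

theory Defs
  imports "HOL-Probability.Probability" "HOL-Library.Extended_Nat"
begin

definition prob_simplex :: "(real ^ 'v) set" where
  "prob_simplex = {\<theta>. (\<forall>v. 0 \<le> \<theta> $ v) \<and> (\<Sum>v\<in>UNIV. \<theta> $ v) = 1}"

text \<open>A discrete probability measure is a \<^typ>\<open>(real ^ 'v) pmf\<close>: its atoms are the elements of
  \<^const>\<open>set_pmf\<close>, which are distinct and carry positive weights \<^const>\<open>pmf\<close> by construction.\<close>

definition mixing_exact :: "nat \<Rightarrow> (real ^ 'v) pmf set" where
  "mixing_exact K = {G. finite (set_pmf G) \<and> card (set_pmf G) = K \<and> set_pmf G \<subseteq> prob_simplex}"

definition mixing_atmost :: "nat \<Rightarrow> (real ^ 'v) pmf set" where
  "mixing_atmost K = (\<Union>k\<in>{1..K}. mixing_exact k)"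

definition dirichlet_density :: "'i set \<Rightarrow> ('i \<Rightarrow> real) \<Rightarrow> ('i \<Rightarrow> real) \<Rightarrow> real" where
  "dirichlet_density I a q =
     (if \<forall>i\<in>I. 0 < q i
      then Gamma (\<Sum>i\<in>I. a i) / (\<Prod>i\<in>I. Gamma (a i)) * (\<Prod>i\<in>I. q i powr (a i - 1))
      else 0)"

text \<open>The simplex over a finite nonempty index set \<open>I\<close> is parametrised by the coordinates other than
  one coordinate \<open>b\<close>, and the density is taken with respect to Lebesgue measure in these coordinates.
  The resulting law does not depend on \<open>b\<close>, because exchanging the dropped coordinate is an affine
  map with determinant \<open>-1\<close>. For \<open>I = {b}\<close> the base measure is the point mass of the
  empty product, so the law is the point mass at \<open>q b = 1\<close>.\<close>

definition simplex_complete :: "'i set \<Rightarrow> 'i \<Rightarrow> ('i \<Rightarrow> real) \<Rightarrow> ('i \<Rightarrow> real)" where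
  "simplex_complete I b x = x(b := 1 - (\<Sum>i\<in>I - {b}. x i))"

definition dirichlet :: "'i set \<Rightarrow> ('i \<Rightarrow> real) \<Rightarrow> ('i \<Rightarrow> real) measure" where
  "dirichlet I a =
     (let b = (SOME b. b \<in> I) in
      distr
        (density (PiM (I - {b}) (\<lambda>_. lborel))
           (\<lambda>x. ennreal (dirichlet_density I a (simplex_complete I b x))))
        (PiM I (\<lambda>_. borel))
        (simplex_complete I b))"

text \<open>The word at position \<open>j < N\<close> (counted from 0) of a document \<open>x\<close> of length \<open>N\<close> is \<open>x j\<close>.\<close>

definition documents :: "nat \<Rightarrow> (nat \<Rightarrow> 'v) set" where
  "documents N = {..<N} \<rightarrow>\<^sub>E UNIV"

definition lda_pmf :: "real \<Rightarrow> (real ^ 'v) pmf \<Rightarrow> nat \<Rightarrow> (nat \<Rightarrow> 'v) \<Rightarrow> real" where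
  "lda_pmf \<alpha> G N x =
     (\<integral>q. (\<Prod>j<N. \<Sum>\<theta>\<in>set_pmf G. q \<theta> * \<theta> $ (x j))
        \<partial>(dirichlet (set_pmf G) (\<lambda>\<theta>. \<alpha> * pmf G \<theta>)))"

definition tv_dist ::
    "nat \<Rightarrow> ((nat \<Rightarrow> 'v) \<Rightarrow> real) \<Rightarrow> ((nat \<Rightarrow> 'v) \<Rightarrow> real) \<Rightarrow> real" where
  "tv_dist N p p' = (1/2) * (\<Sum>x\<in>documents N. \<bar>p x - p' x\<bar>)"

definition couplings :: "'a pmf \<Rightarrow> 'b pmf \<Rightarrow> ('a \<times> 'b) pmf set" where
  "couplings G G' = {q. map_pmf fst q = G \<and> map_pmf snd q = G'}"

definition wasserstein :: "real \<Rightarrow> (real ^ 'v) pmf \<Rightarrow> (real ^ 'v) pmf \<Rightarrow> real" where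
  "wasserstein r G G' =
     (INF q\<in>couplings G G'.
        \<Sum>\<theta>\<in>set_pmf G. \<Sum>\<theta>'\<in>set_pmf G'. pmf q (\<theta>, \<theta>') * norm (\<theta> - \<theta>') powr r) powr (1 / r)"

definition inverse_bound ::
    "real \<Rightarrow> real \<Rightarrow> nat \<Rightarrow> (real ^ 'v) pmf \<Rightarrow> (real ^ 'v) pmf set \<Rightarrow> bool" where
  "inverse_bound \<alpha> r N G0 C \<longleftrightarrow>
     (\<exists>c>0. \<forall>G\<in>C. tv_dist N (lda_pmf \<alpha> G0 N) (lda_pmf \<alpha> G N) \<ge> c * wasserstein r G G0 powr r)"

text \<open>The minimal document lengths, with value \<open>\<infinity>\<close> if no length is sufficient.\<close>

definition N1 :: "real \<Rightarrow> (real ^ 'v) pmf \<Rightarrow> enat" where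
  "N1 \<alpha> G0 = Inf {enat N | N. 1 \<le> N \<and>
     inverse_bound \<alpha> 1 N G0 (mixing_exact (card (set_pmf G0)))}"

definition N2 :: "real \<Rightarrow> (real ^ 'v) pmf \<Rightarrow> nat \<Rightarrow> enat" where
  "N2 \<alpha> G0 K = Inf {enat N | N. 1 \<le> N \<and> inverse_bound \<alpha> 2 N G0 (mixing_atmost K)}"

definition N2_all :: "real \<Rightarrow> (real ^ 'v) pmf \<Rightarrow> enat" where
  "N2_all \<alpha> G0 = Inf {enat N | N. 1 \<le> N \<and>
     (\<forall>K\<ge>card (set_pmf G0). inverse_bound \<alpha> 2 N G0 (mixing_atmost K))}"

definition anchor_word :: "(real ^ 'v) set \<Rightarrow> bool" where
  "anchor_word \<Theta> \<longleftrightarrow>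
     (\<forall>\<theta>\<in>\<Theta>. \<exists>v. \<theta> $ v > 0 \<and> (\<forall>\<theta>'\<in>\<Theta>. \<theta>' \<noteq> \<theta> \<longrightarrow> \<theta>' $ v = 0))"

end

theory Submission
  imports Defs
begin

text \<open>Let \<open>Y = \<Sum>\<^sub>\<theta> q\<^sub>\<theta> \<theta>\<close> with \<open>q\<close> Dirichlet distributed with parameters \<open>\<alpha> G(\<theta>)\<close>, so that the
  probability of a document is a mixed moment of \<open>Y\<close>. Drawing from a Polya urn, each position of a
  document either receives a fresh atom of \<open>G\<close> or repeats the atom of another position
  (\<open>dirichlet_mean_insert\<close>). Hence the moment of \<open>Y\<close> of order \<open>n\<close> is a positive multiple of the moment
  of \<open>G\<close> of order \<open>n\<close>, plus a polynomial in lower moments. Solving this triangular system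
  (\<open>controlled_moment\<close>) bounds the difference of all moments of \<open>G\<close> and \<open>G0\<close> of order at most \<open>N\<close>
  by the total variation distance of the laws of documents of length \<open>N\<close>, uniformly over all \<open>G\<close>.
  So for every polynomial \<open>f\<close> of degree at most \<open>N\<close> the difference \<open>\<integral>f dG - \<integral>f dG0\<close> is
  of the order of this distance, say \<open>t\<close> (\<open>poly_deviation\<close>). The coefficients of \<open>f\<close> may depend on \<open>G\<close>
  as long as they stay bounded.

  Conversely the Wasserstein distance is bounded by such differences (\<open>wasserstein_le_tests\<close>). Two
  things are needed: an assignment \<open>\<tau>\<close> of the atoms of \<open>G\<close> to those of \<open>G0\<close> for which
  \<open>\<integral>|\<eta> - \<tau> \<eta>|\<^sup>r dG\<close> is of order \<open>t\<close>, and for each atom \<open>i\<close> of \<open>G0\<close> a polynomial that agrees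
  with the indicator of \<open>i\<close> near the atoms of \<open>G0\<close> up to an error \<open>|\<eta> - k|\<^sup>r\<close>. The latter reads off the
  masses. It is of Hermite type and has degree \<open>2 K\<^sub>0 - 1\<close> in general; if there are linear forms
  \<open>\<ell>\<^sub>i\<close> dual to the atoms of \<open>G0\<close>, it is \<open>\<ell>\<^sub>i\<close> for \<open>r = 1\<close> and \<open>3 \<ell>\<^sub>i\<^sup>2 - 2 \<ell>\<^sub>i\<^sup>3\<close> for \<open>r = 2\<close>.

  For \<open>r = 2\<close> the assignment sends each point to a nearby atom, and the cost is bounded by a
  nonnegative polynomial that vanishes exactly at the atoms of \<open>G0\<close> and grows quadratically
  there. One can take \<open>\<Prod>\<^sub>i |\<eta> - \<theta>\<^sub>i|\<^sup>2\<close>, of degree \<open>2 K\<^sub>0 \<le> K\<^sub>0 + K - 1\<close>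
  (\<open>inverse_bound_W2\<close>), or, with dual forms, the sum of the squares of the residual
  \<open>\<eta> - \<Sum>\<^sub>i \<ell>\<^sub>i(\<eta>) \<theta>\<^sub>i\<close> and of the products \<open>\<ell>\<^sub>i \<ell>\<^sub>j\<close>, of degree \<open>4\<close>
  (\<open>inverse_bound_W2_dual\<close>).

  For \<open>r = 1\<close> the number of atoms of \<open>G\<close> is used through test polynomials that depend on \<open>G\<close>. A
  product of \<open>2 K\<^sub>0 - 1\<close> affine forms that vanishes at all atoms of \<open>G\<close> and at all atoms
  of \<open>G0\<close> but \<open>\<theta>\<close> shows that some atom of \<open>G\<close> lies within order \<open>t\<close> of \<open>\<theta>\<close>
  (\<open>atom_distance_product\<close>, \<open>inverse_bound_W1\<close>). With dual forms, second moments show that the atoms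
  of \<open>G\<close> also have bounded dual forms (\<open>dual_forms\<close>). Multiplying by these isolates single atoms of
  \<open>G\<close>, so that the residual and the products \<open>\<ell>\<^sub>i \<ell>\<^sub>j\<close> have small mean absolute value; this takes
  degree \<open>2\<close> and \<open>3\<close>. Under the anchor word condition the \<open>\<ell>\<^sub>i\<close> are multiples of coordinates, hence
  nonnegative, and degree \<open>2\<close> suffices for the products as well.\<close>

section \<open>Moments of the Dirichlet law\<close>

text \<open>The cut-offs make both sides vanish for \<open>t \<le> 0\<close>, so that the formula can be integrated again
  over a coordinate that is subtracted from \<open>t\<close>.\<close>
lemma nn_integral_scaled_Beta:
  fixes a b t :: real
  assumes "a > 0" "b > 0"
  shows "(\<integral>\<^sup>+y. ennreal ((if 0 < y then y powr (a - 1) else 0) *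
            (if 0 < t - y then (t - y) powr (b - 1) else 0)) \<partial>lborel)
         = ennreal (if 0 < t then t powr (a + b - 1) * Beta a b else 0)"
proof (cases "0 < t")
  case False
  then have "(if 0 < y then y powr (a - 1) else 0) *
            (if 0 < t - y then (t - y) powr (b - 1) else 0) = 0" for y
    by auto
  then have "(\<integral>\<^sup>+y. ennreal ((if 0 < y then y powr (a - 1) else 0) *
            (if 0 < t - y then (t - y) powr (b - 1) else 0)) \<partial>lborel) = (\<integral>\<^sup>+y. 0 \<partial>(lborel :: real measure))"
    by (intro nn_integral_cong) (simp only: ennreal_0)
  with False show ?thesis by simp
next
  case True
  let ?h = "\<lambda>y. (if 0 < y then y powr (a - 1) else 0) *
            (if 0 < t - y then (t - y) powr (b - 1) else 0)"
  have pt: "?h (0 + t * u) = t powr (a + b - 2) *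
      ((u powr (a - 1) * (1 - u) powr (b - 1)) * indicator {0..1} u)" for u
  proof -
    consider "u \<le> 0" | "0 < u" "u < 1" | "u \<ge> 1" by linarith
    then show ?thesis
    proof cases
      case 1
      then have "\<not> 0 < t * u" using True by (simp add: mult_nonneg_nonpos not_less)
      with 1 show ?thesis by (auto simp: indicator_def)
    next
      case 2
      have "t - t * u = t * (1 - u)" by (simp add: algebra_simps)
      moreover have "t powr (a - 1) * t powr (b - 1) = t powr (a + b - 2)"
        by (simp add: powr_add[symmetric] algebra_simps)
      moreover have "0 < t * u" "0 < t - t * u"
        using 2 True by (auto simp: \<open>t - t * u = t * (1 - u)\<close>)
      moreover have "(t * u) powr (a - 1) * (t * (1 - u)) powr (b - 1)
          = (t powr (a - 1) * t powr (b - 1)) * (u powr (a - 1) * (1 - u) powr (b - 1))"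
        using 2 True by (simp only: powr_mult mult_ac)
      ultimately show ?thesis using 2 True by simp
    next
      case 3
      then have "\<not> 0 < t - t * u" using True by simp
      with 3 show ?thesis by (auto simp: indicator_def)
    qed
  qed
  have "(\<integral>\<^sup>+y. ennreal (?h y) \<partial>lborel) = ennreal \<bar>t\<bar> * (\<integral>\<^sup>+u. ennreal (?h (0 + t * u)) \<partial>lborel)"
    using True by (intro nn_integral_real_affine) auto
  also have "(\<integral>\<^sup>+u. ennreal (?h (0 + t * u)) \<partial>lborel)
      = (\<integral>\<^sup>+u. ennreal (t powr (a + b - 2)) *
          ennreal (indicator {0..1} u * (u powr (a - 1) * (1 - u) powr (b - 1))) \<partial>lborel)"
    unfolding pt by (intro nn_integral_cong) (auto simp: ennreal_mult' indicator_def)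
  also have "\<dots> = ennreal (t powr (a + b - 2)) *
      (\<integral>\<^sup>+u. ennreal (indicator {0..1} u * (u powr (a - 1) * (1 - u) powr (b - 1))) \<partial>lborel)"
    by (intro nn_integral_cmult) auto
  also have "(\<integral>\<^sup>+u. ennreal (indicator {0..1} u * (u powr (a - 1) * (1 - u) powr (b - 1))) \<partial>lborel)
      = ennreal (Beta a b)"
    by (rule nn_integral_has_integral_lebesgue[OF _ has_integral_Beta_real[OF assms]]) auto
  finally have "(\<integral>\<^sup>+y. ennreal (?h y) \<partial>lborel)
      = ennreal \<bar>t\<bar> * (ennreal (t powr (a + b - 2)) * ennreal (Beta a b))" .
  also have "\<dots> = ennreal (t * t powr (a + b - 2) * Beta a b)"
    using True by (simp add: ennreal_mult' mult.assoc)
  also have "t * t powr (a + b - 2) = t powr (a + b - 1)"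
    using True by (simp add: powr_mult_base)
  finally show ?thesis using True by simp
qed

interpretation lborel_PiM: product_sigma_finite "\<lambda>_::'i. (lborel :: real measure)"
  by standard

text \<open>Integrating out one coordinate \<open>y\<close> leaves the same integral with total \<open>t - y\<close>, and the power of
  \<open>t - y\<close> obtained from it is the second factor of a Beta integral. Hence the induction is over
  arbitrary totals \<open>t\<close>.\<close>
lemma nn_integral_simplex:
  fixes a :: "'i \<Rightarrow> real" and b :: real
  assumes "finite J" "\<And>i. i \<in> J \<Longrightarrow> a i > 0" "b > 0"
  shows "(\<integral>\<^sup>+x. ennreal ((\<Prod>i\<in>J. if 0 < x i then x i powr (a i - 1) else 0) *
            (if 0 < t - (\<Sum>i\<in>J. x i) then (t - (\<Sum>i\<in>J. x i)) powr (b - 1) else 0))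
            \<partial>(PiM J (\<lambda>_. lborel)))
         = ennreal (if 0 < t then t powr ((\<Sum>i\<in>J. a i) + b - 1) *
            ((\<Prod>i\<in>J. Gamma (a i)) * Gamma b / Gamma ((\<Sum>i\<in>J. a i) + b)) else 0)"
  using assms(1,2)
proof (induction J arbitrary: t)
  case empty
  have "Gamma b \<noteq> 0" using Gamma_real_pos[OF \<open>b > 0\<close>] by simp
  then show ?case by (simp add: lborel_PiM.nn_integral_empty)
next
  case (insert k J)
  let ?w = "\<lambda>c y. if 0 < (y::real) then y powr (c - 1) else (0::real)"
  let ?A = "(\<Sum>i\<in>J. a i) + b"
  let ?C = "(\<Prod>i\<in>J. Gamma (a i)) * Gamma b / Gamma ?A"
  have A: "?A > 0" using insert.prems \<open>b > 0\<close>
    by (intro add_nonneg_pos sum_nonneg) (auto intro: less_imp_le)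
  have C: "?C \<ge> 0" using insert.prems A \<open>b > 0\<close>
    by (intro divide_nonneg_pos mult_nonneg_nonneg prod_nonneg)
       (auto intro!: Gamma_real_pos less_imp_le)
  have "(\<integral>\<^sup>+x. ennreal ((\<Prod>i\<in>insert k J. ?w (a i) (x i)) * ?w b (t - (\<Sum>i\<in>insert k J. x i)))
            \<partial>(PiM (insert k J) (\<lambda>_. lborel)))
     = (\<integral>\<^sup>+y. (\<integral>\<^sup>+x. ennreal ((\<Prod>i\<in>insert k J. ?w (a i) ((x(k:=y)) i)) *
            ?w b (t - (\<Sum>i\<in>insert k J. (x(k:=y)) i))) \<partial>(PiM J (\<lambda>_. lborel))) \<partial>lborel)"
    using insert.hyps by (intro lborel_PiM.product_nn_integral_insert_rev) (auto intro!: measurable_compose[OF _ measurable_ennreal])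
  also have "\<dots> = (\<integral>\<^sup>+y. ennreal ?C * ennreal (?w (a k) y * ?w ?A (t - y)) \<partial>lborel)"
  proof (rule nn_integral_cong)
    fix y :: real
    have p: "(\<Prod>i\<in>J. ?w (a i) ((x(k:=y)) i)) = (\<Prod>i\<in>J. ?w (a i) (x i))" for x
      using insert.hyps by (intro prod.cong) auto
    have s: "(\<Sum>i\<in>J. (x(k:=y)) i) = (\<Sum>i\<in>J. x i)" for x
      using insert.hyps by (intro sum.cong) auto
    have "(\<integral>\<^sup>+x. ennreal ((\<Prod>i\<in>insert k J. ?w (a i) ((x(k:=y)) i)) *
            ?w b (t - (\<Sum>i\<in>insert k J. (x(k:=y)) i))) \<partial>(PiM J (\<lambda>_. lborel)))
      = (\<integral>\<^sup>+x. ennreal (?w (a k) y) * ennreal ((\<Prod>i\<in>J. ?w (a i) (x i)) *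
            ?w b ((t - y) - (\<Sum>i\<in>J. x i))) \<partial>(PiM J (\<lambda>_. lborel)))"
      using insert.hyps
      by (intro nn_integral_cong)
         (simp only: prod.insert sum.insert p s ennreal_mult' fun_upd_same mult.assoc
           diff_diff_eq[symmetric] if_True zero_le_power powr_ge_zero order_refl simp_thms
           flip: ennreal_mult' split: if_split)
    also have "\<dots> = ennreal (?w (a k) y) * (\<integral>\<^sup>+x. ennreal ((\<Prod>i\<in>J. ?w (a i) (x i)) *
            ?w b ((t - y) - (\<Sum>i\<in>J. x i))) \<partial>(PiM J (\<lambda>_. lborel)))"
      by (intro nn_integral_cmult) auto
    also have "\<dots> = ennreal (?w (a k) y) * ennreal (if 0 < t - y then (t - y) powr (?A - 1) * ?C else 0)"
      using insert.IH[of "t - y"] insert.prems by simp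
    also have "\<dots> = ennreal ?C * ennreal (?w (a k) y * ?w ?A (t - y))"
      using C by (simp add: ennreal_mult'[symmetric] mult_ac)
    finally show "(\<integral>\<^sup>+x. ennreal ((\<Prod>i\<in>insert k J. ?w (a i) ((x(k:=y)) i)) *
            ?w b (t - (\<Sum>i\<in>insert k J. (x(k:=y)) i))) \<partial>(PiM J (\<lambda>_. lborel)))
         = ennreal ?C * ennreal (?w (a k) y * ?w ?A (t - y))" .
  qed
  also have "\<dots> = ennreal ?C * (\<integral>\<^sup>+y. ennreal (?w (a k) y * ?w ?A (t - y)) \<partial>lborel)"
    by (intro nn_integral_cmult) auto
  also have "\<dots> = ennreal ?C * ennreal (if 0 < t then t powr (a k + ?A - 1) * Beta (a k) ?A else 0)"
    using insert.prems A by (subst nn_integral_scaled_Beta) auto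
  also have "\<dots> = ennreal (?C * (if 0 < t then t powr (a k + ?A - 1) * Beta (a k) ?A else 0))"
    using C by (rule ennreal_mult'[symmetric])
  also have "?C * (if 0 < t then t powr (a k + ?A - 1) * Beta (a k) ?A else 0)
     = (if 0 < t then t powr ((\<Sum>i\<in>insert k J. a i) + b - 1) *
            ((\<Prod>i\<in>insert k J. Gamma (a i)) * Gamma b / Gamma ((\<Sum>i\<in>insert k J. a i) + b)) else 0)"
  proof -
    have "Gamma ?A \<noteq> 0" using Gamma_real_pos[OF A] by simp
    then show ?thesis using insert.hyps by (simp add: Beta_def add.assoc)
  qed
  finally show ?case .
qed

text \<open>A monomial shifts the parameters of the density from \<open>a i\<close> to \<open>a i + n i\<close>, so its mean is a quotient
  of normalising constants.\<close>
lemma has_bochner_integral_dirichlet_monomial: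
  fixes a :: "'i \<Rightarrow> real" and n :: "'i \<Rightarrow> nat"
  assumes I: "finite I" "I \<noteq> {}" and a: "\<And>i. i \<in> I \<Longrightarrow> a i > 0"
  shows "has_bochner_integral (dirichlet I a) (\<lambda>q. \<Prod>i\<in>I. q i ^ n i)
    (Gamma (\<Sum>i\<in>I. a i) / Gamma (\<Sum>i\<in>I. a i + n i) *
      (\<Prod>i\<in>I. Gamma (a i + n i) / Gamma (a i)))"
proof -
  define b where "b = (SOME b. b \<in> I)"
  have b: "b \<in> I" unfolding b_def using I by (simp add: some_in_eq)
  define J where "J = I - {b}"
  have J: "finite J" "b \<notin> J" "I = insert b J" using I b by (auto simp: J_def)
  let ?P = "PiM J (\<lambda>_. lborel :: real measure)"
  let ?c = "Gamma (\<Sum>i\<in>I. a i) / (\<Prod>i\<in>I. Gamma (a i))"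
  have c: "?c > 0"
    using I a by (intro divide_pos_pos Gamma_real_pos prod_pos sum_pos) auto
  have meas: "simplex_complete I b \<in> measurable ?P (PiM I (\<lambda>_. borel))"
  proof -
    have "(\<lambda>x. x(b := 1 - (\<Sum>i\<in>J. x i))) \<in> measurable ?P (PiM (insert b J) (\<lambda>_. borel))"
    proof (rule measurable_PiM_single')
      fix i assume "i \<in> insert b J"
      then show "(\<lambda>x. (x(b := 1 - (\<Sum>i\<in>J. x i))) i) \<in> measurable ?P borel"
        by (cases "i = b") auto
    qed (auto simp: space_PiM PiE_def extensional_def)
    then show ?thesis unfolding simplex_complete_def J_def[symmetric] J(3)[symmetric] .
  qed
  have mono_meas: "(\<lambda>q. \<Prod>i\<in>I. q i ^ n i) \<in> borel_measurable (PiM I (\<lambda>_. borel :: real measure))"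
    by measurable
  have dens_meas: "(\<lambda>q. dirichlet_density I a q) \<in> borel_measurable (PiM I (\<lambda>_. borel))"
    unfolding dirichlet_density_def using I by measurable
  note [measurable] = measurable_compose[OF meas dens_meas] measurable_compose[OF meas mono_meas]
  have dens_nonneg: "dirichlet_density I a q \<ge> 0" for q
  proof -
    have "0 \<le> ?c * (\<Prod>i\<in>I. q i powr (a i - 1))"
      using c by (intro mult_nonneg_nonneg prod_nonneg) auto
    then have "0 \<le> (if P then ?c * (\<Prod>i\<in>I. q i powr (a i - 1)) else 0)" for P
      by (cases P) simp_all
    then show ?thesis unfolding dirichlet_density_def .
  qed
  let ?F = "\<lambda>x. dirichlet_density I a (simplex_complete I b x) * (\<Prod>i\<in>I. simplex_complete I b x i ^ n i)"
  let ?w = "\<lambda>c y. if 0 < (y::real) then y powr (c - 1) else (0::real)"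
  have F: "?F x = ?c * ((\<Prod>i\<in>J. ?w (a i + n i) (x i)) * ?w (a b + n b) (1 - (\<Sum>i\<in>J. x i)))" for x
  proof -
    let ?q = "simplex_complete I b x"
    have q: "?q b = 1 - (\<Sum>i\<in>J. x i)" "\<And>i. i \<in> J \<Longrightarrow> ?q i = x i"
      by (auto simp: simplex_complete_def J_def)
    have "?F x = ?c * (\<Prod>i\<in>I. ?w (a i + n i) (?q i))"
    proof (cases "\<forall>i\<in>I. 0 < ?q i")
      case True
      have "(\<Prod>i\<in>I. ?q i powr (a i - 1)) * (\<Prod>i\<in>I. ?q i ^ n i) = (\<Prod>i\<in>I. ?w (a i + n i) (?q i))"
        unfolding prod.distrib[symmetric]
      proof (rule prod.cong[OF refl])
        fix i assume "i \<in> I"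
        then have "0 < ?q i" using True by blast
        then have "?q i powr (a i - 1) * ?q i ^ n i = ?q i powr ((a i - 1) + n i)"
          by (simp only: powr_add powr_realpow)
        also have "(a i - 1) + n i = a i + n i - 1" by simp
        finally show "?q i powr (a i - 1) * ?q i ^ n i = ?w (a i + n i) (?q i)"
          using \<open>0 < ?q i\<close> by simp
      qed
      moreover have "dirichlet_density I a ?q = ?c * (\<Prod>i\<in>I. ?q i powr (a i - 1))"
        unfolding dirichlet_density_def by (rule if_P[OF True])
      ultimately show ?thesis by (simp only: mult.assoc)
    next
      case False
      then obtain i where "i \<in> I" "\<not> 0 < ?q i" by blast
      then have "(\<Prod>i\<in>I. ?w (a i + n i) (?q i)) = 0"
        using I by (intro prod_zero) auto
      moreover have "dirichlet_density I a ?q = 0"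
        unfolding dirichlet_density_def by (rule if_not_P[OF False])
      ultimately show ?thesis by (simp only: mult_zero_left mult_zero_right)
    qed
    also have "(\<Prod>i\<in>I. ?w (a i + n i) (?q i)) =
       (\<Prod>i\<in>J. ?w (a i + n i) (x i)) * ?w (a b + n b) (1 - (\<Sum>i\<in>J. x i))"
    proof -
      have "(\<Prod>i\<in>I. ?w (a i + n i) (?q i)) = ?w (a b + n b) (?q b) * (\<Prod>i\<in>I - {b}. ?w (a i + n i) (?q i))"
        using I(1) b by (rule prod.remove)
      also have "(\<Prod>i\<in>I - {b}. ?w (a i + n i) (?q i)) = (\<Prod>i\<in>J. ?w (a i + n i) (x i))"
        unfolding J_def[symmetric] by (rule prod.cong) (simp_all only: q)
      finally show ?thesis by (simp only: q mult.commute)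
    qed
    finally show ?thesis .
  qed
  have Fnn: "?F x \<ge> 0" for x
    unfolding F using less_imp_le[OF c] by (rule mult_nonneg_nonneg) (intro mult_nonneg_nonneg prod_nonneg, simp_all)
  let ?r = "(\<Prod>i\<in>J. Gamma (a i + n i)) * Gamma (a b + n b) / Gamma ((\<Sum>i\<in>J. a i + n i) + (a b + n b))"
  have an: "a i + n i > 0" if "i \<in> I" for i using a[OF that] by simp
  have "0 < (\<Sum>i\<in>J. a i + n i) + (a b + n b)"
    by (rule add_nonneg_pos[OF sum_nonneg an[OF b]]) (use an J(3) in \<open>auto intro!: less_imp_le\<close>)
  then have "0 < Gamma ((\<Sum>i\<in>J. a i + n i) + (a b + n b))" by (rule Gamma_real_pos)
  moreover have "0 < Gamma (a i + n i)" if "i \<in> I" for i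
    using an[OF that] by (rule Gamma_real_pos)
  ultimately have r: "?r \<ge> 0"
    unfolding J(3) by (intro divide_nonneg_nonneg mult_nonneg_nonneg prod_nonneg) (auto intro: less_imp_le)
  have "(\<integral>\<^sup>+x. ennreal (?F x) \<partial>?P) = (\<integral>\<^sup>+x. ennreal ?c * ennreal ((\<Prod>i\<in>J. ?w (a i + n i) (x i)) * ?w (a b + n b) (1 - (\<Sum>i\<in>J. x i))) \<partial>?P)"
    unfolding F using less_imp_le[OF c] by (intro nn_integral_cong) (rule ennreal_mult')
  also have "\<dots> = ennreal ?c * (\<integral>\<^sup>+x. ennreal ((\<Prod>i\<in>J. ?w (a i + n i) (x i)) * ?w (a b + n b) (1 - (\<Sum>i\<in>J. x i))) \<partial>?P)"
    by (intro nn_integral_cmult) auto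
  also have "\<dots> = ennreal ?c * ennreal ?r"
    using nn_integral_simplex[of J "\<lambda>i. a i + n i" "a b + n b" 1] J an by simp
  also have "\<dots> = ennreal (?c * ?r)" using less_imp_le[OF c] by (simp only: ennreal_mult')
  finally have nn: "(\<integral>\<^sup>+x. ennreal (?F x) \<partial>?P) = ennreal (?c * ?r)" .
  have "has_bochner_integral ?P ?F (?c * ?r)"
    using Fnn nn less_imp_le[OF c] r by (intro has_bochner_integral_nn_integral mult_nonneg_nonneg) simp_all
  then have "has_bochner_integral (density ?P (\<lambda>x. ennreal (dirichlet_density I a (simplex_complete I b x))))
      (\<lambda>x. \<Prod>i\<in>I. simplex_complete I b x i ^ n i) (?c * ?r)"
    using dens_nonneg by (intro has_bochner_integral_density) auto
  then have "has_bochner_integral (dirichlet I a) (\<lambda>q. \<Prod>i\<in>I. q i ^ n i) (?c * ?r)"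
    unfolding dirichlet_def b_def[symmetric] Let_def J_def[symmetric]
    using meas mono_meas by (intro has_bochner_integral_distr) auto
  moreover have "?c * ?r = Gamma (\<Sum>i\<in>I. a i) / Gamma (\<Sum>i\<in>I. a i + n i) *
      (\<Prod>i\<in>I. Gamma (a i + n i) / Gamma (a i))"
  proof -
    have s: "(\<Sum>i\<in>I. a i + n i) = (\<Sum>i\<in>J. a i + n i) + (a b + n b)"
      unfolding J(3) using J(1,2) by simp
    have p: "(\<Prod>i\<in>I. Gamma (a i + n i)) = (\<Prod>i\<in>J. Gamma (a i + n i)) * Gamma (a b + n b)"
      unfolding J(3) using J(1,2) by simp
    show ?thesis unfolding s p[symmetric] prod_dividef by simp
  qed
  ultimately show ?thesis by simp
qed

section \<open>Predictive recursion for Dirichlet means\<close>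

definition pmf_mean :: "'a pmf \<Rightarrow> ('a \<Rightarrow> real) \<Rightarrow> real" where
  "pmf_mean G f = (\<Sum>\<theta>\<in>set_pmf G. pmf G \<theta> * f \<theta>)"

text \<open>The probability of a document is the case in which every \<open>\<phi> j\<close> is a coordinate. Arbitrary functions
  are admitted because merging positions multiplies the functions attached to them.\<close>
definition dirichlet_mean :: "real \<Rightarrow> 'a pmf \<Rightarrow> 'j set \<Rightarrow> ('j \<Rightarrow> 'a \<Rightarrow> real) \<Rightarrow> real" where
  "dirichlet_mean \<alpha> G B \<phi> =
     (\<integral>q. (\<Prod>j\<in>B. \<Sum>\<theta>\<in>set_pmf G. q \<theta> * \<phi> j \<theta>) \<partial>dirichlet (set_pmf G) (\<lambda>\<theta>. \<alpha> * pmf G \<theta>))"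

text \<open>The probability that the positions in \<open>B\<close> receive the atoms \<open>g\<close> when they are drawn one after the
  other from a Polya urn with initial masses \<open>\<alpha> G(\<theta>)\<close>.\<close>
definition polya_weight :: "real \<Rightarrow> 'a pmf \<Rightarrow> 'j set \<Rightarrow> ('j \<Rightarrow> 'a) \<Rightarrow> real" where
  "polya_weight \<alpha> G B g = Gamma \<alpha> / Gamma (\<alpha> + card B) *
     (\<Prod>\<theta>\<in>set_pmf G. Gamma (\<alpha> * pmf G \<theta> + card {j\<in>B. g j = \<theta>}) / Gamma (\<alpha> * pmf G \<theta>))"

lemma polya_weight_integral:
  fixes \<alpha> :: real
  assumes "finite (set_pmf G)" "\<alpha> > 0" "finite B" "g \<in> B \<rightarrow> set_pmf G"
  shows "has_bochner_integral (dirichlet (set_pmf G) (\<lambda>\<theta>. \<alpha> * pmf G \<theta>))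
           (\<lambda>q. \<Prod>j\<in>B. q (g j)) (polya_weight \<alpha> G B g)"
proof -
  let ?S = "set_pmf G" and ?n = "\<lambda>\<theta>. card {j\<in>B. g j = \<theta>}"
  have S: "g ` B \<subseteq> ?S" using assms(4) by auto
  have p: "(\<Prod>j\<in>B. q (g j)) = (\<Prod>\<theta>\<in>?S. q \<theta> ^ ?n \<theta>)" for q :: "'a \<Rightarrow> real"
  proof -
    have "(\<Prod>j\<in>B. q (g j)) = (\<Prod>\<theta>\<in>?S. \<Prod>j\<in>{j\<in>B. g j = \<theta>}. q (g j))"
      by (rule prod.group[symmetric]) (use assms S in auto)
    also have "\<dots> = (\<Prod>\<theta>\<in>?S. q \<theta> ^ ?n \<theta>)" by (intro prod.cong) auto
    finally show ?thesis .
  qed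
  have a: "(\<Sum>\<theta>\<in>?S. \<alpha> * pmf G \<theta>) = \<alpha>"
    using assms by (simp add: sum_pmf_eq_1 flip: sum_distrib_left)
  have "(\<Sum>\<theta>\<in>?S. \<Sum>j\<in>{j\<in>B. g j = \<theta>}. 1) = (\<Sum>j\<in>B. 1::nat)"
    by (rule sum.group) (use assms S in auto)
  then have n: "(\<Sum>\<theta>\<in>?S. ?n \<theta>) = card B" by simp
  have an: "(\<Sum>\<theta>\<in>?S. \<alpha> * pmf G \<theta> + ?n \<theta>) = \<alpha> + card B"
    unfolding sum.distrib a using n by (simp flip: of_nat_sum)
  show ?thesis
    using has_bochner_integral_dirichlet_monomial[of ?S "\<lambda>\<theta>. \<alpha> * pmf G \<theta>" ?n] assms(1,2)
    unfolding p a an polya_weight_def by (simp add: set_pmf_not_empty pmf_positive)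
qed

lemma polya_weight_cong: "(\<And>j. j \<in> B \<Longrightarrow> g j = g' j) \<Longrightarrow> polya_weight \<alpha> G B g = polya_weight \<alpha> G B g'"
  unfolding polya_weight_def by (intro arg_cong2[where f = "(*)"] prod.cong refl
      arg_cong2[where f = "(/)"] arg_cong[where f = Gamma] arg_cong2[where f = "(+)"]
      arg_cong[where f = real] arg_cong[where f = card]) auto

text \<open>The next draw hits an atom with probability proportional to its initial mass plus the number of
  earlier draws of it.\<close>
lemma polya_weight_insert:
  fixes \<alpha> :: real
  assumes "finite (set_pmf G)" "\<alpha> > 0" "finite B" "b \<notin> B" "g b \<in> set_pmf G"
  shows "(\<alpha> + card B) * polya_weight \<alpha> G (insert b B) g =
    (\<alpha> * pmf G (g b) + card {j\<in>B. g j = g b}) * polya_weight \<alpha> G B g"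
proof -
  let ?S = "set_pmf G" and ?n = "\<lambda>\<theta>. card {j\<in>B. g j = \<theta>}" and ?a = "\<lambda>\<theta>. \<alpha> * pmf G \<theta>"
  let ?R = "\<lambda>\<theta>. Gamma (?a \<theta> + ?n \<theta>) / Gamma (?a \<theta>)"
  have rise: "Gamma (x + real (Suc k)) = (x + k) * Gamma (x + k)" if "x > 0" for x :: real and k
  proof -
    have "x + k > 0" using that by simp
    then have "x + k \<notin> \<int>\<^sub>\<le>\<^sub>0" by (auto elim!: nonpos_Ints_cases)
    then have "Gamma (x + k + 1) = (x + k) * Gamma (x + k)" by (rule Gamma_plus1)
    then show ?thesis by (simp add: add_ac)
  qed
  have n': "card {j \<in> insert b B. g j = \<theta>} = (if \<theta> = g b then Suc (?n \<theta>) else ?n \<theta>)" for \<theta>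
  proof -
    have "{j \<in> insert b B. g j = \<theta>} = (if \<theta> = g b then insert b {j\<in>B. g j = \<theta>} else {j\<in>B. g j = \<theta>})"
      by auto
    then show ?thesis using assms(3,4) by simp
  qed
  have pos: "?a (g b) > 0" using assms by (simp add: pmf_positive)
  have "(\<Prod>\<theta>\<in>?S. Gamma (?a \<theta> + card {j \<in> insert b B. g j = \<theta>}) / Gamma (?a \<theta>))
      = Gamma (?a (g b) + Suc (?n (g b))) / Gamma (?a (g b)) * (\<Prod>\<theta>\<in>?S - {g b}. ?R \<theta>)"
    unfolding n' by (subst prod.remove[OF assms(1,5)]) (auto intro!: prod.cong arg_cong2[where f = "(*)"])
  also have "\<dots> = (?a (g b) + ?n (g b)) * (?R (g b) * (\<Prod>\<theta>\<in>?S - {g b}. ?R \<theta>))"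
    unfolding rise[OF pos] by simp
  also have "?R (g b) * (\<Prod>\<theta>\<in>?S - {g b}. ?R \<theta>) = (\<Prod>\<theta>\<in>?S. ?R \<theta>)"
    by (rule prod.remove[OF assms(1,5), symmetric])
  finally have 1: "(\<Prod>\<theta>\<in>?S. Gamma (?a \<theta> + card {j \<in> insert b B. g j = \<theta>}) / Gamma (?a \<theta>))
      = (?a (g b) + ?n (g b)) * (\<Prod>\<theta>\<in>?S. ?R \<theta>)" .
  have "card (insert b B) = Suc (card B)" using assms by simp
  then have 2: "Gamma (\<alpha> + card (insert b B)) = (\<alpha> + card B) * Gamma (\<alpha> + card B)"
    using rise[OF assms(2)] by simp
  have "\<alpha> + card B \<noteq> 0" using assms(2) by (intro less_imp_neq[symmetric]) simp
  then show ?thesis unfolding polya_weight_def 1 2 by simp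
qed

lemma dirichlet_mean_expand:
  fixes \<alpha> :: real
  assumes "finite (set_pmf G)" "\<alpha> > 0" "finite B"
  shows "dirichlet_mean \<alpha> G B \<phi> =
    (\<Sum>g\<in>B \<rightarrow>\<^sub>E set_pmf G. (\<Prod>j\<in>B. \<phi> j (g j)) * polya_weight \<alpha> G B g)"
proof -
  let ?D = "dirichlet (set_pmf G) (\<lambda>\<theta>. \<alpha> * pmf G \<theta>)"
  have e: "(\<Prod>j\<in>B. \<Sum>\<theta>\<in>set_pmf G. q \<theta> * \<phi> j \<theta>) =
     (\<Sum>g\<in>B \<rightarrow>\<^sub>E set_pmf G. (\<Prod>j\<in>B. \<phi> j (g j)) * (\<Prod>j\<in>B. q (g j)))" for q
    using assms by (subst prod_sum_PiE) (simp_all add: prod.distrib mult.commute)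
  have "has_bochner_integral ?D (\<lambda>q. \<Sum>g\<in>B \<rightarrow>\<^sub>E set_pmf G. (\<Prod>j\<in>B. \<phi> j (g j)) * (\<Prod>j\<in>B. q (g j)))
     (\<Sum>g\<in>B \<rightarrow>\<^sub>E set_pmf G. (\<Prod>j\<in>B. \<phi> j (g j)) * polya_weight \<alpha> G B g)"
    by (intro has_bochner_integral_sum has_bochner_integral_mult_right polya_weight_integral assms)
       (auto simp: PiE_def)
  then show ?thesis
    unfolding dirichlet_mean_def e by (rule has_bochner_integral_integral_eq)
qed

text \<open>The two summands correspond to the two parts of the urn: position \<open>b\<close> receives a fresh atom of \<open>G\<close>,
  or it repeats the atom at position \<open>j\<close>, where both functions are then evaluated.\<close>
theorem dirichlet_mean_insert:
  fixes \<alpha> :: real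
  assumes "finite (set_pmf G)" "\<alpha> > 0" "finite B" "b \<notin> B"
  shows "(\<alpha> + card B) * dirichlet_mean \<alpha> G (insert b B) \<phi> =
    \<alpha> * pmf_mean G (\<phi> b) * dirichlet_mean \<alpha> G B \<phi> +
    (\<Sum>j\<in>B. dirichlet_mean \<alpha> G B (\<phi>(j := \<lambda>\<theta>. \<phi> j \<theta> * \<phi> b \<theta>)))"
proof -
  let ?S = "set_pmf G" and ?W = "\<lambda>g. \<Prod>j\<in>B. \<phi> j (g j)" and ?P = "polya_weight \<alpha> G B"
  let ?E = "B \<rightarrow>\<^sub>E set_pmf G"
  have "(\<alpha> + card B) * dirichlet_mean \<alpha> G (insert b B) \<phi> =
     (\<Sum>g\<in>insert b B \<rightarrow>\<^sub>E ?S. (\<Prod>j\<in>insert b B. \<phi> j (g j)) * ((\<alpha> + card B) * polya_weight \<alpha> G (insert b B) g))"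
    using assms by (subst dirichlet_mean_expand) (auto simp: sum_distrib_left mult_ac)
  also have "\<dots> = (\<Sum>(k, g)\<in>?S \<times> ?E. (\<Prod>j\<in>insert b B. \<phi> j ((g(b:=k)) j)) *
       ((\<alpha> + card B) * polya_weight \<alpha> G (insert b B) (g(b:=k))))"
    unfolding PiE_insert_eq using assms
    by (subst sum.reindex[OF inj_combinator]) (auto simp: case_prod_unfold)
  also have "\<dots> = (\<Sum>(k, g)\<in>?S \<times> ?E. \<phi> b k * ?W g * ((\<alpha> * pmf G k + card {j\<in>B. g j = k}) * ?P g))"
  proof (intro sum.cong refl, clarsimp)
    fix k g assume k: "k \<in> ?S" and g: "g \<in> ?E"
    have 1: "(\<Prod>j\<in>insert b B. \<phi> j ((g(b:=k)) j)) = \<phi> b k * ?W g"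
      using assms(3,4) by (auto intro!: prod.cong)
    have 2: "?P (g(b:=k)) = ?P g" using assms(4) by (intro polya_weight_cong) auto
    have 3: "{j\<in>B. (g(b:=k)) j = k} = {j\<in>B. g j = k}" using assms(4) by auto
    show "(\<Prod>j\<in>insert b B. \<phi> j (if j = b then k else g j)) *
       ((\<alpha> + card B) * polya_weight \<alpha> G (insert b B) (g(b:=k)))
      = \<phi> b k * ?W g * ((\<alpha> * pmf G k + card {j\<in>B. g j = k}) * ?P g)"
      using 1 polya_weight_insert[OF assms, of "g(b:=k)"] k unfolding 2 fun_upd_same 3 by (simp add: fun_upd_def)
  qed
  also have "\<dots> = (\<Sum>g\<in>?E. \<Sum>k\<in>?S. \<phi> b k * ?W g * ((\<alpha> * pmf G k + card {j\<in>B. g j = k}) * ?P g))"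
    by (subst sum.swap) (simp add: sum.cartesian_product)
  also have "\<dots> = (\<Sum>g\<in>?E. \<alpha> * pmf_mean G (\<phi> b) * (?W g * ?P g) + (\<Sum>j\<in>B. ?W g * \<phi> b (g j) * ?P g))"
  proof (rule sum.cong[OF refl])
    fix g assume g: "g \<in> ?E"
    have "(\<Sum>k\<in>?S. \<phi> b k * real (card {j\<in>B. g j = k})) = (\<Sum>k\<in>?S. \<Sum>j\<in>{j\<in>B. g j = k}. \<phi> b (g j))"
      by (intro sum.cong) auto
    also have "\<dots> = (\<Sum>j\<in>B. \<phi> b (g j))"
      using assms g by (intro sum.group) auto
    finally have c: "(\<Sum>k\<in>?S. \<phi> b k * real (card {j\<in>B. g j = k})) = (\<Sum>j\<in>B. \<phi> b (g j))" .
    have "(\<Sum>k\<in>?S. \<phi> b k * ?W g * ((\<alpha> * pmf G k + card {j\<in>B. g j = k}) * ?P g)) =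
      \<alpha> * pmf_mean G (\<phi> b) * (?W g * ?P g) + (\<Sum>k\<in>?S. \<phi> b k * real (card {j\<in>B. g j = k})) * (?W g * ?P g)"
      unfolding pmf_mean_def sum_distrib_left sum_distrib_right sum.distrib[symmetric]
      by (intro sum.cong refl) (simp add: algebra_simps)
    then show "(\<Sum>k\<in>?S. \<phi> b k * ?W g * ((\<alpha> * pmf G k + card {j\<in>B. g j = k}) * ?P g)) =
      \<alpha> * pmf_mean G (\<phi> b) * (?W g * ?P g) + (\<Sum>j\<in>B. ?W g * \<phi> b (g j) * ?P g)"
      unfolding c by (simp add: sum_distrib_left sum_distrib_right mult_ac)
  qed
  also have "\<dots> = \<alpha> * pmf_mean G (\<phi> b) * (\<Sum>g\<in>?E. ?W g * ?P g) +
      (\<Sum>j\<in>B. \<Sum>g\<in>?E. ?W g * \<phi> b (g j) * ?P g)"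
    unfolding sum.distrib sum_distrib_left[symmetric] by (subst sum.swap) simp
  also have "(\<Sum>g\<in>?E. ?W g * ?P g) = dirichlet_mean \<alpha> G B \<phi>"
    using assms by (simp add: dirichlet_mean_expand)
  also have "(\<Sum>j\<in>B. \<Sum>g\<in>?E. ?W g * \<phi> b (g j) * ?P g) =
     (\<Sum>j\<in>B. dirichlet_mean \<alpha> G B (\<phi>(j := \<lambda>\<theta>. \<phi> j \<theta> * \<phi> b \<theta>)))"
  proof (rule sum.cong[OF refl])
    fix j assume j: "j \<in> B"
    have "(\<Prod>i\<in>B. (\<phi>(j := \<lambda>\<theta>. \<phi> j \<theta> * \<phi> b \<theta>)) i (g i)) = ?W g * \<phi> b (g j)" for g
      by (subst (1 2) prod.remove[OF assms(3) j]) (auto intro!: prod.cong)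
    then show "(\<Sum>g\<in>?E. ?W g * \<phi> b (g j) * ?P g) = dirichlet_mean \<alpha> G B (\<phi>(j := \<lambda>\<theta>. \<phi> j \<theta> * \<phi> b \<theta>))"
      using assms by (simp add: dirichlet_mean_expand)
  qed
  finally show ?thesis .
qed

lemma dirichlet_mean_empty: 
  assumes "finite (set_pmf G)" "\<alpha> > 0"
  shows "dirichlet_mean \<alpha> G {} \<phi> = 1"
proof -
  have "Gamma (\<alpha> * pmf G \<theta>) \<noteq> 0" if "\<theta> \<in> set_pmf G" for \<theta>
  proof -
    have "0 < \<alpha> * pmf G \<theta>" using that assms by (simp add: pmf_positive)
    then have "0 < Gamma (\<alpha> * pmf G \<theta>)" by (rule Gamma_real_pos)
    then show ?thesis by simp
  qed
  moreover have "Gamma \<alpha> \<noteq> 0" using Gamma_real_pos[OF assms(2)] by simp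
  ultimately show ?thesis using assms
    by (simp add: dirichlet_mean_expand polya_weight_def)
qed

section \<open>Moments of the mixing measure from the law of the words\<close>

lemma dirichlet_mean_cong:
  assumes "\<And>j \<theta>. j \<in> B \<Longrightarrow> \<theta> \<in> set_pmf G \<Longrightarrow> \<phi> j \<theta> = \<psi> j \<theta>"
  shows "dirichlet_mean \<alpha> G B \<phi> = dirichlet_mean \<alpha> G B \<psi>"
  unfolding dirichlet_mean_def
  by (intro Bochner_Integration.integral_cong refl prod.cong sum.cong) (simp add: assms)

lemma dirichlet_mean_sum:
  fixes \<alpha> :: real
  assumes "finite (set_pmf G)" "\<alpha> > 0" "finite B" "b \<in> B"
  shows "(\<Sum>v\<in>V. dirichlet_mean \<alpha> G B (\<phi>(b := f v))) = dirichlet_mean \<alpha> G B (\<phi>(b := \<lambda>\<theta>. \<Sum>v\<in>V. f v \<theta>))"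
proof -
  have p: "(\<Prod>j\<in>B. (\<phi>(b := h)) j (g j)) = h (g b) * (\<Prod>j\<in>B - {b}. \<phi> j (g j))" for h g
    by (subst prod.remove[OF assms(3,4)]) (auto intro!: arg_cong2[where f = "(*)"] prod.cong)
  show ?thesis
    unfolding dirichlet_mean_expand[OF assms(1-3)] p sum_distrib_right by (rule sum.swap)
qed

lemma pmf_mean_const [simp]: "finite (set_pmf G) \<Longrightarrow> pmf_mean G (\<lambda>_. c) = c"
  by (simp add: pmf_mean_def sum_pmf_eq_1 flip: sum_distrib_right)

lemma pmf_mean_cong: "(\<And>\<theta>. \<theta> \<in> set_pmf G \<Longrightarrow> f \<theta> = g \<theta>) \<Longrightarrow> pmf_mean G f = pmf_mean G g"
  unfolding pmf_mean_def by (intro sum.cong) auto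

lemma pmf_mean_sum: "pmf_mean G (\<lambda>\<theta>. \<Sum>i\<in>I. f i \<theta>) = (\<Sum>i\<in>I. pmf_mean G (f i))"
  unfolding pmf_mean_def by (simp add: sum_distrib_left) (rule sum.swap)

lemma pmf_mean_add: "pmf_mean G (\<lambda>\<theta>. f \<theta> + g \<theta>) = pmf_mean G f + pmf_mean G g"
  unfolding pmf_mean_def by (simp add: algebra_simps sum.distrib)

lemma pmf_mean_diff: "pmf_mean G (\<lambda>\<theta>. f \<theta> - g \<theta>) = pmf_mean G f - pmf_mean G g"
  unfolding pmf_mean_def by (simp add: algebra_simps sum_subtractf)

lemma pmf_mean_cmult: "pmf_mean G (\<lambda>\<theta>. c * f \<theta>) = c * pmf_mean G f"
  unfolding pmf_mean_def by (simp add: algebra_simps sum_distrib_left)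

lemma pmf_mean_mono: "(\<And>\<theta>. \<theta> \<in> set_pmf G \<Longrightarrow> f \<theta> \<le> g \<theta>) \<Longrightarrow> pmf_mean G f \<le> pmf_mean G g"
  unfolding pmf_mean_def by (intro sum_mono mult_left_mono) auto

lemma pmf_mean_abs_le: "\<bar>pmf_mean G f\<bar> \<le> pmf_mean G (\<lambda>\<theta>. \<bar>f \<theta>\<bar>)"
  unfolding pmf_mean_def by (rule order_trans[OF sum_abs]) (simp add: abs_mult)

lemma prob_simplex_coord:
  assumes "\<theta> \<in> prob_simplex" shows "0 \<le> \<theta> $ v" "\<theta> $ v \<le> 1" "(\<Sum>v\<in>UNIV. \<theta> $ v) = 1"
proof -
  show n: "0 \<le> \<theta> $ v" and s: "(\<Sum>v\<in>UNIV. \<theta> $ v) = 1" using assms by (auto simp: prob_simplex_def)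
  have "\<theta> $ v \<le> (\<Sum>v\<in>UNIV. \<theta> $ v)"
    by (rule member_le_sum) (use assms in \<open>auto simp: prob_simplex_def\<close>)
  with s show "\<theta> $ v \<le> 1" by simp
qed

definition simplex_pmf :: "(real ^ 'v) pmf \<Rightarrow> bool" where
  "simplex_pmf G \<longleftrightarrow> finite (set_pmf G) \<and> set_pmf G \<subseteq> prob_simplex"

lemma documents_finite [simp]: "finite (documents N :: (nat \<Rightarrow> 'v::finite) set)"
  unfolding documents_def by (rule finite_PiE) auto

locale lda_reference =
  fixes \<alpha> :: real and N :: nat and G0 :: "(real ^ 'v) pmf"
  assumes \<alpha>_pos: "\<alpha> > 0" and G0: "simplex_pmf G0"
begin

definition tv :: "(real ^ 'v) pmf \<Rightarrow> real" where
  "tv G = tv_dist N (lda_pmf \<alpha> G0 N) (lda_pmf \<alpha> G N)"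

lemma tv_nonneg [simp]: "0 \<le> tv G"
  unfolding tv_def tv_dist_def by (simp add: sum_nonneg)

text \<open>The bound is uniform over all \<open>G\<close> on the simplex, whatever their number of atoms.\<close>
definition controlled :: "((real ^ 'v) pmf \<Rightarrow> real) \<Rightarrow> bool" where
  "controlled F \<longleftrightarrow> (\<exists>C\<ge>0. \<forall>G. simplex_pmf G \<longrightarrow> \<bar>F G - F G0\<bar> \<le> C * tv G)"

lemma controlledI:
  assumes "\<And>G. simplex_pmf G \<Longrightarrow> \<bar>F G - F G0\<bar> \<le> C * tv G"
  shows "controlled F"
proof -
  have "\<bar>F G - F G0\<bar> \<le> \<bar>C\<bar> * tv G" if "simplex_pmf G" for G
    by (rule order_trans[OF assms[OF that] mult_right_mono]) simp_all
  then show ?thesis unfolding controlled_def by (intro exI[of _ "\<bar>C\<bar>"]) auto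
qed

lemma controlled_const: "controlled (\<lambda>_. c)"
  by (rule controlledI[of _ 0]) simp

lemma controlled_cong:
  assumes "\<And>G. simplex_pmf G \<Longrightarrow> F G = F' G" "controlled F'" shows "controlled F"
  using assms(2) unfolding controlled_def by (simp add: assms(1) G0 cong: imp_cong)

lemma controlled_add:
  assumes "controlled F" "controlled F'" shows "controlled (\<lambda>G. F G + F' G)"
proof -
  obtain C C' where C: "\<And>G. simplex_pmf G \<Longrightarrow> \<bar>F G - F G0\<bar> \<le> C * tv G"
    and C': "\<And>G. simplex_pmf G \<Longrightarrow> \<bar>F' G - F' G0\<bar> \<le> C' * tv G"
    using assms unfolding controlled_def by blast
  show ?thesis
  proof (rule controlledI)
    fix G :: "(real ^ 'v) pmf" assume "simplex_pmf G"
    from C[OF this] C'[OF this] show "\<bar>F G + F' G - (F G0 + F' G0)\<bar> \<le> (C + C') * tv G"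
      by (simp add: algebra_simps)
  qed
qed

lemma controlled_sum:
  assumes "finite I" "\<And>i. i \<in> I \<Longrightarrow> controlled (F i)" shows "controlled (\<lambda>G. \<Sum>i\<in>I. F i G)"
  using assms by (induction I) (auto intro: controlled_const controlled_add)

text \<open>A product is controlled as soon as one of the factors is bounded uniformly in \<open>G\<close>.\<close>

lemma controlled_mult:
  assumes F: "controlled F" and H: "controlled H" and b: "\<And>G. simplex_pmf G \<Longrightarrow> \<bar>H G\<bar> \<le> b"
  shows "controlled (\<lambda>G. F G * H G)"
proof -
  obtain C C' where C: "C \<ge> 0" "\<And>G. simplex_pmf G \<Longrightarrow> \<bar>F G - F G0\<bar> \<le> C * tv G"
    and C': "\<And>G. simplex_pmf G \<Longrightarrow> \<bar>H G - H G0\<bar> \<le> C' * tv G"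
    using F H unfolding controlled_def by blast
  show ?thesis
  proof (rule controlledI)
    fix G :: "(real ^ 'v) pmf" assume G: "simplex_pmf G"
    have "F G * H G - F G0 * H G0 = (F G - F G0) * H G + F G0 * (H G - H G0)"
      by (simp add: algebra_simps)
    then have "\<bar>F G * H G - F G0 * H G0\<bar> \<le> \<bar>F G - F G0\<bar> * \<bar>H G\<bar> + \<bar>F G0\<bar> * \<bar>H G - H G0\<bar>"
      by (metis abs_mult abs_triangle_ineq)
    also have "\<dots> \<le> (C * tv G) * b + \<bar>F G0\<bar> * (C' * tv G)"
      using C(2)[OF G] C'[OF G] b[OF G] C(1) by (intro add_mono mult_mono) auto
    finally show "\<bar>F G * H G - F G0 * H G0\<bar> \<le> (C * b + \<bar>F G0\<bar> * C') * tv G"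
      by (simp add: algebra_simps)
  qed
qed

lemma controlled_cmult: "controlled F \<Longrightarrow> controlled (\<lambda>G. c * F G)"
  using controlled_mult[OF _ controlled_const[of c], of F "\<bar>c\<bar>"] by (simp add: mult.commute)

lemma controlled_diff:
  assumes "controlled F" "controlled F'" shows "controlled (\<lambda>G. F G - F' G)"
  using controlled_add[OF assms(1) controlled_cmult[OF assms(2), of "-1"]] by simp

abbreviation word :: "(nat \<Rightarrow> 'v) \<Rightarrow> nat \<Rightarrow> real ^ 'v \<Rightarrow> real" where
  "word x \<equiv> \<lambda>j \<theta>. \<theta> $ x j"

text \<open>Inserting the constant function \<open>1\<close> does not change a Dirichlet mean, by the recursion itself; and
  \<open>1\<close> is the sum of the coordinates on the simplex.\<close>
lemma word_mean_marginal:
  assumes "simplex_pmf G" "finite B" "b \<notin> B"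
  shows "dirichlet_mean \<alpha> G B (word x) = (\<Sum>v\<in>UNIV. dirichlet_mean \<alpha> G (insert b B) (word (x(b := v))))"
proof -
  have G: "finite (set_pmf G)" "set_pmf G \<subseteq> prob_simplex" using assms(1) by (auto simp: simplex_pmf_def)
  let ?one = "(word x)(b := \<lambda>\<theta>. 1)"
  have "(\<Sum>v\<in>UNIV. dirichlet_mean \<alpha> G (insert b B) (word (x(b := v)))) =
      (\<Sum>v\<in>UNIV. dirichlet_mean \<alpha> G (insert b B) ((word x)(b := \<lambda>\<theta>. \<theta> $ v)))"
    by (intro sum.cong refl dirichlet_mean_cong) auto
  also have "\<dots> = dirichlet_mean \<alpha> G (insert b B) ((word x)(b := \<lambda>\<theta>. \<Sum>v\<in>UNIV. \<theta> $ v))"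
    by (rule dirichlet_mean_sum) (use G assms \<alpha>_pos in auto)
  also have "\<dots> = dirichlet_mean \<alpha> G (insert b B) ?one"
    by (rule dirichlet_mean_cong) (use G prob_simplex_coord(3) in auto)
  finally have s: "(\<Sum>v\<in>UNIV. dirichlet_mean \<alpha> G (insert b B) (word (x(b := v)))) = \<dots>" .
  have "dirichlet_mean \<alpha> G B (?one(j := \<lambda>\<theta>. ?one j \<theta> * ?one b \<theta>)) = dirichlet_mean \<alpha> G B (word x)"
    and "dirichlet_mean \<alpha> G B ?one = dirichlet_mean \<alpha> G B (word x)" for j
    using assms(3) by (auto intro!: dirichlet_mean_cong)
  then have "(\<alpha> + card B) * dirichlet_mean \<alpha> G (insert b B) ?one =
      (\<alpha> + card B) * dirichlet_mean \<alpha> G B (word x)"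
    using G \<alpha>_pos assms by (subst dirichlet_mean_insert) (simp_all add: algebra_simps)
  moreover have "\<alpha> + card B > 0" using \<alpha>_pos by simp
  ultimately show ?thesis unfolding s by simp
qed

text \<open>Means over fewer positions than \<open>N\<close> are marginals of the law of documents of length \<open>N\<close>.\<close>
lemma controlled_word_mean:
  assumes "B \<subseteq> {..<N}"
  shows "controlled (\<lambda>G. dirichlet_mean \<alpha> G B (word x))"
  using assms
proof (induction "card ({..<N} - B)" arbitrary: B x)
  case 0
  then have B: "B = {..<N}" by auto
  let ?x = "restrict x {..<N}"
  have d: "?x \<in> documents N" by (auto simp: documents_def)
  have l: "dirichlet_mean \<alpha> G B (word x) = lda_pmf \<alpha> G N ?x" for G
    unfolding B lda_pmf_def dirichlet_mean_def[symmetric] by (rule dirichlet_mean_cong) auto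
  show ?case
  proof (rule controlledI)
    fix G :: "(real ^ 'v) pmf"
    have "\<bar>lda_pmf \<alpha> G0 N ?x - lda_pmf \<alpha> G N ?x\<bar> \<le> (\<Sum>x\<in>documents N. \<bar>lda_pmf \<alpha> G0 N x - lda_pmf \<alpha> G N x\<bar>)"
      by (rule member_le_sum[OF d]) auto
    then show "\<bar>dirichlet_mean \<alpha> G B (word x) - dirichlet_mean \<alpha> G0 B (word x)\<bar> \<le> 2 * tv G"
      unfolding l tv_def tv_dist_def by (simp add: abs_minus_commute)
  qed
next
  case (Suc n)
  then obtain b where b: "b \<in> {..<N} - B"
    by (metis card.empty ex_in_conv nat.distinct(1))
  have B: "finite B" using Suc.prems finite_subset by blast
  have "{..<N} - insert b B = ({..<N} - B) - {b}" by auto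
  then have "n = card ({..<N} - insert b B)"
    using Suc.hyps(2) b by (simp add: card_Diff_singleton)
  then have "controlled (\<lambda>G. \<Sum>v\<in>UNIV. dirichlet_mean \<alpha> G (insert b B) (word (x(b := v))))"
    using Suc.prems b by (intro controlled_sum Suc.hyps(1)) auto
  then show ?case
    by (rule controlled_cong[rotated]) (use word_mean_marginal B b in auto)
qed

definition moment :: "nat set \<Rightarrow> (nat \<Rightarrow> 'v) \<Rightarrow> (real ^ 'v) pmf \<Rightarrow> real" where
  "moment A x G = pmf_mean G (\<lambda>\<theta>. \<Prod>j\<in>A. \<theta> $ x j)"

lemma moment_bounded:
  assumes "simplex_pmf G" shows "\<bar>moment A x G\<bar> \<le> 1"
proof -
  have G: "finite (set_pmf G)" "set_pmf G \<subseteq> prob_simplex" using assms(1) by (auto simp: simplex_pmf_def)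
  have "\<bar>moment A x G\<bar> \<le> pmf_mean G (\<lambda>\<theta>. \<bar>\<Prod>j\<in>A. \<theta> $ x j\<bar>)"
    unfolding moment_def by (rule pmf_mean_abs_le)
  also have "\<dots> \<le> pmf_mean G (\<lambda>_. 1)"
  proof (rule pmf_mean_mono)
    fix \<theta> assume "\<theta> \<in> set_pmf G"
    then have "\<theta> \<in> prob_simplex" using G by auto
    then show "\<bar>\<Prod>j\<in>A. \<theta> $ x j\<bar> \<le> 1"
      unfolding abs_prod by (intro prod_le_1) (auto simp: prob_simplex_coord)
  qed
  finally show ?thesis using G by simp
qed

text \<open>Here \<open>A\<close> is a block of positions that are already merged and placed at \<open>b\<close>. Unfolding the recursion
  at the block, either the block is split off, which leaves a product of a lower moment and a marginal
  of the document law, or it absorbs another position. After all of \<open>B\<close> is absorbed the moment over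
  \<open>A \<union> B\<close> remains; the factor \<open>fact n\<close> counts the orders of absorption. The claim is made for every
  \<open>b\<close> in the block because absorbing \<open>j\<close> moves the block to \<open>j\<close>.\<close>
lemma controlled_merge:
  assumes "finite A" "finite B" "A \<inter> B = {}" "A \<union> B \<subseteq> {..<N}" "b \<in> A"
    and lower: "\<And>A'. A' \<subseteq> {..<N} \<Longrightarrow> card A' < card (A \<union> B) \<Longrightarrow> controlled (moment A' x)"
  shows "controlled (\<lambda>G. dirichlet_mean \<alpha> G (insert b B) ((word x)(b := \<lambda>\<theta>. \<Prod>j\<in>A. \<theta> $ x j))
           - fact (card B) / pochhammer (\<alpha> + 1) (card B) * moment (A \<union> B) x G)"
  using assms
proof (induction "card B" arbitrary: A B b)
  case 0
  then have B: "B = {}" by simp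
  show ?case
  proof (rule controlled_cong[OF _ controlled_const])
    fix G :: "(real ^ 'v) pmf" assume "simplex_pmf G"
    then have G: "finite (set_pmf G)" by (simp add: simplex_pmf_def)
    have "\<alpha> * dirichlet_mean \<alpha> G {b} ((word x)(b := \<lambda>\<theta>. \<Prod>j\<in>A. \<theta> $ x j)) = \<alpha> * moment A x G"
      using dirichlet_mean_insert[OF G \<alpha>_pos finite.emptyI, of b] G \<alpha>_pos
      by (simp add: dirichlet_mean_empty moment_def)
    then show "dirichlet_mean \<alpha> G (insert b B) ((word x)(b := \<lambda>\<theta>. \<Prod>j\<in>A. \<theta> $ x j))
           - fact (card B) / pochhammer (\<alpha> + 1) (card B) * moment (A \<union> B) x G = 0"
      using \<alpha>_pos unfolding B by simp
  qed
next
  case (Suc n)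
  let ?\<phi> = "(word x)(b := \<lambda>\<theta>. \<Prod>j\<in>A. \<theta> $ x j)"
  let ?\<psi> = "\<lambda>j. (word x)(j := \<lambda>\<theta>. \<Prod>i\<in>insert j A. \<theta> $ x i)"
  let ?c = "fact n / pochhammer (\<alpha> + 1) n"
  have bB: "b \<notin> B" using Suc.prems by auto
  have IH: "controlled (\<lambda>G. dirichlet_mean \<alpha> G B (?\<psi> j) - ?c * moment (A \<union> B) x G)" if j: "j \<in> B" for j
  proof -
    have u: "insert j A \<union> (B - {j}) = A \<union> B" "insert j (B - {j}) = B" using j by auto
    have n: "n = card (B - {j})" using Suc.hyps(2) Suc.prems(2) j by simp
    have "controlled (\<lambda>G. dirichlet_mean \<alpha> G (insert j (B - {j})) (?\<psi> j)
       - fact (card (B - {j})) / pochhammer (\<alpha> + 1) (card (B - {j})) * moment (insert j A \<union> (B - {j})) x G)"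
      by (rule Suc.hyps(1)[OF n]) (use Suc.prems j u in auto)
    then show ?thesis unfolding u n .
  qed
  have "card A < card (A \<union> B)"
    using Suc.prems Suc.hyps(2) by (simp add: card_Un_disjoint)
  then have mA: "controlled (moment A x)" using Suc.prems by auto
  have "controlled (\<lambda>G. 1 / (\<alpha> + Suc n) * (\<alpha> * (dirichlet_mean \<alpha> G B (word x) * moment A x G) +
      (\<Sum>j\<in>B. dirichlet_mean \<alpha> G B (?\<psi> j) - ?c * moment (A \<union> B) x G)))"
    using Suc.prems
    by (intro controlled_cmult controlled_add controlled_sum IH controlled_mult[of _ _ 1]
         controlled_word_mean mA moment_bounded) auto
  then show ?case
  proof (rule controlled_cong[rotated])
    fix G :: "(real ^ 'v) pmf" assume "simplex_pmf G"
    then have G: "finite (set_pmf G)" by (simp add: simplex_pmf_def)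
    have 1: "dirichlet_mean \<alpha> G B (?\<phi>(j := \<lambda>\<theta>. ?\<phi> j \<theta> * ?\<phi> b \<theta>)) = dirichlet_mean \<alpha> G B (?\<psi> j)" if "j \<in> B" for j
    proof -
      have "j \<notin> A" "j \<noteq> b" using that bB Suc.prems(3) by auto
      then show ?thesis using bB Suc.prems(1) by (intro dirichlet_mean_cong) auto
    qed
    have 2: "dirichlet_mean \<alpha> G B ?\<phi> = dirichlet_mean \<alpha> G B (word x)"
      using bB by (intro dirichlet_mean_cong) auto
    have 3: "(\<Sum>j\<in>B. dirichlet_mean \<alpha> G B (?\<phi>(j := \<lambda>\<theta>. ?\<phi> j \<theta> * ?\<phi> b \<theta>))) =
        (\<Sum>j\<in>B. dirichlet_mean \<alpha> G B (?\<psi> j))"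
      by (rule sum.cong[OF refl]) (rule 1)
    have "(\<alpha> + card B) * dirichlet_mean \<alpha> G (insert b B) ?\<phi> =
        \<alpha> * moment A x G * dirichlet_mean \<alpha> G B (word x) + (\<Sum>j\<in>B. dirichlet_mean \<alpha> G B (?\<psi> j))"
      using dirichlet_mean_insert[OF G \<alpha>_pos Suc.prems(2) bB, of ?\<phi>]
      unfolding 3 unfolding 2 by (simp only: moment_def fun_upd_same)
    moreover have "(\<Sum>j\<in>B. dirichlet_mean \<alpha> G B (?\<psi> j) - ?c * moment (A \<union> B) x G) =
        (\<Sum>j\<in>B. dirichlet_mean \<alpha> G B (?\<psi> j)) - Suc n * ?c * moment (A \<union> B) x G"
      using Suc.hyps(2) by (simp add: sum_subtractf)
    ultimately have "(\<alpha> * (dirichlet_mean \<alpha> G B (word x) * moment A x G) +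
      (\<Sum>j\<in>B. dirichlet_mean \<alpha> G B (?\<psi> j) - ?c * moment (A \<union> B) x G)) =
      (\<alpha> + Suc n) * dirichlet_mean \<alpha> G (insert b B) ?\<phi> - Suc n * ?c * moment (A \<union> B) x G"
      using Suc.hyps(2) by (simp add: algebra_simps)
    moreover have p: "\<alpha> + Suc n > 0" using \<alpha>_pos by simp
    moreover have "fact (Suc n) / pochhammer (\<alpha> + 1) (Suc n) = Suc n * ?c / (\<alpha> + Suc n)"
      by (simp add: pochhammer_Suc add_ac mult_ac)
    ultimately show "dirichlet_mean \<alpha> G (insert b B) ?\<phi>
           - fact (card B) / pochhammer (\<alpha> + 1) (card B) * moment (A \<union> B) x G =
      1 / (\<alpha> + Suc n) * (\<alpha> * (dirichlet_mean \<alpha> G B (word x) * moment A x G) +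
      (\<Sum>j\<in>B. dirichlet_mean \<alpha> G B (?\<psi> j) - ?c * moment (A \<union> B) x G))"
      unfolding Suc.hyps(2)[symmetric] by (simp add: diff_divide_distrib)
  qed
qed

text \<open>Starting from a block of one position, the Dirichlet mean is itself controlled, and since the
  coefficient of the top moment is nonzero, the relation can be solved for this moment.\<close>
theorem controlled_moment:
  assumes "A \<subseteq> {..<N}" shows "controlled (moment A x)"
  using assms
proof (induction "card A" arbitrary: A rule: less_induct)
  case less
  have fin: "finite A" using less.prems finite_subset by blast
  show ?case
  proof (cases "A = {}")
    case True
    show ?thesis
      by (rule controlled_cong[OF _ controlled_const[of 1]]) (simp add: True moment_def simplex_pmf_def)
  next
    case False
    then obtain b where b: "b \<in> A" by auto
    let ?B = "A - {b}"
    let ?c = "fact (card ?B) / pochhammer (\<alpha> + 1) (card ?B)"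
    have u: "{b} \<union> ?B = A" "insert b ?B = A" using b by auto
    have "controlled (\<lambda>G. dirichlet_mean \<alpha> G (insert b ?B) ((word x)(b := \<lambda>\<theta>. \<Prod>j\<in>{b}. \<theta> $ x j))
           - ?c * moment ({b} \<union> ?B) x G)"
      by (rule controlled_merge) (use less fin b u in auto)
    moreover have "(word x)(b := \<lambda>\<theta>. \<Prod>j\<in>{b}. \<theta> $ x j) = word x" by auto
    ultimately have "controlled (\<lambda>G. dirichlet_mean \<alpha> G A (word x) - ?c * moment A x G)"
      unfolding u by simp
    then have "controlled (\<lambda>G. (1 / ?c) * (dirichlet_mean \<alpha> G A (word x) -
        (dirichlet_mean \<alpha> G A (word x) - ?c * moment A x G)))"
      by (intro controlled_cmult, rule controlled_diff[OF controlled_word_mean[OF less.prems]])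
    moreover have "pochhammer (\<alpha> + 1) (card ?B) > 0" using \<alpha>_pos by (intro pochhammer_pos) simp
    then have "?c \<noteq> 0" by simp
    then have "(1 / ?c) * (X - (X - ?c * m)) = m" for X m :: real by simp
    ultimately show ?thesis by (simp only:)
  qed
qed

text \<open>The forms \<open>t j\<close> may depend on \<open>G\<close> in applications. This is harmless, since there are only finitely
  many monomials and the forms enter through their coefficients.\<close>
lemma linear_product_deviation:
  "\<exists>C\<ge>0. \<forall>G n t. simplex_pmf G \<longrightarrow> n \<le> N \<longrightarrow>
     \<bar>pmf_mean G (\<lambda>\<theta>. \<Prod>j<n. t j \<bullet> \<theta>) - pmf_mean G0 (\<lambda>\<theta>. \<Prod>j<n. t j \<bullet> \<theta>)\<bar>
       \<le> C * (\<Prod>j<n. norm (t j)) * tv G"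
proof -
  have "\<forall>p. \<exists>C\<ge>0. \<forall>G. simplex_pmf G \<longrightarrow> fst p \<le> N \<longrightarrow>
     \<bar>moment {..<fst p} (snd p) G - moment {..<fst p} (snd p) G0\<bar> \<le> C * tv G"
  proof
    fix p :: "nat \<times> (nat \<Rightarrow> 'v)"
    show "\<exists>C\<ge>0. \<forall>G. simplex_pmf G \<longrightarrow> fst p \<le> N \<longrightarrow>
     \<bar>moment {..<fst p} (snd p) G - moment {..<fst p} (snd p) G0\<bar> \<le> C * tv G"
    proof (cases "fst p \<le> N")
      case True
      then have "controlled (moment {..<fst p} (snd p))" by (intro controlled_moment) auto
      then show ?thesis unfolding controlled_def by blast
    qed auto
  qed
  then obtain c where c: "\<And>p. 0 \<le> c p" "\<And>n x G. simplex_pmf G \<Longrightarrow> n \<le> N \<Longrightarrow>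
     \<bar>moment {..<n} x G - moment {..<n} x G0\<bar> \<le> c (n, x) * tv G"
    by (metis fst_conv snd_conv)
  define C where "C = (\<Sum>n\<le>N. \<Sum>x\<in>documents n. c (n, x))"
  show ?thesis
  proof (intro exI[of _ C] conjI allI impI)
    show "0 \<le> C" unfolding C_def by (intro sum_nonneg c)
    fix G :: "(real ^ 'v) pmf" and n and t :: "nat \<Rightarrow> real ^ 'v"
    assume G: "simplex_pmf G" and n: "n \<le> N"
    have e: "pmf_mean H (\<lambda>\<theta>. \<Prod>j<n. t j \<bullet> \<theta>) = (\<Sum>x\<in>documents n. (\<Prod>j<n. t j $ x j) * moment {..<n} x H)" for H
    proof -
      have "(\<Prod>j<n. t j \<bullet> \<theta>) = (\<Sum>x\<in>documents n. (\<Prod>j<n. t j $ x j) * (\<Prod>j<n. \<theta> $ x j))" for \<theta>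
        unfolding inner_vec_def documents_def by (subst prod_sum_PiE) (simp_all add: prod.distrib)
      then show ?thesis by (simp add: pmf_mean_sum pmf_mean_cmult moment_def)
    qed
    have "\<bar>pmf_mean G (\<lambda>\<theta>. \<Prod>j<n. t j \<bullet> \<theta>) - pmf_mean G0 (\<lambda>\<theta>. \<Prod>j<n. t j \<bullet> \<theta>)\<bar>
       = \<bar>\<Sum>x\<in>documents n. (\<Prod>j<n. t j $ x j) * (moment {..<n} x G - moment {..<n} x G0)\<bar>"
      unfolding e by (simp add: sum_subtractf right_diff_distrib)
    also have "\<dots> \<le> (\<Sum>x\<in>documents n. (\<Prod>j<n. norm (t j)) * (c (n, x) * tv G))"
    proof (rule order_trans[OF sum_abs], rule sum_mono)
      fix x
      have "\<bar>\<Prod>j<n. t j $ x j\<bar> \<le> (\<Prod>j<n. norm (t j))"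
        unfolding abs_prod by (intro prod_mono) (auto simp: component_le_norm_cart)
      then show "\<bar>(\<Prod>j<n. t j $ x j) * (moment {..<n} x G - moment {..<n} x G0)\<bar>
          \<le> (\<Prod>j<n. norm (t j)) * (c (n, x) * tv G)"
        unfolding abs_mult by (intro mult_mono c G n) (auto intro: prod_nonneg)
    qed
    also have "\<dots> = (\<Sum>x\<in>documents n. c (n, x)) * ((\<Prod>j<n. norm (t j)) * tv G)"
      by (simp add: sum_distrib_left sum_distrib_right mult_ac)
    also have "\<dots> \<le> C * ((\<Prod>j<n. norm (t j)) * tv G)"
    proof (rule mult_right_mono)
      show "(\<Sum>x\<in>documents n. c (n, x)) \<le> C"
        unfolding C_def by (rule member_le_sum) (use n c in \<open>auto intro: sum_nonneg\<close>)
    qed (auto intro!: mult_nonneg_nonneg prod_nonneg)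
    finally show "\<bar>pmf_mean G (\<lambda>\<theta>. \<Prod>j<n. t j \<bullet> \<theta>) - pmf_mean G0 (\<lambda>\<theta>. \<Prod>j<n. t j \<bullet> \<theta>)\<bar>
       \<le> C * (\<Prod>j<n. norm (t j)) * tv G" by (simp add: mult.assoc)
  qed
qed

end

section \<open>Polynomial test functions\<close>

text \<open>\<open>poly_bound d B f\<close>: the function \<open>f\<close> is a sum of constant multiples of products of at most \<open>d\<close> linear
  forms, and \<open>B\<close> bounds the sum of the products of their norms and constants. Keeping track of \<open>B\<close> allows polynomials that vary with \<open>G\<close>.\<close>
inductive poly_bound :: "nat \<Rightarrow> real \<Rightarrow> ('a::real_inner \<Rightarrow> real) \<Rightarrow> bool" where
  const: "\<bar>c\<bar> \<le> B \<Longrightarrow> poly_bound d B (\<lambda>_. c)"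
| times: "poly_bound d B f \<Longrightarrow> poly_bound (Suc d) (norm t * B) (\<lambda>\<theta>. (t \<bullet> \<theta>) * f \<theta>)"
| add: "poly_bound d B f \<Longrightarrow> poly_bound d B' g \<Longrightarrow> poly_bound d (B + B') (\<lambda>\<theta>. f \<theta> + g \<theta>)"

lemma poly_bound_nonneg: "poly_bound d B f \<Longrightarrow> 0 \<le> B"
  by (induction rule: poly_bound.induct) auto

lemma poly_bound_mono:
  assumes "poly_bound d B f" "d \<le> d'" "B \<le> B'" shows "poly_bound d' B' f"
proof -
  have "poly_bound d' B f"
    using assms(1,2)
  proof (induction arbitrary: d' rule: poly_bound.induct)
    case (times d B f t)
    then obtain e where "d' = Suc e" "d \<le> e" by (metis Suc_le_D Suc_le_mono)
    with times show ?case by (auto intro: poly_bound.times)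
  qed (auto intro: poly_bound.intros)
  from poly_bound.add[OF this poly_bound.const[of 0 "B' - B"]] assms(3) show ?thesis by simp
qed

lemma poly_bound_linear: "poly_bound 1 (norm t) (\<lambda>\<theta>. t \<bullet> \<theta>)"
  using poly_bound.times[OF poly_bound.const[of 1 1 0], of t] by simp

lemma poly_bound_cmult:
  "poly_bound d B f \<Longrightarrow> poly_bound d (\<bar>c\<bar> * B) (\<lambda>\<theta>. c * f \<theta>)"
proof (induction rule: poly_bound.induct)
  case (const c' B d)
  then show ?case by (intro poly_bound.const) (auto simp: abs_mult intro: mult_left_mono)
next
  case (times d B f t)
  from poly_bound.times[OF times.IH, of t] show ?case by (simp add: mult_ac)
next
  case (add d B f B' g)
  from poly_bound.add[OF add.IH] show ?case by (simp add: algebra_simps)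
qed

lemma poly_bound_mult:
  assumes f: "poly_bound d B f" and g: "poly_bound e B' g"
  shows "poly_bound (d + e) (B * B') (\<lambda>\<theta>. f \<theta> * g \<theta>)"
  using f
proof (induction rule: poly_bound.induct)
  case (const c B d)
  have "poly_bound e (\<bar>c\<bar> * B') (\<lambda>\<theta>. c * g \<theta>)" by (rule poly_bound_cmult[OF g])
  then show ?case
    by (rule poly_bound_mono) (use const poly_bound_nonneg[OF g] in \<open>auto intro: mult_right_mono\<close>)
next
  case (times d B f t)
  from poly_bound.times[OF times.IH, of t] show ?case by (simp add: mult.assoc)
next
  case (add d B f B'' h)
  from poly_bound.add[OF add.IH] show ?case by (simp add: algebra_simps)
qed

lemma poly_bound_sum:
  assumes "finite I" "\<And>i. i \<in> I \<Longrightarrow> poly_bound d (B i) (f i)"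
  shows "poly_bound d (\<Sum>i\<in>I. B i) (\<lambda>\<theta>. \<Sum>i\<in>I. f i \<theta>)"
  using assms by (induction I) (auto intro: poly_bound.intros)

lemma poly_bound_prod:
  assumes "finite I" "\<And>i. i \<in> I \<Longrightarrow> poly_bound (d i) (B i) (f i)"
  shows "poly_bound (\<Sum>i\<in>I. d i) (\<Prod>i\<in>I. B i) (\<lambda>\<theta>. \<Prod>i\<in>I. f i \<theta>)"
  using assms by (induction I) (auto intro: poly_bound.intros poly_bound_mult)

lemma poly_bound_affine:
  assumes "norm s \<le> 1" shows "poly_bound 1 (2 * norm t) (\<lambda>\<theta>. t \<bullet> (\<theta> - s))"
proof -
  have "\<bar>- (t \<bullet> s)\<bar> \<le> norm t"
    using Cauchy_Schwarz_ineq2[of t s] mult_left_mono[OF assms norm_ge_zero[of t]] by simp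
  from poly_bound.add[OF poly_bound_linear[of t] poly_bound.const[OF this]] show ?thesis
    by (simp add: inner_diff_right)
qed

context lda_reference begin

lemma poly_deviation_constant:
  "\<exists>C\<ge>0. \<forall>G d B f. simplex_pmf G \<longrightarrow> d \<le> N \<longrightarrow> poly_bound d B f \<longrightarrow>
     \<bar>pmf_mean G f - pmf_mean G0 f\<bar> \<le> C * B * tv G"
proof -
  obtain C where C: "C \<ge> 0" "\<And>G n t. simplex_pmf G \<Longrightarrow> n \<le> N \<Longrightarrow>
     \<bar>pmf_mean G (\<lambda>\<theta>. \<Prod>j<n. t j \<bullet> \<theta>) - pmf_mean G0 (\<lambda>\<theta>. \<Prod>j<n. t j \<bullet> \<theta>)\<bar>
       \<le> C * (\<Prod>j<n. norm (t j)) * tv G"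
    using linear_product_deviation by blast
  have *: "\<bar>pmf_mean G (\<lambda>\<theta>. (\<Prod>j<n. t j \<bullet> \<theta>) * f \<theta>) - pmf_mean G0 (\<lambda>\<theta>. (\<Prod>j<n. t j \<bullet> \<theta>) * f \<theta>)\<bar>
       \<le> C * (\<Prod>j<n. norm (t j)) * B * tv G"
    if "poly_bound d B f" "simplex_pmf G" "n + d \<le> N" for G d B f n t
    using that(1,3)
  proof (induction arbitrary: n t rule: poly_bound.induct)
    case (const c B d)
    let ?p = "\<lambda>\<theta>. \<Prod>j<n. t j \<bullet> \<theta>"
    have "pmf_mean H (\<lambda>\<theta>. ?p \<theta> * c) = c * pmf_mean H ?p" for H
      by (simp add: mult.commute flip: pmf_mean_cmult)
    then have "\<bar>pmf_mean G (\<lambda>\<theta>. ?p \<theta> * c) - pmf_mean G0 (\<lambda>\<theta>. ?p \<theta> * c)\<bar>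
      = \<bar>c\<bar> * \<bar>pmf_mean G ?p - pmf_mean G0 ?p\<bar>" by (simp add: abs_mult flip: right_diff_distrib)
    also have "\<dots> \<le> B * (C * (\<Prod>j<n. norm (t j)) * tv G)"
      using const by (intro mult_mono C that(2)) auto
    finally show ?case by (simp add: mult_ac)
  next
    case (times d B f s)
    let ?t = "t(n := s)"
    have p: "(\<Prod>j<Suc n. ?t j \<bullet> \<theta>) = (\<Prod>j<n. t j \<bullet> \<theta>) * (s \<bullet> \<theta>)" for \<theta> by simp
    have q: "(\<Prod>j<Suc n. norm (?t j)) = (\<Prod>j<n. norm (t j)) * norm s" by simp
    have "\<bar>pmf_mean G (\<lambda>\<theta>. (\<Prod>j<Suc n. ?t j \<bullet> \<theta>) * f \<theta>) - pmf_mean G0 (\<lambda>\<theta>. (\<Prod>j<Suc n. ?t j \<bullet> \<theta>) * f \<theta>)\<bar>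
       \<le> C * (\<Prod>j<Suc n. norm (?t j)) * B * tv G"
      by (rule times.IH) (use times.prems in simp)
    then show ?case unfolding p q by (simp add: mult_ac)
  next
    case (add d B f B' g)
    have "pmf_mean H (\<lambda>\<theta>. (\<Prod>j<n. t j \<bullet> \<theta>) * (f \<theta> + g \<theta>)) =
       pmf_mean H (\<lambda>\<theta>. (\<Prod>j<n. t j \<bullet> \<theta>) * f \<theta>) + pmf_mean H (\<lambda>\<theta>. (\<Prod>j<n. t j \<bullet> \<theta>) * g \<theta>)" for H
      by (simp add: distrib_left flip: pmf_mean_add)
    with add.IH[OF add.prems, of t] show ?case by (simp add: algebra_simps)
  qed
  show ?thesis
  proof (intro exI[of _ C] conjI C allI impI)
    fix G :: "(real ^ 'v) pmf" and d B and f :: "real ^ 'v \<Rightarrow> real"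
    assume "simplex_pmf G" "d \<le> N" "poly_bound d B f"
    from *[OF this(3,1), of 0] this(2) show "\<bar>pmf_mean G f - pmf_mean G0 f\<bar> \<le> C * B * tv G" by simp
  qed
qed

text \<open>A fixed admissible constant, which depends only on \<open>G0\<close>, \<open>\<alpha>\<close> and \<open>N\<close>.\<close>
definition \<kappa> :: real where
  "\<kappa> = (SOME C. C \<ge> 0 \<and> (\<forall>G d B f. simplex_pmf G \<longrightarrow> d \<le> N \<longrightarrow> poly_bound d B f \<longrightarrow>
     \<bar>pmf_mean G f - pmf_mean G0 f\<bar> \<le> C * B * tv G))"

lemma \<kappa>_nonneg: "0 \<le> \<kappa>"
  and poly_deviation: "simplex_pmf G \<Longrightarrow> d \<le> N \<Longrightarrow> poly_bound d B f \<Longrightarrow>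
     \<bar>pmf_mean G f - pmf_mean G0 f\<bar> \<le> \<kappa> * B * tv G"
  using someI_ex[OF poly_deviation_constant] unfolding \<kappa>_def[symmetric] by simp_all

lemma inverse_boundI:
  assumes "\<And>G. G \<in> \<C> \<Longrightarrow> wasserstein r G G0 powr r \<le> K * tv G"
  shows "inverse_bound \<alpha> r N G0 \<C>"
proof -
  let ?c = "1 / (\<bar>K\<bar> + 1)"
  have "?c * wasserstein r G G0 powr r \<le> tv G" if "G \<in> \<C>" for G
  proof -
    have "K * tv G \<le> (\<bar>K\<bar> + 1) * tv G" by (rule mult_right_mono) auto
    with assms[OF that] have "wasserstein r G G0 powr r \<le> (\<bar>K\<bar> + 1) * tv G" by linarith
    then show ?thesis by (simp add: field_simps)
  qed
  moreover have "?c > 0" by simp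
  ultimately show ?thesis unfolding inverse_bound_def tv_def by blast
qed

end

section \<open>Upper bounds for the Wasserstein distance\<close>
lemma prob_simplex_norm_le: "\<theta> \<in> prob_simplex \<Longrightarrow> norm \<theta> \<le> 1"
  using norm_le_l1_cart[of \<theta>] prob_simplex_coord[of \<theta>] by simp

lemma prob_simplex_dist_le: "\<theta> \<in> prob_simplex \<Longrightarrow> \<eta> \<in> prob_simplex \<Longrightarrow> norm (\<theta> - \<eta>) \<le> 2"
  using norm_triangle_ineq4[of \<theta> \<eta>] prob_simplex_norm_le[of \<theta>] prob_simplex_norm_le[of \<eta>] by simp

lemma exists_pmf:
  assumes "finite S" "\<And>x. x \<in> S \<Longrightarrow> 0 \<le> f x" "(\<Sum>x\<in>S. f x) = 1"
  shows "\<exists>p. set_pmf p \<subseteq> S \<and> (\<forall>x\<in>S. pmf p x = f x)"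
proof -
  let ?f = "\<lambda>x. if x \<in> S then f x else 0"
  have "(\<integral>\<^sup>+x. ennreal (?f x) \<partial>count_space UNIV) = (\<Sum>x\<in>S. ennreal (?f x))"
    using assms(1) by (intro nn_integral_count_space') auto
  also have "\<dots> = ennreal (\<Sum>x\<in>S. ?f x)" using assms(2) by (intro sum_ennreal) auto
  also have "\<dots> = 1" using assms(3) by simp
  finally have p: "pmf (embed_pmf ?f) x = ?f x" for x
    using assms(2) by (intro pmf_embed_pmf) auto
  then show ?thesis by (intro exI[of _ "embed_pmf ?f"]) (auto simp: set_pmf_eq split: if_splits)
qed

text \<open>Move each atom \<open>\<eta>\<close> of \<open>G\<close> to \<open>\<tau> \<eta>\<close>, but only with the share of its mass that the atom
  \<open>\<tau> \<eta>\<close> of \<open>G0\<close> can absorb; the excess is spread over the atoms of \<open>G0\<close> that are not yet full.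
  The excess is at most the total mass discrepancy, and travels at most the diameter.\<close>

lemma wasserstein_le_assignment:
  fixes G G0 :: "(real ^ 'v) pmf"
  assumes G: "simplex_pmf G" and G0: "simplex_pmf G0" and r: "r > 0"
    and \<tau>: "\<And>\<eta>. \<eta> \<in> set_pmf G \<Longrightarrow> \<tau> \<eta> \<in> set_pmf G0"
  shows "wasserstein r G G0 powr r \<le> pmf_mean G (\<lambda>\<eta>. norm (\<eta> - \<tau> \<eta>) powr r) +
    2 powr r * (\<Sum>i\<in>set_pmf G0. \<bar>pmf_mean G (\<lambda>\<eta>. of_bool (\<tau> \<eta> = i)) - pmf G0 i\<bar>)"
proof -
  let ?T = "set_pmf G" and ?S = "set_pmf G0"
  have fin: "finite ?T" "finite ?S" and sub: "?T \<subseteq> prob_simplex" "?S \<subseteq> prob_simplex"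
    using G G0 by (auto simp: simplex_pmf_def)
  define p where "p i = pmf_mean G (\<lambda>\<eta>. of_bool (\<tau> \<eta> = i))" for i
  define w where "w = pmf G0"
  define \<rho> where "\<rho> i = min 1 (w i / p i)" for i
  define tot where "tot = (\<Sum>i\<in>?S. max 0 (w i - p i))"
  have p0: "p i \<ge> 0" for i unfolding p_def pmf_mean_def by (intro sum_nonneg) auto
  have w0: "w i \<ge> 0" for i unfolding w_def by simp
  have \<rho>: "0 \<le> \<rho> i" "\<rho> i \<le> 1" for i unfolding \<rho>_def using p0 w0 by auto
  have p\<rho>: "p i * \<rho> i = min (p i) (w i)" for i
    using p0[of i] w0[of i] by (cases "p i = 0") (auto simp: \<rho>_def min_def field_simps)
  have push: "pmf_mean G (\<lambda>\<eta>. F (\<tau> \<eta>)) = (\<Sum>i\<in>?S. p i * F i)" for F :: "real ^ 'v \<Rightarrow> real"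
  proof -
    have "(\<Sum>i\<in>?S. p i * F i) = (\<Sum>i\<in>?S. \<Sum>\<eta>\<in>?T. pmf G \<eta> * of_bool (\<tau> \<eta> = i) * F i)"
      unfolding p_def pmf_mean_def by (simp add: sum_distrib_right)
    also have "\<dots> = (\<Sum>\<eta>\<in>?T. \<Sum>i\<in>?S. pmf G \<eta> * of_bool (\<tau> \<eta> = i) * F i)" by (rule sum.swap)
    also have "\<dots> = (\<Sum>\<eta>\<in>?T. pmf G \<eta> * F (\<tau> \<eta>))"
    proof (rule sum.cong[OF refl])
      fix \<eta> assume "\<eta> \<in> ?T"
      then have "(\<Sum>i\<in>?S. pmf G \<eta> * of_bool (\<tau> \<eta> = i) * F i) = (\<Sum>i\<in>{\<tau> \<eta>}. pmf G \<eta> * of_bool (\<tau> \<eta> = i) * F i)"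
        using \<tau> fin by (intro sum.mono_neutral_right) auto
      then show "(\<Sum>i\<in>?S. pmf G \<eta> * of_bool (\<tau> \<eta> = i) * F i) = pmf G \<eta> * F (\<tau> \<eta>)" by simp
    qed
    finally show ?thesis by (simp add: pmf_mean_def)
  qed
  have sp: "(\<Sum>i\<in>?S. p i) = 1" using push[of "\<lambda>_. 1"] fin by simp
  have sw: "(\<Sum>i\<in>?S. w i) = 1" unfolding w_def using fin by (simp add: sum_pmf_eq_1)
  have "(\<Sum>i\<in>?S. (p i - min (p i) (w i)) - max 0 (w i - p i)) = (\<Sum>i\<in>?S. p i - w i)"
    by (intro sum.cong) (auto simp: min_def max_def)
  then have tot: "(\<Sum>i\<in>?S. p i * (1 - \<rho> i)) = tot"
    using sp sw by (simp add: sum_subtractf tot_def right_diff_distrib p\<rho>)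
  have tot0: "tot \<ge> 0" unfolding tot_def by (intro sum_nonneg) auto
  (* The law of the redistributed mass; if nothing is missing anywhere, all shares are 1 and any law will do. *)
  have "\<exists>\<nu>. set_pmf \<nu> \<subseteq> ?S \<and> (\<forall>i\<in>?S. tot * pmf \<nu> i = max 0 (w i - p i))"
  proof (cases "tot = 0")
    case True
    then have "max 0 (w i - p i) = 0" if "i \<in> ?S" for i
      using that fin by (subst (asm) tot_def, subst (asm) sum_nonneg_eq_0_iff) auto
    with True show ?thesis by (intro exI[of _ G0]) auto
  next
    case False
    have "\<exists>\<nu>. set_pmf \<nu> \<subseteq> ?S \<and> (\<forall>i\<in>?S. pmf \<nu> i = max 0 (w i - p i) / tot)"
      using fin tot0 False by (intro exists_pmf) (auto simp: sum_divide_distrib[symmetric] tot_def)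
    with False show ?thesis by auto
  qed
  then obtain \<nu> where \<nu>: "set_pmf \<nu> \<subseteq> ?S" "\<And>i. i \<in> ?S \<Longrightarrow> tot * pmf \<nu> i = max 0 (w i - p i)"
    by blast
  (* A particle assigned to i stays there with probability \<rho> i and is otherwise sent to \<nu>. *)
  define K where "K i = bind_pmf (bernoulli_pmf (\<rho> i)) (\<lambda>b. if b then return_pmf i else \<nu>)" for i
  have K: "pmf (K i) l = \<rho> i * of_bool (i = l) + (1 - \<rho> i) * pmf \<nu> l" for i l
    unfolding K_def pmf_bind using \<rho> by (simp add: mult.commute indicator_def)
  define q where "q = bind_pmf G (\<lambda>\<eta>. map_pmf (Pair \<eta>) (K (\<tau> \<eta>)))"
  have q: "pmf q (\<eta>, \<theta>) = pmf G \<eta> * pmf (K (\<tau> \<eta>)) \<theta>" for \<eta> \<theta>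
  proof -
    have "pmf (map_pmf (Pair \<eta>') (K (\<tau> \<eta>'))) (\<eta>, \<theta>) = (if \<eta>' = \<eta> then pmf (K (\<tau> \<eta>)) \<theta> else 0)" for \<eta>'
      by (auto simp: pmf_map_inj' inj_on_def pmf_eq_0_set_pmf)
    then have "pmf q (\<eta>, \<theta>) = (\<integral>\<eta>'. (if \<eta>' = \<eta> then pmf (K (\<tau> \<eta>)) \<theta> else 0) \<partial>G)"
      unfolding q_def pmf_bind by simp
    also have "\<dots> = pmf G \<eta> * pmf (K (\<tau> \<eta>)) \<theta>"
      by (subst integral_measure_pmf[of "{\<eta>}"]) (auto split: if_splits)
    finally show ?thesis .
  qed
  have "map_pmf fst q = G"
    unfolding q_def map_bind_pmf map_pmf_comp by (simp add: map_pmf_const bind_return_pmf')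
  moreover have "map_pmf snd q = G0"
  proof -
    have supp: "pmf (K (\<tau> \<eta>)) l = 0" if "\<eta> \<in> ?T" "l \<notin> ?S" for \<eta> l
      using that \<tau>[of \<eta>] \<nu>(1) unfolding K by (auto simp: pmf_eq_0_set_pmf)
    have e: "map_pmf snd q = bind_pmf G (\<lambda>\<eta>. K (\<tau> \<eta>))"
      unfolding q_def map_bind_pmf map_pmf_comp by simp
    have "pmf (bind_pmf G (\<lambda>\<eta>. K (\<tau> \<eta>))) l = w l" for l
    proof -
      have "pmf (bind_pmf G (\<lambda>\<eta>. K (\<tau> \<eta>))) l = pmf_mean G (\<lambda>\<eta>. pmf (K (\<tau> \<eta>)) l)"
        unfolding pmf_bind pmf_mean_def using fin by (subst integral_measure_pmf[of ?T]) auto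
      also have "\<dots> = w l"
      proof (cases "l \<in> ?S")
        case False
        have "pmf_mean G (\<lambda>\<eta>. pmf (K (\<tau> \<eta>)) l) = pmf_mean G (\<lambda>_. 0)"
          using supp False by (intro pmf_mean_cong) auto
        also have "\<dots> = w l" using False fin by (simp add: w_def pmf_eq_0_set_pmf)
        finally show ?thesis .
      next
        case True
        have "pmf_mean G (\<lambda>\<eta>. pmf (K (\<tau> \<eta>)) l) = (\<Sum>i\<in>?S. p i * pmf (K i) l)" by (rule push)
        also have "\<dots> = (\<Sum>i\<in>?S. of_bool (i = l) * (p i * \<rho> i)) + (\<Sum>i\<in>?S. p i * (1 - \<rho> i)) * pmf \<nu> l"
          unfolding K sum_distrib_right sum.distrib[symmetric]
          by (intro sum.cong refl) (simp add: algebra_simps)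
        also have "(\<Sum>i\<in>?S. of_bool (i = l) * (p i * \<rho> i)) = (\<Sum>i\<in>{l}. of_bool (i = l) * (p i * \<rho> i))"
          using fin True by (intro sum.mono_neutral_right) auto
        finally show ?thesis using \<nu>(2)[OF True] by (simp add: tot p\<rho> min_def max_def split: if_splits)
      qed
      finally show ?thesis .
    qed
    then show ?thesis unfolding e by (intro pmf_eqI) (simp add: w_def)
  qed
  ultimately have qc: "q \<in> couplings G G0" by (simp add: couplings_def)
  let ?cost = "\<lambda>q. \<Sum>\<theta>\<in>?T. \<Sum>\<theta>'\<in>?S. pmf q (\<theta>, \<theta>') * norm (\<theta> - \<theta>') powr r"
  have cost0: "0 \<le> ?cost q" for q by (intro sum_nonneg mult_nonneg_nonneg) auto
  have "wasserstein r G G0 powr r = (INF q\<in>couplings G G0. ?cost q)"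
  proof -
    have "0 \<le> (INF q\<in>couplings G G0. ?cost q)" using qc cost0 by (intro cINF_greatest) auto
    then show ?thesis unfolding wasserstein_def powr_powr using r by simp
  qed
  also have "\<dots> \<le> ?cost q"
    by (rule cINF_lower[OF _ qc]) (auto intro!: bdd_belowI2[of _ 0] cost0)
  also have "\<dots> = pmf_mean G (\<lambda>\<eta>. \<Sum>\<theta>\<in>?S. pmf (K (\<tau> \<eta>)) \<theta> * norm (\<eta> - \<theta>) powr r)"
    unfolding q pmf_mean_def by (simp add: sum_distrib_left mult.assoc)
  also have "\<dots> \<le> pmf_mean G (\<lambda>\<eta>. norm (\<eta> - \<tau> \<eta>) powr r + 2 powr r * (1 - \<rho> (\<tau> \<eta>)))"
  proof (rule pmf_mean_mono)
    fix \<eta> assume \<eta>: "\<eta> \<in> ?T"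
    let ?i = "\<tau> \<eta>"
    have "(\<Sum>\<theta>\<in>?S. pmf (K ?i) \<theta> * norm (\<eta> - \<theta>) powr r) =
       (\<Sum>\<theta>\<in>?S. of_bool (?i = \<theta>) * (\<rho> ?i * norm (\<eta> - \<theta>) powr r)) +
       (1 - \<rho> ?i) * (\<Sum>\<theta>\<in>?S. pmf \<nu> \<theta> * norm (\<eta> - \<theta>) powr r)"
      unfolding K sum_distrib_left sum.distrib[symmetric] by (intro sum.cong refl) (simp add: algebra_simps)
    also have "(\<Sum>\<theta>\<in>?S. of_bool (?i = \<theta>) * (\<rho> ?i * norm (\<eta> - \<theta>) powr r)) =
       (\<Sum>\<theta>\<in>{?i}. of_bool (?i = \<theta>) * (\<rho> ?i * norm (\<eta> - \<theta>) powr r))"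
      using fin \<tau>[OF \<eta>] by (intro sum.mono_neutral_right) auto
    also have "\<dots> \<le> norm (\<eta> - ?i) powr r" using \<rho> by (simp add: mult_left_le_one_le)
    also have "(1 - \<rho> ?i) * (\<Sum>\<theta>\<in>?S. pmf \<nu> \<theta> * norm (\<eta> - \<theta>) powr r) \<le> (1 - \<rho> ?i) * (\<Sum>\<theta>\<in>?S. pmf \<nu> \<theta> * 2 powr r)"
      using \<eta> sub r \<rho> by (intro sum_mono mult_left_mono powr_mono2 prob_simplex_dist_le) auto
    also have "(\<Sum>\<theta>\<in>?S. pmf \<nu> \<theta> * 2 powr r) = 2 powr r"
      using fin \<nu>(1) by (simp add: sum_pmf_eq_1 flip: sum_distrib_right)
    finally show "(\<Sum>\<theta>\<in>?S. pmf (K ?i) \<theta> * norm (\<eta> - \<theta>) powr r) \<le>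
       norm (\<eta> - ?i) powr r + 2 powr r * (1 - \<rho> ?i)" by (simp add: mult_ac)
  qed
  also have "\<dots> = pmf_mean G (\<lambda>\<eta>. norm (\<eta> - \<tau> \<eta>) powr r) + 2 powr r * tot"
    using push[of "\<lambda>i. 1 - \<rho> i"] by (simp add: pmf_mean_add pmf_mean_cmult tot)
  also have "tot \<le> (\<Sum>i\<in>?S. \<bar>p i - w i\<bar>)" unfolding tot_def by (intro sum_mono) auto
  finally show ?thesis unfolding p_def w_def by simp
qed

text \<open>The masses near the atoms of \<open>G0\<close> are read off with test functions \<open>g i\<close> that imitate the
  indicator of the cell of \<open>i\<close> up to an error of the order of the transport cost itself.\<close>

lemma wasserstein_le_tests:
  fixes G G0 :: "(real ^ 'v) pmf"
  assumes G: "simplex_pmf G" and G0: "simplex_pmf G0" and r: "r > 0"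
    and \<tau>: "\<And>\<eta>. \<eta> \<in> set_pmf G \<Longrightarrow> \<tau> \<eta> \<in> set_pmf G0"
    and A: "pmf_mean G (\<lambda>\<eta>. norm (\<eta> - \<tau> \<eta>) powr r) \<le> A"
    and g: "\<And>i k \<eta>. i \<in> set_pmf G0 \<Longrightarrow> k \<in> set_pmf G0 \<Longrightarrow> \<eta> \<in> prob_simplex \<Longrightarrow>
       \<bar>g i \<eta> - of_bool (k = i)\<bar> \<le> L * norm (\<eta> - k) powr r"
    and dev: "\<And>i. i \<in> set_pmf G0 \<Longrightarrow> \<bar>pmf_mean G (g i) - pmf_mean G0 (g i)\<bar> \<le> M"
    and L: "L \<ge> 0"
  shows "wasserstein r G G0 powr r \<le> A + 2 powr r * card (set_pmf G0) * (M + L * A)"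
proof -
  let ?T = "set_pmf G" and ?S = "set_pmf G0"
  have fin: "finite ?T" "finite ?S" and sub: "?T \<subseteq> prob_simplex" "?S \<subseteq> prob_simplex"
    using G G0 by (auto simp: simplex_pmf_def)
  have mass: "\<bar>pmf_mean G (\<lambda>\<eta>. of_bool (\<tau> \<eta> = i)) - pmf G0 i\<bar> \<le> M + L * A" if i: "i \<in> ?S" for i
  proof -
    have "g i k = of_bool (k = i)" if "k \<in> ?S" for k
      using g[OF i that, of k] sub that r by auto
    then have "pmf_mean G0 (g i) = (\<Sum>k\<in>?S. pmf G0 k * of_bool (k = i))"
      by (simp add: pmf_mean_def)
    also have "\<dots> = (\<Sum>k\<in>{i}. pmf G0 k * of_bool (k = i))"
      using fin i by (intro sum.mono_neutral_right) auto
    finally have 0: "pmf_mean G0 (g i) = pmf G0 i" by simp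
    have "\<bar>pmf_mean G (\<lambda>\<eta>. of_bool (\<tau> \<eta> = i)) - pmf_mean G (g i)\<bar>
      = \<bar>pmf_mean G (\<lambda>\<eta>. of_bool (\<tau> \<eta> = i) - g i \<eta>)\<bar>" by (simp add: pmf_mean_diff)
    also have "\<dots> \<le> pmf_mean G (\<lambda>\<eta>. \<bar>of_bool (\<tau> \<eta> = i) - g i \<eta>\<bar>)" by (rule pmf_mean_abs_le)
    also have "\<dots> \<le> pmf_mean G (\<lambda>\<eta>. L * norm (\<eta> - \<tau> \<eta>) powr r)"
    proof (rule pmf_mean_mono)
      fix \<eta> assume "\<eta> \<in> ?T"
      then show "\<bar>of_bool (\<tau> \<eta> = i) - g i \<eta>\<bar> \<le> L * norm (\<eta> - \<tau> \<eta>) powr r"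
        using g[OF i \<tau>[of \<eta>], of \<eta>] sub by (subst abs_minus_commute) auto
    qed
    also have "\<dots> \<le> L * A" unfolding pmf_mean_cmult using A L by (rule mult_left_mono)
    finally show ?thesis using dev[OF i] 0 by linarith
  qed
  have "(\<Sum>i\<in>?S. \<bar>pmf_mean G (\<lambda>\<eta>. of_bool (\<tau> \<eta> = i)) - pmf G0 i\<bar>) \<le> (\<Sum>i\<in>?S. M + L * A)"
    by (intro sum_mono mass)
  then have "2 powr r * (\<Sum>i\<in>?S. \<bar>pmf_mean G (\<lambda>\<eta>. of_bool (\<tau> \<eta> = i)) - pmf G0 i\<bar>)
     \<le> 2 powr r * (card ?S * (M + L * A))" by (intro mult_left_mono) auto
  moreover have "wasserstein r G G0 powr r \<le> pmf_mean G (\<lambda>\<eta>. norm (\<eta> - \<tau> \<eta>) powr r) +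
    2 powr r * (\<Sum>i\<in>?S. \<bar>pmf_mean G (\<lambda>\<eta>. of_bool (\<tau> \<eta> = i)) - pmf G0 i\<bar>)"
    by (rule wasserstein_le_assignment[OF G G0 r]) (rule \<tau>)
  ultimately show ?thesis using A unfolding mult.assoc by linarith
qed

context lda_reference begin

text \<open>With test functions for the masses at hand, an inverse bound reduces to an assignment of atoms whose
  cost is of the order of \<open>tv G\<close>.\<close>
lemma wasserstein_control:
  assumes r: "r > 0" and d: "d \<le> N"
    and g: "\<And>i. i \<in> set_pmf G0 \<Longrightarrow> poly_bound d (B i) (g i)"
    and L: "L \<ge> 0" "\<And>i k \<eta>. i \<in> set_pmf G0 \<Longrightarrow> k \<in> set_pmf G0 \<Longrightarrow> \<eta> \<in> prob_simplex \<Longrightarrow>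
       \<bar>g i \<eta> - of_bool (k = i)\<bar> \<le> L * norm (\<eta> - k) powr r"
  shows "\<exists>K. \<forall>G \<tau>. simplex_pmf G \<longrightarrow> (\<forall>\<eta>\<in>set_pmf G. \<tau> \<eta> \<in> set_pmf G0) \<longrightarrow>
     pmf_mean G (\<lambda>\<eta>. norm (\<eta> - \<tau> \<eta>) powr r) \<le> a * tv G \<longrightarrow> wasserstein r G G0 powr r \<le> K * tv G"
proof -
  let ?S = "set_pmf G0"
  have fin: "finite ?S" using G0 by (simp add: simplex_pmf_def)
  define M where "M = \<kappa> * (\<Sum>i\<in>?S. B i)"
  let ?K = "a + 2 powr r * card ?S * (M + L * a)"
  have "wasserstein r G G0 powr r \<le> ?K * tv G"
    if G: "simplex_pmf G" and \<tau>: "\<forall>\<eta>\<in>set_pmf G. \<tau> \<eta> \<in> ?S"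
      and A: "pmf_mean G (\<lambda>\<eta>. norm (\<eta> - \<tau> \<eta>) powr r) \<le> a * tv G" for G \<tau>
  proof -
    have "wasserstein r G G0 powr r \<le> a * tv G + 2 powr r * card ?S * (M * tv G + L * (a * tv G))"
    proof (rule wasserstein_le_tests[OF G G0 r _ A L(2) _ L(1)])
      fix i assume i: "i \<in> ?S"
      have "\<bar>pmf_mean G (g i) - pmf_mean G0 (g i)\<bar> \<le> \<kappa> * B i * tv G" by (rule poly_deviation[OF G d g[OF i]])
      also have "\<dots> \<le> M * tv G"
        unfolding M_def using fin i \<kappa>_nonneg poly_bound_nonneg[OF g]
        by (intro mult_right_mono mult_left_mono member_le_sum) auto
      finally show "\<bar>pmf_mean G (g i) - pmf_mean G0 (g i)\<bar> \<le> M * tv G" .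
    qed (use \<tau> in auto)
    then show ?thesis by (simp add: algebra_simps)
  qed
  then show ?thesis by blast
qed

lemma wasserstein_bounded:
  assumes G: "simplex_pmf G" and r: "r > 0"
  shows "wasserstein r G G0 powr r \<le> 2 powr r * (1 + real (card (set_pmf G0)))"
proof -
  have fin: "finite (set_pmf G)" "set_pmf G \<subseteq> prob_simplex" "set_pmf G0 \<subseteq> prob_simplex"
    using G G0 by (auto simp: simplex_pmf_def)
  obtain k where k: "k \<in> set_pmf G0" using set_pmf_not_empty[of G0] by blast
  have "pmf_mean G (\<lambda>\<eta>. norm (\<eta> - k) powr r) \<le> pmf_mean G (\<lambda>\<eta>. 2 powr r)"
    using fin k r by (intro pmf_mean_mono powr_mono2 prob_simplex_dist_le) auto
  then have 1: "pmf_mean G (\<lambda>\<eta>. norm (\<eta> - k) powr r) \<le> 2 powr r" using fin by simp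
  have "\<bar>pmf_mean G (\<lambda>\<eta>. of_bool (k = i)) - pmf G0 i\<bar> \<le> 1" for i
    using fin pmf_le_1[of G0 i] pmf_nonneg[of G0 i] by (cases "k = i") auto
  then have "(\<Sum>i\<in>set_pmf G0. \<bar>pmf_mean G (\<lambda>\<eta>. of_bool (k = i)) - pmf G0 i\<bar>) \<le> (\<Sum>i\<in>set_pmf G0. 1)"
    by (intro sum_mono) auto
  then have 2: "2 powr r * (\<Sum>i\<in>set_pmf G0. \<bar>pmf_mean G (\<lambda>\<eta>. of_bool (k = i)) - pmf G0 i\<bar>)
      \<le> 2 powr r * card (set_pmf G0)"
    by (intro mult_left_mono) auto
  have "wasserstein r G G0 powr r \<le> pmf_mean G (\<lambda>\<eta>. norm (\<eta> - k) powr r) +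
    2 powr r * (\<Sum>i\<in>set_pmf G0. \<bar>pmf_mean G (\<lambda>\<eta>. of_bool (k = i)) - pmf G0 i\<bar>)"
    by (rule wasserstein_le_assignment[OF G G0 r]) (rule k)
  with 1 2 show ?thesis unfolding distrib_left by linarith
qed

text \<open>Only mixing measures with small \<open>tv\<close> matter, since \<open>W\<^sub>r\<close> is bounded.\<close>

lemma small_tv_suffices:
  assumes \<epsilon>: "\<epsilon> > 0" and r: "r > 0"
    and K: "\<And>G. G \<in> \<C> \<Longrightarrow> simplex_pmf G" "\<And>G. G \<in> \<C> \<Longrightarrow> tv G < \<epsilon> \<Longrightarrow> wasserstein r G G0 powr r \<le> K * tv G"
  shows "inverse_bound \<alpha> r N G0 \<C>"
proof (rule inverse_boundI)
  let ?D = "2 powr r * (1 + real (card (set_pmf G0)))"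
  fix G assume G: "G \<in> \<C>"
  show "wasserstein r G G0 powr r \<le> (\<bar>K\<bar> + ?D / \<epsilon>) * tv G"
  proof (cases "tv G < \<epsilon>")
    case True
    have "K * tv G \<le> (\<bar>K\<bar> + ?D / \<epsilon>) * tv G"
      using \<epsilon> by (intro mult_right_mono add_increasing2) auto
    with K(2)[OF G True] show ?thesis by linarith
  next
    case False
    have "?D = ?D / \<epsilon> * \<epsilon>" using \<epsilon> by simp
    also have "\<dots> \<le> (\<bar>K\<bar> + ?D / \<epsilon>) * tv G"
      using False \<epsilon> by (intro mult_mono) auto
    finally show ?thesis using wasserstein_bounded[OF K(1)[OF G] r] by linarith
  qed
qed

end

section \<open>Arbitrary atoms\<close>
lemma poly_bound_norm_sq:
  fixes s :: "'a::euclidean_space"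
  assumes "norm s \<le> 1"
  shows "poly_bound 2 (4 * DIM('a)) (\<lambda>\<theta>. (norm (\<theta> - s))\<^sup>2)"
proof -
  have "poly_bound (1 + 1) ((2 * norm b) * (2 * norm b)) (\<lambda>\<theta>. (b \<bullet> (\<theta> - s)) * (b \<bullet> (\<theta> - s)))" for b
    by (intro poly_bound_mult poly_bound_affine assms)
  then have "poly_bound (1 + 1) (\<Sum>b\<in>(Basis :: 'a set). (2 * norm b) * (2 * norm b))
     (\<lambda>\<theta>. \<Sum>b\<in>Basis. (b \<bullet> (\<theta> - s)) * (b \<bullet> (\<theta> - s)))"
    by (rule poly_bound_sum[OF finite_Basis])
  moreover have "(\<Sum>b\<in>Basis. (b \<bullet> x) * (b \<bullet> x)) = (norm x)\<^sup>2" for x :: 'a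
    unfolding power2_norm_eq_inner by (subst euclidean_inner) (simp add: inner_commute)
  moreover have "(\<Sum>b\<in>(Basis :: 'a set). (2 * norm b) * (2 * norm b)) = 4 * DIM('a)" by simp
  ultimately show ?thesis by (simp only: one_add_one)
qed

text \<open>Each factor is \<open>1\<close> plus a linear form in \<open>\<eta> - \<theta>\<close> plus \<open>O(|\<eta> - \<theta>|\<^sup>2)\<close>, and such expansions multiply.\<close>
lemma prod_norm_sq_taylor:
  fixes \<theta> :: "real ^ 'v"
  assumes "finite A" "A \<subseteq> prob_simplex" "\<theta> \<in> prob_simplex" "\<theta> \<notin> A"
  shows "\<exists>b C. C \<ge> 0 \<and> (\<forall>\<eta>\<in>prob_simplex.
     \<bar>(\<Prod>i\<in>A. (norm (\<eta> - i))\<^sup>2 / (norm (\<theta> - i))\<^sup>2) - 1 - b \<bullet> (\<eta> - \<theta>)\<bar> \<le> C * (norm (\<eta> - \<theta>))\<^sup>2)"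
  using assms
proof (induction A)
  case empty
  show ?case by (intro exI[of _ 0]) auto
next
  case (insert k A)
  let ?u = "\<lambda>\<eta>. \<Prod>i\<in>A. (norm (\<eta> - i))\<^sup>2 / (norm (\<theta> - i))\<^sup>2"
  obtain b C where C: "C \<ge> 0" "\<And>\<eta>. \<eta> \<in> prob_simplex \<Longrightarrow>
     \<bar>?u \<eta> - 1 - b \<bullet> (\<eta> - \<theta>)\<bar> \<le> C * (norm (\<eta> - \<theta>))\<^sup>2"
    using insert by auto
  define c where "c = (norm (\<theta> - k))\<^sup>2"
  have c: "c > 0" using insert.prems by (auto simp: c_def)
  define b1 where "b1 = (2 / c) *\<^sub>R (\<theta> - k)"
  let ?C = "4 / c * C + norm b1 * norm b + 1 / c * (1 + 2 * norm b)"
  have "\<bar>(norm (\<eta> - k))\<^sup>2 / c * ?u \<eta> - 1 - (b1 + b) \<bullet> (\<eta> - \<theta>)\<bar> \<le> ?C * (norm (\<eta> - \<theta>))\<^sup>2"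
    if \<eta>: "\<eta> \<in> prob_simplex" for \<eta>
  proof -
    define x where "x = \<eta> - \<theta>"
    define e where "e = ?u \<eta> - 1 - b \<bullet> x"
    define f where "f = (norm (\<eta> - k))\<^sup>2 / c"
    have "(norm (\<eta> - k))\<^sup>2 = c + 2 * ((\<theta> - k) \<bullet> x) + (norm x)\<^sup>2"
      unfolding x_def c_def power2_norm_eq_inner by (simp add: inner_diff inner_commute algebra_simps)
    then have "f = (c + 2 * ((\<theta> - k) \<bullet> x) + (norm x)\<^sup>2) / c" by (simp only: f_def)
    also have "\<dots> = 1 + 2 / c * ((\<theta> - k) \<bullet> x) + (norm x)\<^sup>2 / c" using c by (simp add: add_divide_distrib)
    also have "2 / c * ((\<theta> - k) \<bullet> x) = b1 \<bullet> x" by (simp add: b1_def)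
    finally have f: "f = 1 + b1 \<bullet> x + (norm x)\<^sup>2 / c" .
    have x2: "norm x \<le> 2" unfolding x_def using \<eta> insert.prems by (intro prob_simplex_dist_le) auto
    have "norm (\<eta> - k) \<le> 2" using \<eta> insert.prems by (intro prob_simplex_dist_le) auto
    then have "(norm (\<eta> - k))\<^sup>2 \<le> 2\<^sup>2" by (rule power_mono) simp
    then have f4: "\<bar>f\<bar> \<le> 4 / c" unfolding f_def using c by (simp add: divide_right_mono)
    have "f * ?u \<eta> - 1 - (b1 + b) \<bullet> x = f * e + (b1 \<bullet> x) * (b \<bullet> x) + (norm x)\<^sup>2 / c * (1 + b \<bullet> x)"
    proof -
      have "?u \<eta> = 1 + b \<bullet> x + e" by (simp add: e_def)
      then have "f * ?u \<eta> = f * (1 + b \<bullet> x) + f * e" by (simp add: algebra_simps)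
      also have "f * (1 + b \<bullet> x) = (1 + b1 \<bullet> x + (norm x)\<^sup>2 / c) * (1 + b \<bullet> x)" by (simp only: f)
      finally show ?thesis by (simp add: algebra_simps inner_add_left)
    qed
    also have "\<bar>\<dots>\<bar> \<le> \<bar>f\<bar> * \<bar>e\<bar> + \<bar>b1 \<bullet> x\<bar> * \<bar>b \<bullet> x\<bar> + (norm x)\<^sup>2 / c * \<bar>1 + b \<bullet> x\<bar>"
    proof -
      have "\<bar>(norm x)\<^sup>2 / c * (1 + b \<bullet> x)\<bar> = (norm x)\<^sup>2 / c * \<bar>1 + b \<bullet> x\<bar>" using c by (simp add: abs_mult)
      moreover have "\<bar>p + q + s\<bar> \<le> \<bar>p\<bar> + \<bar>q\<bar> + \<bar>s\<bar>" for p q s :: real by linarith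
      ultimately show ?thesis by (metis abs_mult)
    qed
    also have "\<dots> \<le> 4 / c * (C * (norm x)\<^sup>2) + (norm b1 * norm x) * (norm b * norm x) +
        (norm x)\<^sup>2 / c * (1 + 2 * norm b)"
    proof -
      have "\<bar>b \<bullet> x\<bar> \<le> norm b * 2"
        using Cauchy_Schwarz_ineq2[of b x] mult_left_mono[OF x2, of "norm b"] by simp
      then have "\<bar>1 + b \<bullet> x\<bar> \<le> 1 + 2 * norm b" by linarith
      moreover have "\<bar>e\<bar> \<le> C * (norm x)\<^sup>2" using C(2)[OF \<eta>] by (simp add: e_def x_def)
      ultimately show ?thesis using f4 c
        by (intro add_mono mult_mono Cauchy_Schwarz_ineq2) auto
    qed
    also have "\<dots> = ?C * (norm x)\<^sup>2" by (simp add: algebra_simps power2_eq_square)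
    finally show ?thesis unfolding f_def x_def .
  qed
  moreover have "?C \<ge> 0" using C(1) c by simp
  ultimately show ?case
    unfolding prod.insert[OF insert.hyps] c_def[symmetric] by blast
qed

text \<open>The product of the squared distances to the other atoms vanishes to second order there; the
  affine factor removes the gradient at \<open>\<theta>\<close>.\<close>

lemma hermite_indicator:
  fixes \<theta> :: "real ^ 'v"
  assumes S: "finite S" "S \<subseteq> prob_simplex" and \<theta>: "\<theta> \<in> S"
  shows "\<exists>g B L. L \<ge> 0 \<and> poly_bound (2 * card S - 1) B g \<and>
     (\<forall>k\<in>S. \<forall>\<eta>\<in>prob_simplex. \<bar>g \<eta> - of_bool (k = \<theta>)\<bar> \<le> L * (norm (\<eta> - k))\<^sup>2)"
proof -
  define A where "A = S - {\<theta>}"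
  have A: "finite A" "A \<subseteq> prob_simplex" "\<theta> \<notin> A" using S by (auto simp: A_def)
  have \<theta>s: "\<theta> \<in> prob_simplex" using S \<theta> by auto
  define f where "f i \<eta> = (norm (\<eta> - i))\<^sup>2 / (norm (\<theta> - i))\<^sup>2" for i \<eta> :: "real ^ 'v"
  define u where "u \<eta> = (\<Prod>i\<in>A. f i \<eta>)" for \<eta>
  obtain b C where C: "C \<ge> 0" "\<And>\<eta>. \<eta> \<in> prob_simplex \<Longrightarrow>
     \<bar>u \<eta> - 1 - b \<bullet> (\<eta> - \<theta>)\<bar> \<le> C * (norm (\<eta> - \<theta>))\<^sup>2"
    using prod_norm_sq_taylor[OF A(1,2) \<theta>s A(3)] unfolding u_def f_def by blast
  (* Multiplying by 1 - b (\<eta> - \<theta>) cancels the linear term of u at \<theta>. *)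
  let ?g = "\<lambda>\<eta>. u \<eta> * (1 + (- b) \<bullet> (\<eta> - \<theta>))"
  let ?m = "\<lambda>k. 1 / (norm (\<theta> - k))\<^sup>2 * (\<Prod>i\<in>A - {k}. 4 / (norm (\<theta> - i))\<^sup>2) * (1 + 2 * norm b)"
  let ?H = "(norm b)\<^sup>2 + C * (1 + 2 * norm b)"
  let ?L = "?H + (\<Sum>k\<in>A. ?m k)"
  have m0: "?m k \<ge> 0" for k by (intro mult_nonneg_nonneg prod_nonneg) auto
  have H0: "?H \<ge> 0" using C(1) by simp
  have sm0: "(\<Sum>k\<in>A. ?m k) \<ge> 0" by (intro sum_nonneg m0)
  have "poly_bound 2 (\<bar>1 / (norm (\<theta> - i))\<^sup>2\<bar> * (4 * DIM(real ^ 'v))) (\<lambda>\<eta>. 1 / (norm (\<theta> - i))\<^sup>2 * (norm (\<eta> - i))\<^sup>2)"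
    if "i \<in> A" for i
    using that A(2) by (intro poly_bound_cmult poly_bound_norm_sq prob_simplex_norm_le) auto
  then have "poly_bound (\<Sum>i\<in>A. 2) (\<Prod>i\<in>A. \<bar>1 / (norm (\<theta> - i))\<^sup>2\<bar> * (4 * DIM(real ^ 'v)))
      (\<lambda>\<eta>. \<Prod>i\<in>A. 1 / (norm (\<theta> - i))\<^sup>2 * (norm (\<eta> - i))\<^sup>2)"
    using A(1) by (intro poly_bound_prod) auto
  moreover have "(\<lambda>\<eta>. \<Prod>i\<in>A. 1 / (norm (\<theta> - i))\<^sup>2 * (norm (\<eta> - i))\<^sup>2) = u"
    by (simp add: fun_eq_iff u_def f_def)
  ultimately obtain Bu where Bu: "poly_bound (\<Sum>i\<in>A. 2) Bu u" by auto
  have deg: "(\<Sum>i\<in>A. 2) + 1 = 2 * card S - 1"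
  proof -
    have "card S = Suc (card A)" unfolding A_def using card_Suc_Diff1[OF S(1) \<theta>] by simp
    then show ?thesis by simp
  qed
  have "poly_bound 1 (1 + 2 * norm (- b)) (\<lambda>\<eta>. 1 + (- b) \<bullet> (\<eta> - \<theta>))"
    using prob_simplex_norm_le[OF \<theta>s] by (intro poly_bound.add poly_bound.const poly_bound_affine) auto
  from poly_bound_mult[OF Bu this] have poly: "poly_bound (2 * card S - 1) (Bu * (1 + 2 * norm (- b))) ?g"
    unfolding deg .
  have approx: "\<bar>?g \<eta> - of_bool (k = \<theta>)\<bar> \<le> ?L * (norm (\<eta> - k))\<^sup>2"
    if k: "k \<in> S" and \<eta>: "\<eta> \<in> prob_simplex" for k \<eta>
  proof -
    define x where "x = \<eta> - \<theta>"
    have x2: "norm x \<le> 2" unfolding x_def by (rule prob_simplex_dist_le[OF \<eta> \<theta>s])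
    have "\<bar>b \<bullet> x\<bar> \<le> norm b * 2"
      using Cauchy_Schwarz_ineq2[of b x] mult_left_mono[OF x2, of "norm b"] by simp
    then have bx: "\<bar>1 - b \<bullet> x\<bar> \<le> 1 + 2 * norm b" by linarith
    show ?thesis
    proof (cases "k = \<theta>")
      case True
      define e where "e = u \<eta> - 1 - b \<bullet> x"
      have "?g \<eta> - 1 = e * (1 - b \<bullet> x) - (b \<bullet> x)\<^sup>2"
        by (simp add: e_def x_def[symmetric] algebra_simps power2_eq_square)
      also have "\<bar>\<dots>\<bar> \<le> \<bar>e\<bar> * \<bar>1 - b \<bullet> x\<bar> + (b \<bullet> x)\<^sup>2"
        using abs_triangle_ineq4[of "e * (1 - b \<bullet> x)" "(b \<bullet> x)\<^sup>2"] by (simp add: abs_mult)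
      also have "\<dots> \<le> (C * (norm x)\<^sup>2) * (1 + 2 * norm b) + (norm b * norm x)\<^sup>2"
      proof (intro add_mono mult_mono)
        show "\<bar>e\<bar> \<le> C * (norm x)\<^sup>2" using C(2)[OF \<eta>] by (simp only: e_def x_def)
        show "(b \<bullet> x)\<^sup>2 \<le> (norm b * norm x)\<^sup>2"
          using power_mono[OF Cauchy_Schwarz_ineq2[of b x], of 2] by simp
      qed (use bx C(1) in auto)
      also have "\<dots> = ?H * (norm x)\<^sup>2" by (simp add: algebra_simps power_mult_distrib)
      also have "\<dots> \<le> ?L * (norm x)\<^sup>2" using sm0 by (intro mult_right_mono) auto
      finally show ?thesis using True by (simp add: x_def)
    next
      case False
      then have kA: "k \<in> A" using k by (simp add: A_def)
      have f0: "f i \<eta> \<ge> 0" for i by (simp add: f_def)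
      have f4: "f i \<eta> \<le> 4 / (norm (\<theta> - i))\<^sup>2" if "i \<in> A" for i
      proof -
        have "norm (\<eta> - i) \<le> 2" using that A(2) \<eta> by (intro prob_simplex_dist_le) auto
        then have "(norm (\<eta> - i))\<^sup>2 \<le> 2\<^sup>2" by (rule power_mono) simp
        then show ?thesis unfolding f_def by (intro divide_right_mono) auto
      qed
      have "\<bar>?g \<eta>\<bar> = f k \<eta> * (\<Prod>i\<in>A - {k}. f i \<eta>) * \<bar>1 - b \<bullet> x\<bar>"
        unfolding u_def prod.remove[OF A(1) kA] x_def[symmetric] using f0 by (simp add: abs_mult abs_prod)
      also have "\<dots> \<le> f k \<eta> * (\<Prod>i\<in>A - {k}. 4 / (norm (\<theta> - i))\<^sup>2) * (1 + 2 * norm b)"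
        using f0 f4 bx by (intro mult_mono prod_mono mult_nonneg_nonneg prod_nonneg) auto
      also have "\<dots> = ?m k * (norm (\<eta> - k))\<^sup>2" by (simp add: f_def)
      also have "\<dots> \<le> ?L * (norm (\<eta> - k))\<^sup>2"
      proof (rule mult_right_mono)
        have "?m k \<le> (\<Sum>k\<in>A. ?m k)" by (rule member_le_sum[OF kA _ A(1)]) (rule m0)
        then show "?m k \<le> ?L" using H0 by linarith
      qed simp
      finally show ?thesis using False by simp
    qed
  qed
  have "?L \<ge> 0" by (rule add_nonneg_nonneg[OF H0 sm0])
  with poly approx show ?thesis by blast
qed

lemma hermite_indicators:
  fixes S :: "(real ^ 'v) set"
  assumes S: "finite S" "S \<subseteq> prob_simplex"
  obtains g B L where "L \<ge> 0" "\<And>i. i \<in> S \<Longrightarrow> poly_bound (2 * card S - 1) (B i) (g i)"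
    "\<And>i k \<eta>. i \<in> S \<Longrightarrow> k \<in> S \<Longrightarrow> \<eta> \<in> prob_simplex \<Longrightarrow> \<bar>g i \<eta> - of_bool (k = i)\<bar> \<le> L * (norm (\<eta> - k))\<^sup>2"
proof -
  obtain g B L where L: "\<And>i. i \<in> S \<Longrightarrow> L i \<ge> 0" "\<And>i. i \<in> S \<Longrightarrow> poly_bound (2 * card S - 1) (B i) (g i)"
    "\<And>i k \<eta>. i \<in> S \<Longrightarrow> k \<in> S \<Longrightarrow> \<eta> \<in> prob_simplex \<Longrightarrow> \<bar>g i \<eta> - of_bool (k = i)\<bar> \<le> L i * (norm (\<eta> - k))\<^sup>2"
    using hermite_indicator[OF S] by metis
  show thesis
  proof (rule that[of "\<Sum>i\<in>S. L i" B g])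
    fix i k \<eta> :: "real ^ 'v" assume i: "i \<in> S" "k \<in> S" "\<eta> \<in> prob_simplex"
    have "L i * (norm (\<eta> - k))\<^sup>2 \<le> (\<Sum>i\<in>S. L i) * (norm (\<eta> - k))\<^sup>2"
      using i S L(1) by (intro mult_right_mono member_le_sum) auto
    with L(3)[OF i] show "\<bar>g i \<eta> - of_bool (k = i)\<bar> \<le> (\<Sum>i\<in>S. L i) * (norm (\<eta> - k))\<^sup>2" by linarith
  qed (use L in \<open>auto intro: sum_nonneg\<close>)
qed

lemma nearest_point:
  fixes \<eta> :: "'a::real_normed_vector"
  assumes "finite S" "S \<noteq> {}"
  obtains k where "k \<in> S" "\<And>i. i \<in> S \<Longrightarrow> norm (\<eta> - k) \<le> norm (\<eta> - i)"
  using arg_min_if_finite(1)[OF assms, of "\<lambda>i. norm (\<eta> - i)"] arg_min_least[OF assms, of _ "\<lambda>i. norm (\<eta> - i)"]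
  by blast

context lda_reference begin

text \<open>The polynomial \<open>\<Prod>\<^sub>i |\<eta> - \<theta>\<^sub>i|\<^sup>2\<close> has mean \<open>0\<close> under \<open>G0\<close>, so its mean under \<open>G\<close> is of the order of
  \<open>tv G\<close>; and it dominates the squared distance to the nearest atom, since
  \<open>|\<eta> - i| \<ge> |i - k| / 2\<close> for the nearest atom \<open>k\<close> and any other atom \<open>i\<close>. The number of atoms of \<open>G\<close> does not enter.\<close>
theorem inverse_bound_W2:
  assumes N: "2 * card (set_pmf G0) \<le> N" and \<C>: "\<And>G. G \<in> \<C> \<Longrightarrow> simplex_pmf G"
  shows "inverse_bound \<alpha> 2 N G0 \<C>"
proof -
  let ?S = "set_pmf G0"
  have S: "finite ?S" "?S \<subseteq> prob_simplex" using G0 by (auto simp: simplex_pmf_def)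
  let ?f = "\<lambda>\<eta>. \<Prod>i\<in>?S. (norm (\<eta> - i))\<^sup>2"
  have "poly_bound (\<Sum>i\<in>?S. 2) (\<Prod>i\<in>?S. 4 * real DIM(real ^ 'v)) ?f"
  proof (rule poly_bound_prod[OF S(1)])
    fix i assume "i \<in> ?S"
    then have "norm i \<le> 1" using S(2) by (auto intro: prob_simplex_norm_le)
    then show "poly_bound 2 (4 * real DIM(real ^ 'v)) (\<lambda>\<eta>. (norm (\<eta> - i))\<^sup>2)"
      using poly_bound_norm_sq[of i] by (simp only: of_nat_mult of_nat_numeral)
  qed
  then obtain B where f: "poly_bound (2 * card ?S) B ?f" by (metis mult.commute sum_constant of_nat_id)
  define c where "c k = (\<Prod>i\<in>?S - {k}. (norm (i - k))\<^sup>2 / 4)" for k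
  have c: "c k > 0" for k unfolding c_def using S by (intro prod_pos) auto
  let ?Q = "\<Sum>k\<in>?S. 1 / c k"
  have "\<exists>k\<in>?S. (norm (\<eta> - k))\<^sup>2 \<le> ?Q * ?f \<eta>" for \<eta>
  proof -
    obtain k where k: "k \<in> ?S" "\<And>i. i \<in> ?S \<Longrightarrow> norm (\<eta> - k) \<le> norm (\<eta> - i)"
      using nearest_point[OF S(1) set_pmf_not_empty] by blast
    have "(norm (i - k))\<^sup>2 / 4 \<le> (norm (\<eta> - i))\<^sup>2" if "i \<in> ?S" for i
    proof -
      have "norm (i - k) \<le> norm (\<eta> - i) + norm (\<eta> - k)"
        using norm_triangle_ineq4[of "\<eta> - k" "\<eta> - i"] by simp
      then have "norm (i - k) \<le> 2 * norm (\<eta> - i)" using k(2)[OF that] by linarith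
      then have "(norm (i - k))\<^sup>2 \<le> (2 * norm (\<eta> - i))\<^sup>2" by (rule power_mono) simp
      then show ?thesis by (simp add: power_mult_distrib)
    qed
    then have "c k \<le> (\<Prod>i\<in>?S - {k}. (norm (\<eta> - i))\<^sup>2)" unfolding c_def by (intro prod_mono) auto
    then have "(norm (\<eta> - k))\<^sup>2 * c k \<le> ?f \<eta>"
      unfolding prod.remove[OF S(1) k(1)] by (rule mult_left_mono) simp
    then have "(norm (\<eta> - k))\<^sup>2 \<le> 1 / c k * ?f \<eta>" using c[of k] by (simp add: field_simps)
    also have "\<dots> \<le> ?Q * ?f \<eta>"
      using S k(1) less_imp_le[OF c] by (intro mult_right_mono member_le_sum prod_nonneg) auto
    finally show ?thesis using k(1) by blast
  qed
  then obtain \<tau> where \<tau>: "\<And>\<eta>. \<tau> \<eta> \<in> ?S" "\<And>\<eta>. (norm (\<eta> - \<tau> \<eta>))\<^sup>2 \<le> ?Q * ?f \<eta>" by metis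
  have near: "pmf_mean G (\<lambda>\<eta>. norm (\<eta> - \<tau> \<eta>) powr 2) \<le> (?Q * (\<kappa> * B)) * tv G" if G: "simplex_pmf G" for G
  proof -
    have "pmf_mean G (\<lambda>\<eta>. norm (\<eta> - \<tau> \<eta>) powr 2) \<le> pmf_mean G (\<lambda>\<eta>. ?Q * ?f \<eta>)"
      using \<tau>(2) by (intro pmf_mean_mono) simp
    also have "\<dots> = ?Q * pmf_mean G ?f" by (rule pmf_mean_cmult)
    also have "pmf_mean G0 ?f = 0"
      unfolding pmf_mean_def using S by (intro sum.neutral) (auto simp: prod_zero_iff)
    then have "pmf_mean G ?f \<le> \<kappa> * B * tv G" using poly_deviation[OF G N f] by simp
    then have "?Q * pmf_mean G ?f \<le> ?Q * (\<kappa> * B * tv G)"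
      by (rule mult_left_mono) (use less_imp_le[OF c] in \<open>auto intro: sum_nonneg\<close>)
    finally show ?thesis by (simp add: mult.assoc)
  qed
  obtain g Bg L where g: "L \<ge> 0" "\<And>i. i \<in> ?S \<Longrightarrow> poly_bound (2 * card ?S - 1) (Bg i) (g i)"
    "\<And>i k \<eta>. i \<in> ?S \<Longrightarrow> k \<in> ?S \<Longrightarrow> \<eta> \<in> prob_simplex \<Longrightarrow> \<bar>g i \<eta> - of_bool (k = i)\<bar> \<le> L * (norm (\<eta> - k))\<^sup>2"
    using hermite_indicators[OF S] by metis
  have d: "2 * card ?S - 1 \<le> N" using N by simp
  have g2: "\<bar>g i \<eta> - of_bool (k = i)\<bar> \<le> L * norm (\<eta> - k) powr 2"
    if "i \<in> ?S" "k \<in> ?S" "\<eta> \<in> prob_simplex" for i k \<eta>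
    using g(3)[OF that] by simp
  obtain K where K: "\<And>G \<tau>. simplex_pmf G \<Longrightarrow> (\<forall>\<eta>\<in>set_pmf G. \<tau> \<eta> \<in> ?S) \<Longrightarrow>
     pmf_mean G (\<lambda>\<eta>. norm (\<eta> - \<tau> \<eta>) powr 2) \<le> (?Q * (\<kappa> * B)) * tv G \<Longrightarrow> wasserstein 2 G G0 powr 2 \<le> K * tv G"
    using wasserstein_control[OF zero_less_numeral d g(2) g(1) g2, of "?Q * (\<kappa> * B)"] by blast
  show ?thesis by (rule inverse_boundI) (use K near \<tau>(1) \<C> in blast)
qed

text \<open>If no atom of \<open>G\<close> were near \<open>\<theta>\<close>, a polynomial of degree \<open>2 K\<^sub>0 - 1\<close> that vanishes
  at all atoms of \<open>G\<close> and at all other atoms of \<open>G0\<close> would separate the two measures.\<close>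

lemma atom_distance_product:
  assumes N: "2 * card (set_pmf G0) - 1 \<le> N"
  shows "\<exists>a\<ge>0. \<forall>G. simplex_pmf G \<longrightarrow> card (set_pmf G) = card (set_pmf G0) \<longrightarrow>
     (\<forall>\<theta>\<in>set_pmf G0. (\<Prod>j\<in>set_pmf G. norm (\<theta> - j)) \<le> a * tv G)"
proof -
  let ?S = "set_pmf G0" and ?K = "card (set_pmf G0)"
  have S: "finite ?S" "?S \<subseteq> prob_simplex" using G0 by (auto simp: simplex_pmf_def)
  define e where "e \<theta> = pmf G0 \<theta> * (\<Prod>l\<in>?S - {\<theta>}. (norm (\<theta> - l))\<^sup>2)" for \<theta>
  have e: "e \<theta> > 0" if "\<theta> \<in> ?S" for \<theta>
    unfolding e_def using that S by (intro mult_pos_pos prod_pos) (auto simp: pmf_positive)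
  define B where "B \<theta> = (\<Prod>l\<in>?S - {\<theta>}. 2 * norm (\<theta> - l)) * 2 ^ ?K" for \<theta>
  define a where "a = (\<Sum>\<theta>\<in>?S. \<kappa> * B \<theta> / e \<theta>)"
  have B0: "B \<theta> \<ge> 0" for \<theta> unfolding B_def by (intro mult_nonneg_nonneg prod_nonneg) auto
  have a_ge: "0 \<le> \<kappa> * B \<theta> / e \<theta>" if "\<theta> \<in> ?S" for \<theta>
    using e[OF that] \<kappa>_nonneg B0 by (intro divide_nonneg_pos mult_nonneg_nonneg) auto
  have "(\<Prod>j\<in>set_pmf G. norm (\<theta> - j)) \<le> a * tv G"
    if G: "simplex_pmf G" and card: "card (set_pmf G) = ?K" and \<theta>: "\<theta> \<in> ?S" for G \<theta>
  proof -
    let ?T = "set_pmf G"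
    have T: "finite ?T" "?T \<subseteq> prob_simplex" using G by (auto simp: simplex_pmf_def)
    let ?p = "\<lambda>\<eta>. \<Prod>l\<in>?S - {\<theta>}. (\<theta> - l) \<bullet> (\<eta> - l)"
    (* The normalised direction sgn (\<theta> - j) makes the factor equal to |\<theta> - j| at \<theta>, to the first power,
       while the norm of the form stays at most 1. *)
    let ?q = "\<lambda>\<eta>. \<Prod>j\<in>?T. sgn (\<theta> - j) \<bullet> (\<eta> - j)"
    have p: "poly_bound (\<Sum>l\<in>?S - {\<theta>}. 1) (\<Prod>l\<in>?S - {\<theta>}. 2 * norm (\<theta> - l)) ?p"
      using S by (intro poly_bound_prod poly_bound_affine prob_simplex_norm_le) auto
    have q: "poly_bound (\<Sum>j\<in>?T. 1) (\<Prod>j\<in>?T. 2 * norm (sgn (\<theta> - j))) ?q"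
      using T by (intro poly_bound_prod poly_bound_affine prob_simplex_norm_le) auto
    have "(\<Prod>j\<in>?T. 2 * norm (sgn (\<theta> - j))) \<le> (\<Prod>j\<in>?T. 2)"
      by (intro prod_mono) (auto simp: norm_sgn)
    then have q': "poly_bound (\<Sum>j\<in>?T. 1) (2 ^ ?K) ?q"
      using card by (intro poly_bound_mono[OF q]) auto
    have "?K > 0" using S(1) \<theta> by (auto simp: card_gt_0_iff)
    then have "(\<Sum>l\<in>?S - {\<theta>}. 1) + (\<Sum>j\<in>?T. 1) \<le> N" using N card S(1) \<theta> by simp
    from poly_deviation[OF G this poly_bound_mult[OF p q']]
    have dev: "\<bar>pmf_mean G (\<lambda>\<eta>. ?p \<eta> * ?q \<eta>) - pmf_mean G0 (\<lambda>\<eta>. ?p \<eta> * ?q \<eta>)\<bar> \<le> \<kappa> * B \<theta> * tv G"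
      unfolding B_def .
    have 0: "pmf_mean G (\<lambda>\<eta>. ?p \<eta> * ?q \<eta>) = 0"
    proof -
      have "?q \<eta> = 0" if "\<eta> \<in> ?T" for \<eta>
        using T(1) that by (intro prod_zero bexI[of _ \<eta>]) simp_all
      then show ?thesis unfolding pmf_mean_def by (intro sum.neutral) simp
    qed
    have "pmf_mean G0 (\<lambda>\<eta>. ?p \<eta> * ?q \<eta>) = (\<Sum>\<eta>\<in>{\<theta>}. pmf G0 \<eta> * (?p \<eta> * ?q \<eta>))"
    proof -
      have "?p \<eta> = 0" if "\<eta> \<in> ?S - {\<theta>}" for \<eta>
        using S(1) that by (intro prod_zero bexI[of _ \<eta>]) simp_all
      then show ?thesis
        unfolding pmf_mean_def using S(1) \<theta> by (intro sum.mono_neutral_right) simp_all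
    qed
    also have "\<dots> = e \<theta> * (\<Prod>j\<in>?T. norm (\<theta> - j))"
    proof -
      have "sgn x \<bullet> x = norm x" for x :: "real ^ 'v"
        by (cases "x = 0") (auto simp: sgn_div_norm power2_norm_eq_inner[symmetric] power2_eq_square)
      then show ?thesis by (simp add: e_def power2_norm_eq_inner)
    qed
    finally have "e \<theta> * (\<Prod>j\<in>?T. norm (\<theta> - j)) \<le> \<kappa> * B \<theta> * tv G"
      using dev 0 by linarith
    then have "(\<Prod>j\<in>?T. norm (\<theta> - j)) \<le> \<kappa> * B \<theta> / e \<theta> * tv G"
      using e[OF \<theta>] by (simp add: field_simps)
    also have "\<dots> \<le> a * tv G"
      unfolding a_def using S(1) \<theta> a_ge by (intro mult_right_mono member_le_sum) auto
    finally show ?thesis .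
  qed
  moreover have "a \<ge> 0" unfolding a_def by (intro sum_nonneg a_ge)
  ultimately show ?thesis by blast
qed

lemma atoms_separated:
  obtains \<delta> where "\<delta> > 0" "\<And>\<theta> \<theta>'. \<theta> \<in> set_pmf G0 \<Longrightarrow> \<theta>' \<in> set_pmf G0 \<Longrightarrow> \<theta> \<noteq> \<theta>' \<Longrightarrow> \<delta> \<le> norm (\<theta> - \<theta>')"
proof -
  let ?P = "{(\<theta>, \<theta>'). \<theta> \<in> set_pmf G0 \<and> \<theta>' \<in> set_pmf G0 \<and> \<theta> \<noteq> \<theta>'}"
  let ?D = "insert 1 ((\<lambda>(\<theta>, \<theta>'). norm (\<theta> - \<theta>')) ` ?P)"
  have "finite (set_pmf G0)" using G0 by (simp add: simplex_pmf_def)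
  then have "finite ?P" by (intro finite_subset[of ?P "set_pmf G0 \<times> set_pmf G0"]) auto
  then have "finite ?D" by blast
  then have "Min ?D > 0" "\<And>d. d \<in> ?D \<Longrightarrow> Min ?D \<le> d" by auto
  then show thesis by (intro that[of "Min ?D"]) auto
qed

text \<open>Once \<open>tv G\<close> is small, each atom of \<open>G0\<close> has an atom of \<open>G\<close> in its own small ball. As both measures
  have the same number of atoms, this is a bijection, and then in the product of distances
  all factors but one are bounded below, so the remaining one is of the order of \<open>tv G\<close>.\<close>
theorem inverse_bound_W1:
  assumes N: "2 * card (set_pmf G0) - 1 \<le> N"
    and \<C>: "\<And>G. G \<in> \<C> \<Longrightarrow> simplex_pmf G" "\<And>G. G \<in> \<C> \<Longrightarrow> card (set_pmf G) = card (set_pmf G0)"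
  shows "inverse_bound \<alpha> 1 N G0 \<C>"
proof -
  let ?S = "set_pmf G0" and ?K = "card (set_pmf G0)"
  have S: "finite ?S" "?S \<subseteq> prob_simplex" using G0 by (auto simp: simplex_pmf_def)
  obtain a where a: "a \<ge> 0" "\<And>G \<theta>. simplex_pmf G \<Longrightarrow> card (set_pmf G) = ?K \<Longrightarrow> \<theta> \<in> ?S \<Longrightarrow>
     (\<Prod>j\<in>set_pmf G. norm (\<theta> - j)) \<le> a * tv G"
    using atom_distance_product[OF N] by blast
  obtain \<delta> where \<delta>: "\<delta> > 0" "\<And>\<theta> \<theta>'. \<theta> \<in> ?S \<Longrightarrow> \<theta>' \<in> ?S \<Longrightarrow> \<theta> \<noteq> \<theta>' \<Longrightarrow> 4 * \<delta> \<le> norm (\<theta> - \<theta>')"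
  proof -
    obtain \<delta> where "\<delta> > 0" "\<And>\<theta> \<theta>'. \<theta> \<in> ?S \<Longrightarrow> \<theta>' \<in> ?S \<Longrightarrow> \<theta> \<noteq> \<theta>' \<Longrightarrow> \<delta> \<le> norm (\<theta> - \<theta>')"
      using atoms_separated by blast
    then show thesis by (intro that[of "\<delta> / 4"]) auto
  qed
  define b where "b = a / \<delta> ^ (?K - 1)"
  have matching: "\<exists>\<tau>. (\<forall>\<eta>\<in>set_pmf G. \<tau> \<eta> \<in> ?S) \<and> pmf_mean G (\<lambda>\<eta>. norm (\<eta> - \<tau> \<eta>) powr 1) \<le> b * tv G"
    if G: "G \<in> \<C>" and small: "a * tv G < \<delta> ^ ?K" for G
  proof -
    let ?T = "set_pmf G"
    have T: "finite ?T" "?T \<subseteq> prob_simplex" and card: "card ?T = ?K"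
      using \<C>[OF G] by (auto simp: simplex_pmf_def)
    note prod_le = a(2)[OF \<C>(1)[OF G] card]
    have "\<exists>j\<in>?T. norm (\<theta> - j) < \<delta>" if "\<theta> \<in> ?S" for \<theta>
    proof (rule ccontr)
      assume "\<not> ?thesis"
      then have "(\<Prod>j\<in>?T. \<delta>) \<le> (\<Prod>j\<in>?T. norm (\<theta> - j))"
        using \<delta>(1) by (intro prod_mono) (auto simp: not_less)
      with prod_le[OF that] small card show False by simp
    qed
    then obtain \<sigma> where \<sigma>: "\<And>\<theta>. \<theta> \<in> ?S \<Longrightarrow> \<sigma> \<theta> \<in> ?T" "\<And>\<theta>. \<theta> \<in> ?S \<Longrightarrow> norm (\<theta> - \<sigma> \<theta>) < \<delta>" by metis
    (* The atoms of G0 are at least 4 \<delta> apart, so an atom of G close to one of them is far from the others. *)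
    have far: "\<delta> \<le> norm (\<theta> - \<sigma> \<theta>')" if "\<theta> \<in> ?S" "\<theta>' \<in> ?S" "\<theta> \<noteq> \<theta>'" for \<theta> \<theta>'
    proof -
      have "norm (\<theta> - \<theta>') \<le> norm (\<theta> - \<sigma> \<theta>') + norm (\<theta>' - \<sigma> \<theta>')"
        using norm_triangle_ineq4[of "\<theta> - \<sigma> \<theta>'" "\<theta>' - \<sigma> \<theta>'"] by simp
      with \<delta>(2)[OF that] \<sigma>(2)[OF that(2)] \<delta>(1) show ?thesis by linarith
    qed
    have inj: "inj_on \<sigma> ?S"
    proof (rule inj_onI, rule ccontr)
      fix \<theta> \<theta>' assume "\<theta> \<in> ?S" "\<theta>' \<in> ?S" "\<sigma> \<theta> = \<sigma> \<theta>'" "\<theta> \<noteq> \<theta>'"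
      with far[of \<theta> \<theta>'] \<sigma>(2)[of \<theta>] show False by simp
    qed
    have onto: "\<sigma> ` ?S = ?T"
      using \<sigma>(1) T card card_image[OF inj] by (intro card_subset_eq) auto
    have close: "norm (\<theta> - \<sigma> \<theta>) \<le> b * tv G" if \<theta>: "\<theta> \<in> ?S" for \<theta>
    proof -
      have "\<delta> ^ (?K - 1) = (\<Prod>j\<in>?T - {\<sigma> \<theta>}. \<delta>)" using T \<sigma>(1)[OF \<theta>] card by simp
      also have "\<dots> \<le> (\<Prod>j\<in>?T - {\<sigma> \<theta>}. norm (\<theta> - j))"
      proof (rule prod_mono)
        fix j assume "j \<in> ?T - {\<sigma> \<theta>}"
        then obtain \<theta>' where "\<theta>' \<in> ?S" "j = \<sigma> \<theta>'" "\<theta> \<noteq> \<theta>'" using onto by auto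
        then show "0 \<le> \<delta> \<and> \<delta> \<le> norm (\<theta> - j)" using far[OF \<theta>] \<delta>(1) by auto
      qed
      finally have "norm (\<theta> - \<sigma> \<theta>) * \<delta> ^ (?K - 1) \<le> (\<Prod>j\<in>?T. norm (\<theta> - j))"
        unfolding prod.remove[OF T(1) \<sigma>(1)[OF \<theta>]] by (rule mult_left_mono) simp
      with prod_le[OF \<theta>] have "norm (\<theta> - \<sigma> \<theta>) * \<delta> ^ (?K - 1) \<le> a * tv G" by linarith
      then show ?thesis unfolding b_def using \<delta>(1) by (simp add: field_simps)
    qed
    let ?\<tau> = "inv_into ?S \<sigma>"
    have \<tau>: "?\<tau> \<eta> \<in> ?S" "\<sigma> (?\<tau> \<eta>) = \<eta>" if "\<eta> \<in> ?T" for \<eta>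
      using that onto inv_into_into[of \<eta> \<sigma> ?S] f_inv_into_f[of \<eta> \<sigma> ?S] by auto
    have "pmf_mean G (\<lambda>\<eta>. norm (\<eta> - ?\<tau> \<eta>) powr 1) \<le> pmf_mean G (\<lambda>_. b * tv G)"
    proof (rule pmf_mean_mono)
      fix \<eta> assume "\<eta> \<in> ?T"
      from close[OF \<tau>(1)[OF this]] \<tau>(2)[OF this] show "norm (\<eta> - ?\<tau> \<eta>) powr 1 \<le> b * tv G"
        by (simp add: norm_minus_commute)
    qed
    then show ?thesis using \<tau>(1) T(1) by auto
  qed
  obtain g Bg L where g: "L \<ge> 0" "\<And>i. i \<in> ?S \<Longrightarrow> poly_bound (2 * card ?S - 1) (Bg i) (g i)"
    "\<And>i k \<eta>. i \<in> ?S \<Longrightarrow> k \<in> ?S \<Longrightarrow> \<eta> \<in> prob_simplex \<Longrightarrow> \<bar>g i \<eta> - of_bool (k = i)\<bar> \<le> L * (norm (\<eta> - k))\<^sup>2"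
    using hermite_indicators[OF S] by metis
  have g1: "\<bar>g i \<eta> - of_bool (k = i)\<bar> \<le> 2 * L * norm (\<eta> - k) powr 1"
    if "i \<in> ?S" "k \<in> ?S" "\<eta> \<in> prob_simplex" for i k \<eta>
  proof -
    have "norm (\<eta> - k) * norm (\<eta> - k) \<le> 2 * norm (\<eta> - k)"
      using that S by (intro mult_right_mono prob_simplex_dist_le) auto
    then have "L * (norm (\<eta> - k))\<^sup>2 \<le> L * (2 * norm (\<eta> - k))"
      using g(1) by (simp add: power2_eq_square mult_left_mono)
    with g(3)[OF that] show ?thesis by (simp add: mult_ac)
  qed
  obtain K where K: "\<And>G \<tau>. simplex_pmf G \<Longrightarrow> (\<forall>\<eta>\<in>set_pmf G. \<tau> \<eta> \<in> ?S) \<Longrightarrow>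
     pmf_mean G (\<lambda>\<eta>. norm (\<eta> - \<tau> \<eta>) powr 1) \<le> b * tv G \<Longrightarrow> wasserstein 1 G G0 powr 1 \<le> K * tv G"
    using wasserstein_control[OF zero_less_one N g(2) _ g1, of b] g(1) by auto
  have \<epsilon>: "\<delta> ^ ?K / (a + 1) > 0" using a(1) \<delta>(1) by simp
  show ?thesis
  proof (rule small_tv_suffices[OF \<epsilon> zero_less_one \<C>(1)])
    fix G assume G: "G \<in> \<C>" and t: "tv G < \<delta> ^ ?K / (a + 1)"
    have "a * tv G \<le> (a + 1) * tv G" by (intro mult_right_mono) auto
    also have "\<dots> < \<delta> ^ ?K" using t a(1) by (simp add: field_simps)
    finally show "wasserstein 1 G G0 powr 1 \<le> K * tv G"
      using matching[OF G] K[OF \<C>(1)[OF G]] by blast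
  qed
qed

end

section \<open>Atoms with dual linear forms\<close>
locale lda_dual = lda_reference \<alpha> N G0
  for \<alpha> :: real and N :: nat and G0 :: "(real ^ 'v) pmf" +
  fixes z :: "real ^ 'v \<Rightarrow> real ^ 'v"
  assumes dual: "\<And>i l. i \<in> set_pmf G0 \<Longrightarrow> l \<in> set_pmf G0 \<Longrightarrow> z i \<bullet> l = of_bool (i = l)"
begin

text \<open>The linear form \<open>\<eta> \<mapsto> (\<eta> - \<Sum>\<^sub>i (z i \<bullet> \<eta>) i) $ v\<close>.\<close>
definition residual_form :: "'v \<Rightarrow> real ^ 'v" where
  "residual_form v = axis v 1 - (\<Sum>i\<in>set_pmf G0. (i $ v) *\<^sub>R z i)"

definition atom_pairs :: "((real ^ 'v) \<times> (real ^ 'v)) set" where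
  "atom_pairs = {p \<in> set_pmf G0 \<times> set_pmf G0. fst p \<noteq> snd p}"

text \<open>A sum of absolute values of polynomials of degree at most \<open>2\<close> that vanish at the atoms of \<open>G0\<close>.\<close>
definition off_atoms :: "real ^ 'v \<Rightarrow> real" where
  "off_atoms \<eta> = (\<Sum>v\<in>UNIV. \<bar>residual_form v \<bullet> \<eta>\<bar>) +
     (\<Sum>p\<in>atom_pairs. \<bar>(z (fst p) \<bullet> \<eta>) * (z (snd p) \<bullet> \<eta>)\<bar>)"

lemma G0_finite: "finite (set_pmf G0)" and G0_simplex: "set_pmf G0 \<subseteq> prob_simplex"
  using G0 by (auto simp: simplex_pmf_def)

lemma atom_pairs_finite: "finite atom_pairs"
  unfolding atom_pairs_def using G0_finite by (intro finite_Collect_conjI disjI1) simp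

lemma residual_form_component:
  "residual_form v \<bullet> \<eta> = (\<eta> - (\<Sum>i\<in>set_pmf G0. (z i \<bullet> \<eta>) *\<^sub>R i)) $ v"
  unfolding residual_form_def
  by (simp add: inner_diff_left inner_axis' inner_sum_left mult.commute)

lemma residual_form_atom: "i \<in> set_pmf G0 \<Longrightarrow> residual_form v \<bullet> i = 0"
proof -
  assume i: "i \<in> set_pmf G0"
  have "(\<Sum>l\<in>set_pmf G0. (z l \<bullet> i) *\<^sub>R l) = (\<Sum>l\<in>{i}. (z l \<bullet> i) *\<^sub>R l)"
    using i G0_finite by (intro sum.mono_neutral_right) (auto simp: dual)
  then show ?thesis using i by (simp add: residual_form_component dual)
qed

lemma pair_product_atom:
  assumes "p \<in> atom_pairs" "i \<in> set_pmf G0"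
  shows "(z (fst p) \<bullet> i) * (z (snd p) \<bullet> i) = 0"
  using assms by (auto simp: atom_pairs_def dual)

text \<open>On the simplex \<open>off_atoms\<close> controls the distance to the atoms: a point without residual is
  \<open>\<Sum>\<^sub>i \<ell>\<^sub>i(\<eta>) \<theta>\<^sub>i\<close> with \<open>\<Sum>\<^sub>i \<ell>\<^sub>i(\<eta>) = 1\<close>, and if all products vanish only one
  coordinate survives.\<close>

lemma distance_le_off_atoms:
  "\<exists>C\<ge>0. \<forall>\<eta>\<in>prob_simplex. \<exists>k\<in>set_pmf G0. norm (\<eta> - k) \<le> C * off_atoms \<eta>"
proof -
  let ?S = "set_pmf G0"
  define n where "n = real (card ?S)"
  have n: "n > 0" unfolding n_def using G0_finite set_pmf_not_empty[of G0] by (simp add: card_gt_0_iff)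
  show ?thesis
  proof (intro exI[of _ "4 + 4 * n"] conjI ballI)
    show "0 \<le> 4 + 4 * n" using n by simp
    fix \<eta> :: "real ^ 'v" assume \<eta>: "\<eta> \<in> prob_simplex"
    define l where "l i = z i \<bullet> \<eta>" for i
    define x where "x = \<eta> - (\<Sum>i\<in>?S. l i *\<^sub>R i)"
    define R where "R = (\<Sum>v\<in>UNIV. \<bar>residual_form v \<bullet> \<eta>\<bar>)"
    define Q where "Q = (\<Sum>p\<in>atom_pairs. \<bar>l (fst p) * l (snd p)\<bar>)"
    have off: "off_atoms \<eta> = R + Q" unfolding off_atoms_def R_def Q_def l_def ..
    have Rx: "R = (\<Sum>v\<in>UNIV. \<bar>x $ v\<bar>)" unfolding R_def residual_form_component x_def l_def ..
    have R0: "R \<ge> 0" and Q0: "Q \<ge> 0" unfolding R_def Q_def by (auto intro: sum_nonneg)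
    have nx: "norm x \<le> R" unfolding Rx by (rule norm_le_l1_cart)
    have "(\<Sum>v\<in>UNIV. x $ v) = (\<Sum>v\<in>UNIV. \<eta> $ v) - (\<Sum>v\<in>UNIV. \<Sum>i\<in>?S. l i * i $ v)"
      unfolding x_def by (simp add: sum_subtractf)
    also have "(\<Sum>v\<in>UNIV. \<Sum>i\<in>?S. l i * i $ v) = (\<Sum>i\<in>?S. l i * (\<Sum>v\<in>UNIV. i $ v))"
      unfolding sum_distrib_left by (rule sum.swap)
    also have "\<dots> = (\<Sum>i\<in>?S. l i)"
      using G0_simplex by (intro sum.cong) (auto simp: prob_simplex_def)
    finally have "1 - (\<Sum>i\<in>?S. l i) = (\<Sum>v\<in>UNIV. x $ v)" using \<eta> by (simp add: prob_simplex_def)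
    also have "\<bar>\<dots>\<bar> \<le> R" unfolding Rx by (rule sum_abs)
    finally have sl: "\<bar>1 - (\<Sum>i\<in>?S. l i)\<bar> \<le> R" .
    show "\<exists>k\<in>?S. norm (\<eta> - k) \<le> (4 + 4 * n) * off_atoms \<eta>"
    (* If the residual is large, the diameter bound suffices; otherwise some coordinate is at least 1 / (2 n). *)
    proof (cases "R \<ge> 1 / 2")
      case True
      obtain k where k: "k \<in> ?S" using set_pmf_not_empty[of G0] by blast
      have "norm (\<eta> - k) \<le> 2" using k \<eta> G0_simplex by (intro prob_simplex_dist_le) auto
      also have "\<dots> \<le> 4 * (R + Q)" using True Q0 by simp
      also have "\<dots> \<le> (4 + 4 * n) * (R + Q)" using n R0 Q0 by (intro mult_right_mono) auto
      finally show ?thesis using k off by auto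
    next
      case False
      have "Max (l ` ?S) \<in> l ` ?S" using G0_finite by (intro Max_in) (auto simp: set_pmf_not_empty)
      then obtain k where k: "k \<in> ?S" "l k = Max (l ` ?S)" by auto
      have max: "l i \<le> l k" if "i \<in> ?S" for i using that G0_finite k(2) by simp
      have "(\<Sum>i\<in>?S. l i) \<le> n * l k"
        using sum_bounded_above[of ?S l "l k"] max by (simp add: n_def)
      then have lk: "1 / 2 \<le> n * l k" using False sl by linarith
      have each: "\<bar>l i\<bar> \<le> 2 * n * \<bar>l k * l i\<bar>" for i
      proof -
        have "l k > 0" using lk n zero_less_mult_pos[of n "l k"] by linarith
        then have "1 * \<bar>l i\<bar> \<le> (2 * (n * l k)) * \<bar>l i\<bar>" using lk by (intro mult_right_mono) auto
        then show ?thesis using \<open>l k > 0\<close> by (simp add: abs_mult mult_ac)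
      qed
      define s where "s = (\<Sum>i\<in>?S - {k}. \<bar>l i\<bar>)"
      have "(\<Sum>i\<in>?S - {k}. \<bar>l k * l i\<bar>) = (\<Sum>p\<in>Pair k ` (?S - {k}). \<bar>l (fst p) * l (snd p)\<bar>)"
        by (subst sum.reindex) (auto simp: inj_on_def)
      also have "\<dots> \<le> Q" unfolding Q_def
        using k(1) atom_pairs_finite by (intro sum_mono2) (auto simp: atom_pairs_def)
      finally have "2 * n * (\<Sum>i\<in>?S - {k}. \<bar>l k * l i\<bar>) \<le> 2 * n * Q"
        using n by (intro mult_left_mono) auto
      moreover have "s \<le> 2 * n * (\<Sum>i\<in>?S - {k}. \<bar>l k * l i\<bar>)"
        unfolding s_def sum_distrib_left by (intro sum_mono each)
      ultimately have s: "s \<le> 2 * n * Q" by linarith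
      have "\<bar>\<Sum>i\<in>?S - {k}. l i\<bar> \<le> s" unfolding s_def by (rule sum_abs)
      then have k1: "\<bar>l k - 1\<bar> \<le> R + s"
        using sl unfolding sum.remove[OF G0_finite k(1)] by linarith
      have "\<eta> - k = x + (l k - 1) *\<^sub>R k + (\<Sum>i\<in>?S - {k}. l i *\<^sub>R i)"
        unfolding x_def sum.remove[OF G0_finite k(1)] by (simp add: algebra_simps)
      then have "norm (\<eta> - k) \<le> norm x + norm ((l k - 1) *\<^sub>R k) + norm (\<Sum>i\<in>?S - {k}. l i *\<^sub>R i)"
        using norm_triangle_ineq[of "x + (l k - 1) *\<^sub>R k" "\<Sum>i\<in>?S - {k}. l i *\<^sub>R i"]
          norm_triangle_ineq[of x "(l k - 1) *\<^sub>R k"] by simp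
      also have "\<dots> \<le> R + (R + s) + s"
      proof (intro add_mono nx)
        have "norm ((l k - 1) *\<^sub>R k) \<le> \<bar>l k - 1\<bar> * 1"
          unfolding norm_scaleR using k(1) G0_simplex by (intro mult_left_mono prob_simplex_norm_le) auto
        then show "norm ((l k - 1) *\<^sub>R k) \<le> R + s" by (rule order_trans) (use k1 in simp)
        have "norm (l i *\<^sub>R i) \<le> \<bar>l i\<bar>" if "i \<in> ?S - {k}" for i
          unfolding norm_scaleR using that G0_simplex
          by (intro mult_left_le prob_simplex_norm_le) auto
        then show "norm (\<Sum>i\<in>?S - {k}. l i *\<^sub>R i) \<le> s"
          unfolding s_def by (rule sum_norm_le)
      qed
      also have "\<dots> \<le> 2 * R + 2 * (2 * n * Q)" using s by linarith
      also have "\<dots> \<le> (4 + 4 * n) * (R + Q)"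
        using n R0 Q0 by (simp add: algebra_simps)
      finally show ?thesis using k(1) off by auto
    qed
  qed
qed

lemma dual_form_diff:
  assumes "i \<in> set_pmf G0" "k \<in> set_pmf G0"
  shows "\<bar>z i \<bullet> \<eta> - of_bool (k = i)\<bar> \<le> norm (z i) * norm (\<eta> - k)"
proof -
  have "z i \<bullet> \<eta> - of_bool (k = i) = z i \<bullet> (\<eta> - k)"
    using dual[OF assms] by (auto simp: inner_diff_right)
  then show ?thesis by (simp add: Cauchy_Schwarz_ineq2)
qed

text \<open>Squaring the summands of \<open>off_atoms\<close> gives a nonnegative polynomial of degree \<open>4\<close> with mean \<open>0\<close>
  under \<open>G0\<close> that dominates the squared distance to the atoms. The cubic \<open>3 x\<^sup>2 - 2 x\<^sup>3\<close> takes the values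
  \<open>0\<close> and \<open>1\<close> at \<open>0\<close> and \<open>1\<close> with vanishing derivative, so composed with a dual form it tests the masses.\<close>
theorem inverse_bound_W2_dual:
  assumes N: "4 \<le> N" and \<C>: "\<And>G. G \<in> \<C> \<Longrightarrow> simplex_pmf G"
  shows "inverse_bound \<alpha> 2 N G0 \<C>"
proof -
  let ?S = "set_pmf G0"
  let ?r = "\<lambda>\<eta>. \<Sum>v\<in>UNIV. (residual_form v \<bullet> \<eta>) * (residual_form v \<bullet> \<eta>)"
  let ?h = "\<lambda>p \<eta>. (z (fst p) \<bullet> \<eta>) * (z (snd p) \<bullet> \<eta>)"
  let ?q = "\<lambda>\<eta>. \<Sum>p\<in>atom_pairs. ?h p \<eta> * ?h p \<eta>"
  have "poly_bound (1 + 1) (\<Sum>v\<in>UNIV. norm (residual_form v) * norm (residual_form v)) ?r"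
    by (intro poly_bound_sum finite poly_bound_mult poly_bound_linear)
  from poly_bound_mono[OF this, of 4, OF _ order_refl] obtain B1 where 1: "poly_bound 4 B1 ?r" by auto
  have "poly_bound ((1 + 1) + (1 + 1)) (\<Sum>p\<in>atom_pairs. (norm (z (fst p)) * norm (z (snd p))) * (norm (z (fst p)) * norm (z (snd p)))) ?q"
    by (intro poly_bound_sum atom_pairs_finite poly_bound_mult poly_bound_linear)
  from poly_bound_mono[OF this, of 4, OF _ order_refl] obtain B2 where 2: "poly_bound 4 B2 ?q" by auto
  from poly_bound.add[OF 1 2] obtain B where f: "poly_bound 4 B (\<lambda>\<eta>. ?r \<eta> + ?q \<eta>)" by blast
  define m where "m = 2 * real CARD('v) + 2 * real (card atom_pairs)"
  have sq: "(off_atoms \<eta>)\<^sup>2 \<le> m * (?r \<eta> + ?q \<eta>)" for \<eta>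
  proof -
    let ?R = "\<Sum>v\<in>UNIV. \<bar>residual_form v \<bullet> \<eta>\<bar>" and ?Q = "\<Sum>p\<in>atom_pairs. \<bar>?h p \<eta>\<bar>"
    have r0: "?r \<eta> \<ge> 0" and q0: "?q \<eta> \<ge> 0" by (intro sum_nonneg; simp)+
    have R: "?R\<^sup>2 \<le> ?r \<eta> * CARD('v)"
      using sum_squared_le_sum_of_squares[of "\<lambda>v. \<bar>residual_form v \<bullet> \<eta>\<bar>" UNIV]
      by (simp add: power2_eq_square)
    have Q: "?Q\<^sup>2 \<le> ?q \<eta> * card atom_pairs"
      using sum_squared_le_sum_of_squares[of "\<lambda>p. \<bar>?h p \<eta>\<bar>" atom_pairs]
      by (simp only: power2_abs) (simp only: power2_eq_square)
    have "(off_atoms \<eta>)\<^sup>2 \<le> 2 * ?R\<^sup>2 + 2 * ?Q\<^sup>2"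
      unfolding off_atoms_def using sum_squares_bound[of ?R ?Q] by (simp add: power2_sum)
    also have "\<dots> \<le> 2 * (?r \<eta> * CARD('v)) + 2 * (?q \<eta> * card atom_pairs)" using R Q by linarith
    also have "\<dots> = 2 * real CARD('v) * ?r \<eta> + 2 * real (card atom_pairs) * ?q \<eta>" by simp
    also have "\<dots> \<le> m * ?r \<eta> + m * ?q \<eta>"
      unfolding m_def using r0 q0 by (intro add_mono mult_right_mono) auto
    finally show ?thesis by (simp add: distrib_left)
  qed
  have m0: "m \<ge> 0" by (simp add: m_def)
  have f0: "pmf_mean G0 (\<lambda>\<eta>. ?r \<eta> + ?q \<eta>) = 0"
  proof -
    have "?r i + ?q i = 0" if "i \<in> ?S" for i
      using that by (simp add: residual_form_atom pair_product_atom)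
    then show ?thesis unfolding pmf_mean_def by (intro sum.neutral) simp
  qed
  obtain c where c: "c \<ge> 0" "\<And>\<eta>. \<eta> \<in> prob_simplex \<Longrightarrow> \<exists>k\<in>?S. norm (\<eta> - k) \<le> c * off_atoms \<eta>"
    using distance_le_off_atoms by blast
  then obtain \<tau> where \<tau>: "\<And>\<eta>. \<eta> \<in> prob_simplex \<Longrightarrow> \<tau> \<eta> \<in> ?S"
    "\<And>\<eta>. \<eta> \<in> prob_simplex \<Longrightarrow> norm (\<eta> - \<tau> \<eta>) \<le> c * off_atoms \<eta>" by metis
  have near: "pmf_mean G (\<lambda>\<eta>. norm (\<eta> - \<tau> \<eta>) powr 2) \<le> (c\<^sup>2 * m * (\<kappa> * B)) * tv G" if G: "simplex_pmf G" for G
  proof -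
    have "pmf_mean G (\<lambda>\<eta>. norm (\<eta> - \<tau> \<eta>) powr 2) \<le> pmf_mean G (\<lambda>\<eta>. c\<^sup>2 * m * (?r \<eta> + ?q \<eta>))"
    proof (rule pmf_mean_mono)
      fix \<eta> assume "\<eta> \<in> set_pmf G"
      then have "\<eta> \<in> prob_simplex" using G by (auto simp: simplex_pmf_def)
      then have "(norm (\<eta> - \<tau> \<eta>))\<^sup>2 \<le> (c * off_atoms \<eta>)\<^sup>2" by (intro power_mono \<tau>) auto
      also have "\<dots> \<le> c\<^sup>2 * (m * (?r \<eta> + ?q \<eta>))"
        unfolding power_mult_distrib by (intro mult_left_mono sq) auto
      finally show "norm (\<eta> - \<tau> \<eta>) powr 2 \<le> c\<^sup>2 * m * (?r \<eta> + ?q \<eta>)" by (simp add: mult.assoc)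
    qed
    also have "\<dots> = c\<^sup>2 * m * pmf_mean G (\<lambda>\<eta>. ?r \<eta> + ?q \<eta>)" by (rule pmf_mean_cmult)
    also have "\<dots> \<le> c\<^sup>2 * m * (\<kappa> * B * tv G)"
      using poly_deviation[OF G N f] m0 unfolding f0 by (intro mult_left_mono) auto
    finally show ?thesis by (simp add: mult.assoc)
  qed
  let ?g = "\<lambda>i \<eta>. 3 * ((z i \<bullet> \<eta>) * (z i \<bullet> \<eta>)) + (-2) * ((z i \<bullet> \<eta>) * ((z i \<bullet> \<eta>) * (z i \<bullet> \<eta>)))"
  define Bg where "Bg i = \<bar>3\<bar> * (norm (z i) * norm (z i)) + \<bar>-2\<bar> * (norm (z i) * (norm (z i) * norm (z i)))" for i
  have g: "poly_bound 4 (Bg i) (?g i)" for i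
  proof -
    have "poly_bound (1 + 1) (\<bar>3\<bar> * (norm (z i) * norm (z i))) (\<lambda>\<eta>. 3 * ((z i \<bullet> \<eta>) * (z i \<bullet> \<eta>)))"
      by (intro poly_bound_cmult poly_bound_mult poly_bound_linear)
    moreover have "poly_bound (1 + (1 + 1)) (\<bar>-2\<bar> * (norm (z i) * (norm (z i) * norm (z i))))
        (\<lambda>\<eta>. (-2) * ((z i \<bullet> \<eta>) * ((z i \<bullet> \<eta>) * (z i \<bullet> \<eta>))))"
      by (intro poly_bound_cmult poly_bound_mult poly_bound_linear)
    ultimately show ?thesis unfolding Bg_def
      by (intro poly_bound.add) (erule poly_bound_mono; simp)+
  qed
  define L where "L = (\<Sum>i\<in>?S. (norm (z i))\<^sup>2 * (3 + 4 * norm (z i)))"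
  have gL: "\<bar>?g i \<eta> - of_bool (k = i)\<bar> \<le> L * norm (\<eta> - k) powr 2"
    if i: "i \<in> ?S" and k: "k \<in> ?S" and \<eta>: "\<eta> \<in> prob_simplex" for i k \<eta>
  proof -
    define e where "e = (of_bool (k = i) :: real)"
    define t where "t = z i \<bullet> \<eta> - e"
    have e: "e = 0 \<or> e = 1" by (auto simp: e_def)
    have zl: "z i \<bullet> \<eta> = e + t" by (simp add: t_def)
    have t: "\<bar>t\<bar> \<le> norm (z i) * norm (\<eta> - k)"
      unfolding t_def e_def by (rule dual_form_diff[OF i k])
    have "norm (\<eta> - k) \<le> 2" using \<eta> k G0_simplex by (intro prob_simplex_dist_le) auto
    then have "norm (z i) * norm (\<eta> - k) \<le> norm (z i) * 2" by (rule mult_left_mono) simp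
    with t have t2: "\<bar>t\<bar> \<le> 2 * norm (z i)" by simp
    have "\<bar>?g i \<eta> - e\<bar> = t\<^sup>2 * \<bar>3 * (1 - 2 * e) - 2 * t\<bar>"
    proof -
      have "?g i \<eta> - e = t\<^sup>2 * (3 * (1 - 2 * e) - 2 * t)"
        unfolding zl using e by (auto simp: algebra_simps power2_eq_square)
      then show ?thesis by (simp add: abs_mult)
    qed
    also have "\<dots> \<le> t\<^sup>2 * (3 + 4 * norm (z i))"
      using e t2 by (intro mult_left_mono) auto
    also have "\<dots> \<le> (norm (z i) * norm (\<eta> - k))\<^sup>2 * (3 + 4 * norm (z i))"
      using power_mono[OF t, of 2] by (intro mult_right_mono) auto
    also have "\<dots> = ((norm (z i))\<^sup>2 * (3 + 4 * norm (z i))) * (norm (\<eta> - k))\<^sup>2"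
      by (simp add: power_mult_distrib mult_ac)
    also have "\<dots> \<le> L * (norm (\<eta> - k))\<^sup>2"
      unfolding L_def using i G0_finite by (intro mult_right_mono member_le_sum) auto
    finally show ?thesis by (simp add: e_def)
  qed
  have L0: "L \<ge> 0" unfolding L_def by (intro sum_nonneg) auto
  obtain K where K: "\<And>G \<tau>. simplex_pmf G \<Longrightarrow> (\<forall>\<eta>\<in>set_pmf G. \<tau> \<eta> \<in> ?S) \<Longrightarrow>
     pmf_mean G (\<lambda>\<eta>. norm (\<eta> - \<tau> \<eta>) powr 2) \<le> (c\<^sup>2 * m * (\<kappa> * B)) * tv G \<Longrightarrow> wasserstein 2 G G0 powr 2 \<le> K * tv G"
    using wasserstein_control[OF zero_less_numeral N g L0 gL, of "c\<^sup>2 * m * (\<kappa> * B)"] by blast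
  show ?thesis
  proof (rule inverse_boundI)
    fix G assume "G \<in> \<C>"
    then have G: "simplex_pmf G" by (rule \<C>)
    have "\<forall>\<eta>\<in>set_pmf G. \<tau> \<eta> \<in> ?S" using G \<tau>(1) by (auto simp: simplex_pmf_def)
    from K[OF G this near[OF G]] show "wasserstein 2 G G0 powr 2 \<le> K * tv G" .
  qed
qed

lemma span_expansion: "x \<in> span (set_pmf G0) \<Longrightarrow> x = (\<Sum>i\<in>set_pmf G0. (z i \<bullet> x) *\<^sub>R i)"
proof (induction rule: span_induct_alt)
  case base
  show ?case by simp
next
  case (step c i y)
  have "(\<Sum>l\<in>set_pmf G0. (z l \<bullet> i) *\<^sub>R l) = (\<Sum>l\<in>{i}. (z l \<bullet> i) *\<^sub>R l)"
    using step(1) G0_finite by (intro sum.mono_neutral_right) (auto simp: dual)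
  also have "\<dots> = i" using step(1) by (simp add: dual)
  finally have i: "(\<Sum>l\<in>set_pmf G0. (z l \<bullet> i) *\<^sub>R l) = i" .
  have "(\<Sum>l\<in>set_pmf G0. (z l \<bullet> (c *\<^sub>R i + y)) *\<^sub>R l) =
      c *\<^sub>R (\<Sum>l\<in>set_pmf G0. (z l \<bullet> i) *\<^sub>R l) + (\<Sum>l\<in>set_pmf G0. (z l \<bullet> y) *\<^sub>R l)"
    by (simp add: inner_add_right scaleR_add_left sum.distrib scaleR_sum_right)
  also have "\<dots> = c *\<^sub>R i + y" by (simp only: i step(2)[symmetric])
  finally show ?case by (rule sym)
qed

text \<open>Second moments bound the quadratic form \<open>a \<mapsto> \<integral>(a \<bullet> \<eta>)\<^sup>2 dG\<close> from below on the span of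
  the forms \<open>z i\<close>. So the evaluation of these forms at the atoms of \<open>G\<close> is injective with bounded
  inverse, and by a dimension count it is onto.\<close>

lemma dual_forms:
  assumes N: "2 \<le> N"
  shows "\<exists>\<epsilon>>0. \<exists>D\<ge>0. \<forall>G. simplex_pmf G \<longrightarrow> card (set_pmf G) = card (set_pmf G0) \<longrightarrow> tv G < \<epsilon> \<longrightarrow>
     (\<forall>k\<in>set_pmf G. \<exists>\<mu>. norm \<mu> \<le> D \<and> (\<forall>j\<in>set_pmf G. \<mu> \<bullet> j = of_bool (j = k)))"
proof -
  let ?S = "set_pmf G0"
  (* This constant comes from the Cauchy-Schwarz inequality with weights pmf G0 i; the summand 1 makes it positive. *)
  define Z where "Z = 1 + (\<Sum>i\<in>?S. (norm (z i))\<^sup>2 / pmf G0 i)"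
  have Z: "Z > 0" unfolding Z_def by (intro add_pos_nonneg sum_nonneg) auto
  (* F sends a combination of the atoms to the form in the span of the z i whose values at the atoms
     are the coefficients of this combination. *)
  define F where "F b = (\<Sum>i\<in>?S. (z i \<bullet> b) *\<^sub>R z i)" for b
  have F_atom: "F b \<bullet> i = z i \<bullet> b" if "i \<in> ?S" for b i
  proof -
    have "F b \<bullet> i = (\<Sum>l\<in>?S. (z l \<bullet> b) * (z l \<bullet> i))" by (simp add: F_def inner_sum_left)
    also have "\<dots> = (\<Sum>l\<in>{i}. (z l \<bullet> b) * (z l \<bullet> i))"
      using that G0_finite by (intro sum.mono_neutral_right) (auto simp: dual)
    finally show ?thesis using that by (simp add: dual)
  qed
  have F_lin: "linear F"
    unfolding F_def by (intro linear_compose_sum ballI linearI)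
      (auto simp: inner_add_right scaleR_add_left)
  let ?sq = "\<lambda>a \<eta>. (a \<bullet> \<eta>) * (a \<bullet> \<eta>)"
  have lower0: "(norm (F b))\<^sup>2 \<le> Z * pmf_mean G0 (?sq (F b))" for b
  proof -
    have "norm (F b) \<le> (\<Sum>i\<in>?S. norm ((z i \<bullet> b) *\<^sub>R z i))" unfolding F_def by (rule norm_sum)
    also have "\<dots> = (\<Sum>i\<in>?S. (sqrt (pmf G0 i) * \<bar>F b \<bullet> i\<bar>) * (norm (z i) / sqrt (pmf G0 i)))"
      by (intro sum.cong) (auto simp: F_atom set_pmf_iff)
    finally have "(norm (F b))\<^sup>2 \<le> \<dots>\<^sup>2" by (intro power_mono) auto
    also have "\<dots> \<le> (\<Sum>i\<in>?S. (sqrt (pmf G0 i) * \<bar>F b \<bullet> i\<bar>)\<^sup>2) * (\<Sum>i\<in>?S. (norm (z i) / sqrt (pmf G0 i))\<^sup>2)"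
      by (rule Cauchy_Schwarz_ineq_sum)
    also have "(\<Sum>i\<in>?S. (sqrt (pmf G0 i) * \<bar>F b \<bullet> i\<bar>)\<^sup>2) = pmf_mean G0 (?sq (F b))"
      unfolding pmf_mean_def by (intro sum.cong) (auto simp: power_mult_distrib power2_eq_square[of "_ \<bullet> _"])
    also have "(\<Sum>i\<in>?S. (norm (z i) / sqrt (pmf G0 i))\<^sup>2) = Z - 1"
      unfolding Z_def by (simp add: power_divide)
    also have "pmf_mean G0 (?sq (F b)) * (Z - 1) \<le> Z * pmf_mean G0 (?sq (F b))"
      by (simp add: algebra_simps pmf_mean_def sum_nonneg)
    finally show ?thesis .
  qed
  (* Below this threshold the deviation of the second moments uses up at most half of the lower bound. *)
  define \<epsilon> where "\<epsilon> = 1 / (2 * Z * (\<kappa> + 1))"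
  have \<epsilon>: "\<epsilon> > 0" unfolding \<epsilon>_def using Z \<kappa>_nonneg by simp
  have "\<exists>\<mu>. norm \<mu> \<le> 2 * Z + 1 \<and> (\<forall>j\<in>set_pmf G. \<mu> \<bullet> j = of_bool (j = k))"
    if G: "simplex_pmf G" and card: "card (set_pmf G) = card ?S" and small: "tv G < \<epsilon>"
      and k: "k \<in> set_pmf G" for G k
  proof -
    let ?T = "set_pmf G"
    have T: "finite ?T" using G by (simp add: simplex_pmf_def)
    have lower: "(norm (F b))\<^sup>2 \<le> 2 * Z * pmf_mean G (?sq (F b))" for b
    proof -
      let ?n = "(norm (F b))\<^sup>2"
      have "poly_bound 2 (norm (F b) * norm (F b)) (?sq (F b))"
        using poly_bound_mult[OF poly_bound_linear[of "F b"] poly_bound_linear[of "F b"]] by (simp add: numeral_2_eq_2)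
      from poly_deviation[OF G N this]
      have "pmf_mean G0 (?sq (F b)) \<le> pmf_mean G (?sq (F b)) + \<kappa> * ?n * tv G"
        by (simp add: power2_eq_square)
      then have "Z * pmf_mean G0 (?sq (F b)) \<le> Z * (pmf_mean G (?sq (F b)) + \<kappa> * ?n * tv G)"
        using Z by (intro mult_left_mono) auto
      with lower0[of b] have "?n \<le> Z * pmf_mean G (?sq (F b)) + (Z * \<kappa> * tv G) * ?n"
        by (simp add: algebra_simps)
      also have "Z * \<kappa> * tv G \<le> 1 / 2"
      proof -
        have "Z * \<kappa> * tv G \<le> Z * (\<kappa> + 1) * \<epsilon>" using Z \<kappa>_nonneg small by (intro mult_mono) auto
        also have "\<dots> = 1 / 2" unfolding \<epsilon>_def using Z \<kappa>_nonneg by simp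
        finally show ?thesis .
      qed
      then have "(Z * \<kappa> * tv G) * ?n \<le> 1 / 2 * ?n" by (rule mult_right_mono) simp
      finally show ?thesis by simp
    qed
    obtain \<pi> where \<pi>: "bij_betw \<pi> ?T ?S" using finite_same_card_bij[OF T G0_finite card] by blast
    have \<pi>S: "\<pi> j \<in> ?S" if "j \<in> ?T" for j using that \<pi> by (auto simp: bij_betw_def)
    have \<pi>inj: "\<pi> j = \<pi> j' \<longleftrightarrow> j = j'" if "j \<in> ?T" "j' \<in> ?T" for j j'
      using that \<pi> by (auto simp: bij_betw_def inj_on_def)
    (* The values of F b at the atoms of G, written as coefficients at the atoms of G0: an endomorphism of
       the span, for which injectivity implies surjectivity. *)
    define \<Phi> where "\<Phi> b = (\<Sum>j\<in>?T. (F b \<bullet> j) *\<^sub>R \<pi> j)" for b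
    have \<Phi>_lin: "linear \<Phi>"
      unfolding \<Phi>_def by (intro linear_compose_sum ballI linearI)
        (auto simp: linear_add[OF F_lin] linear_cmul[OF F_lin] inner_add_left scaleR_add_left)
    have coord: "z (\<pi> j) \<bullet> \<Phi> b = F b \<bullet> j" if j: "j \<in> ?T" for j b
    proof -
      have "z (\<pi> j) \<bullet> \<Phi> b = (\<Sum>i\<in>?T. (F b \<bullet> i) * of_bool (i = j))"
        unfolding \<Phi>_def inner_sum_right using j by (intro sum.cong) (auto simp: dual \<pi>S \<pi>inj)
      also have "\<dots> = (\<Sum>i\<in>{j}. (F b \<bullet> i) * of_bool (i = j))"
        using j T by (intro sum.mono_neutral_right) auto
      finally show ?thesis by simp
    qed
    let ?H = "span ?S"
    have inj: "inj_on \<Phi> ?H"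
    proof (subst linear_injective_on_subspace_0[OF \<Phi>_lin subspace_span], intro ballI impI)
      fix b assume b: "b \<in> ?H" and 0: "\<Phi> b = 0"
      have "F b \<bullet> j = 0" if "j \<in> ?T" for j using coord[OF that, of b] 0 by simp
      then have "pmf_mean G (?sq (F b)) = 0" unfolding pmf_mean_def by (intro sum.neutral) simp
      with lower[of b] have "F b = 0" by simp
      then have "z i \<bullet> b = 0" if "i \<in> ?S" for i using F_atom[OF that, of b] by simp
      then have "(\<Sum>i\<in>?S. (z i \<bullet> b) *\<^sub>R i) = 0" by (intro sum.neutral) simp
      with span_expansion[OF b] show "b = 0" by simp
    qed
    have "\<Phi> ` ?H = ?H"
    proof (rule subspace_dim_equal)
      show "subspace (\<Phi> ` ?H)" by (intro linear_subspace_image \<Phi>_lin subspace_span)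
      show "\<Phi> ` ?H \<subseteq> ?H"
        unfolding \<Phi>_def by (intro image_subsetI span_sum span_scale span_base \<pi>S)
      show "dim ?H \<le> dim (\<Phi> ` ?H)"
        using dim_image_eq[OF \<Phi>_lin, of ?H] inj by (simp add: span_span)
    qed (rule subspace_span)
    moreover have "\<pi> k \<in> ?H" using \<pi>S[OF k] by (rule span_base)
    ultimately obtain b where b: "\<Phi> b = \<pi> k" by (metis imageE)
    have val: "F b \<bullet> j = of_bool (j = k)" if "j \<in> ?T" for j
      using coord[OF that, of b] dual[OF \<pi>S[OF that] \<pi>S[OF k]] \<pi>inj[OF that k] unfolding b by simp
    have "pmf_mean G (?sq (F b)) \<le> pmf_mean G (\<lambda>_. 1)"
      by (intro pmf_mean_mono) (auto simp: val)
    then have "2 * Z * pmf_mean G (?sq (F b)) \<le> 2 * Z * 1" using Z T by (intro mult_left_mono) auto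
    with lower[of b] have "(norm (F b))\<^sup>2 \<le> 2 * Z" by linarith
    moreover have "2 * norm (F b) \<le> (norm (F b))\<^sup>2 + 1"
      using sum_squares_bound[of "norm (F b)" 1] by simp
    ultimately have "norm (F b) \<le> 2 * Z + 1" using Z by linarith
    with val show ?thesis by blast
  qed
  then show ?thesis using \<epsilon> Z by (intro exI[of _ \<epsilon>] conjI exI[of _ "2 * Z + 1"]) auto
qed

text \<open>Multiplying a test function by the form that singles out one atom \<open>k\<close> of \<open>G\<close> isolates its
  value there, so signs cannot cancel any more; this costs one degree.\<close>

lemma absolute_deviation:
  assumes N: "2 \<le> N" and d: "Suc d \<le> N" and f: "poly_bound d B f" and 0: "\<And>i. i \<in> set_pmf G0 \<Longrightarrow> f i = 0"
  shows "\<exists>\<epsilon>>0. \<exists>K\<ge>0. \<forall>G. simplex_pmf G \<longrightarrow> card (set_pmf G) = card (set_pmf G0) \<longrightarrow> tv G < \<epsilon> \<longrightarrow>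
     pmf_mean G (\<lambda>\<eta>. \<bar>f \<eta>\<bar>) \<le> K * tv G"
proof -
  let ?S = "set_pmf G0"
  obtain \<epsilon> D where \<epsilon>: "\<epsilon> > 0" and D: "D \<ge> 0"
    "\<And>G k. simplex_pmf G \<Longrightarrow> card (set_pmf G) = card ?S \<Longrightarrow> tv G < \<epsilon> \<Longrightarrow> k \<in> set_pmf G \<Longrightarrow>
      \<exists>\<mu>. norm \<mu> \<le> D \<and> (\<forall>j\<in>set_pmf G. \<mu> \<bullet> j = of_bool (j = k))"
    using dual_forms[OF N] by blast
  have B: "B \<ge> 0" using f by (rule poly_bound_nonneg)
  have "pmf_mean G (\<lambda>\<eta>. \<bar>f \<eta>\<bar>) \<le> real (card ?S) * (\<kappa> * (D * B)) * tv G"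
    if G: "simplex_pmf G" and card: "card (set_pmf G) = card ?S" and small: "tv G < \<epsilon>" for G
  proof -
    let ?T = "set_pmf G"
    have T: "finite ?T" using G by (simp add: simplex_pmf_def)
    have "pmf G k * \<bar>f k\<bar> \<le> \<kappa> * (D * B) * tv G" if k: "k \<in> ?T" for k
    proof -
      obtain \<mu> where \<mu>: "norm \<mu> \<le> D" "\<And>j. j \<in> ?T \<Longrightarrow> \<mu> \<bullet> j = of_bool (j = k)"
        using D(2)[OF G card small k] by blast
      have "pmf_mean G (\<lambda>\<eta>. (\<mu> \<bullet> \<eta>) * f \<eta>) = (\<Sum>\<eta>\<in>{k}. pmf G \<eta> * ((\<mu> \<bullet> \<eta>) * f \<eta>))"
        unfolding pmf_mean_def using T k by (intro sum.mono_neutral_right) (auto simp: \<mu>)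
      also have "\<dots> = pmf G k * f k" using k by (simp add: \<mu>)
      finally have 1: "pmf_mean G (\<lambda>\<eta>. (\<mu> \<bullet> \<eta>) * f \<eta>) = pmf G k * f k" .
      have 2: "pmf_mean G0 (\<lambda>\<eta>. (\<mu> \<bullet> \<eta>) * f \<eta>) = 0"
        unfolding pmf_mean_def by (intro sum.neutral) (simp add: 0)
      have "\<bar>pmf G k * f k\<bar> \<le> \<kappa> * (norm \<mu> * B) * tv G"
        using poly_deviation[OF G d poly_bound.times[OF f, of \<mu>]] unfolding 1 2 by simp
      also have "\<dots> \<le> \<kappa> * (D * B) * tv G"
        using \<kappa>_nonneg B \<mu>(1) by (intro mult_right_mono mult_left_mono) auto
      finally show ?thesis by (simp add: abs_mult)
    qed
    then have "pmf_mean G (\<lambda>\<eta>. \<bar>f \<eta>\<bar>) \<le> (\<Sum>k\<in>?T. \<kappa> * (D * B) * tv G)"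
      unfolding pmf_mean_def by (rule sum_mono)
    then show ?thesis using card by (simp add: mult.assoc)
  qed
  moreover have "0 \<le> real (card ?S) * (\<kappa> * (D * B))" using \<kappa>_nonneg D(1) B by simp
  ultimately show ?thesis using \<epsilon> by blast
qed

text \<open>The cross terms are the only place where the third moment is needed in general.\<close>

theorem inverse_bound_W1_dual:
  assumes N: "2 \<le> N"
    and \<C>: "\<And>G. G \<in> \<C> \<Longrightarrow> simplex_pmf G" "\<And>G. G \<in> \<C> \<Longrightarrow> card (set_pmf G) = card (set_pmf G0)"
    and cross: "\<And>p. p \<in> atom_pairs \<Longrightarrow> \<exists>\<epsilon>>0. \<exists>K\<ge>0. \<forall>G\<in>\<C>. tv G < \<epsilon> \<longrightarrow>
       pmf_mean G (\<lambda>\<eta>. \<bar>(z (fst p) \<bullet> \<eta>) * (z (snd p) \<bullet> \<eta>)\<bar>) \<le> K * tv G"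
  shows "inverse_bound \<alpha> 1 N G0 \<C>"
proof -
  let ?S = "set_pmf G0"
  have N2: "Suc 1 \<le> N" using N by simp
  have "\<exists>\<epsilon>>0. \<exists>K\<ge>0. \<forall>G\<in>\<C>. tv G < \<epsilon> \<longrightarrow> pmf_mean G (\<lambda>\<eta>. \<bar>residual_form v \<bullet> \<eta>\<bar>) \<le> K * tv G" for v
  proof -
    obtain \<epsilon> K where "\<epsilon> > 0" "K \<ge> 0" "\<forall>G. simplex_pmf G \<longrightarrow> card (set_pmf G) = card ?S \<longrightarrow> tv G < \<epsilon> \<longrightarrow>
       pmf_mean G (\<lambda>\<eta>. \<bar>residual_form v \<bullet> \<eta>\<bar>) \<le> K * tv G"
      using absolute_deviation[OF N N2 poly_bound_linear residual_form_atom, of v] by blast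
    then show ?thesis using \<C> by (intro exI[of _ \<epsilon>] conjI exI[of _ K] ballI) simp_all
  qed
  then have "\<forall>v. \<exists>\<epsilon>. \<epsilon> > 0 \<and> (\<exists>K\<ge>0. \<forall>G\<in>\<C>. tv G < \<epsilon> \<longrightarrow>
     pmf_mean G (\<lambda>\<eta>. \<bar>residual_form v \<bullet> \<eta>\<bar>) \<le> K * tv G)" by blast
  from choice[OF this] obtain \<epsilon>r where \<epsilon>r0: "\<And>v. \<epsilon>r v > 0"
    and "\<forall>v. \<exists>K. K \<ge> 0 \<and> (\<forall>G\<in>\<C>. tv G < \<epsilon>r v \<longrightarrow>
     pmf_mean G (\<lambda>\<eta>. \<bar>residual_form v \<bullet> \<eta>\<bar>) \<le> K * tv G)" by blast
  from choice[OF this(2)] obtain Kr where r: "\<And>v G. G \<in> \<C> \<Longrightarrow> tv G < \<epsilon>r v \<Longrightarrow>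
     pmf_mean G (\<lambda>\<eta>. \<bar>residual_form v \<bullet> \<eta>\<bar>) \<le> Kr v * tv G" by blast
  have "\<forall>p\<in>atom_pairs. \<exists>\<epsilon>. \<epsilon> > 0 \<and> (\<exists>K\<ge>0. \<forall>G\<in>\<C>. tv G < \<epsilon> \<longrightarrow>
     pmf_mean G (\<lambda>\<eta>. \<bar>(z (fst p) \<bullet> \<eta>) * (z (snd p) \<bullet> \<eta>)\<bar>) \<le> K * tv G)" using cross by blast
  from bchoice[OF this] obtain \<epsilon>p where \<epsilon>p0: "\<And>p. p \<in> atom_pairs \<Longrightarrow> \<epsilon>p p > 0"
    and "\<forall>p\<in>atom_pairs. \<exists>K. K \<ge> 0 \<and> (\<forall>G\<in>\<C>. tv G < \<epsilon>p p \<longrightarrow>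
     pmf_mean G (\<lambda>\<eta>. \<bar>(z (fst p) \<bullet> \<eta>) * (z (snd p) \<bullet> \<eta>)\<bar>) \<le> K * tv G)" by blast
  from bchoice[OF this(2)] obtain Kp where p: "\<And>p G. p \<in> atom_pairs \<Longrightarrow> G \<in> \<C> \<Longrightarrow> tv G < \<epsilon>p p \<Longrightarrow>
       pmf_mean G (\<lambda>\<eta>. \<bar>(z (fst p) \<bullet> \<eta>) * (z (snd p) \<bullet> \<eta>)\<bar>) \<le> Kp p * tv G" by blast
  define \<epsilon> where "\<epsilon> = Min (insert 1 (range \<epsilon>r \<union> \<epsilon>p ` atom_pairs))"
  have fin: "finite (insert 1 (range \<epsilon>r \<union> \<epsilon>p ` atom_pairs))" using atom_pairs_finite by simp
  have \<epsilon>: "\<epsilon> > 0" unfolding \<epsilon>_def using fin \<epsilon>r0 \<epsilon>p0 by (subst Min_gr_iff) auto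
  have \<epsilon>r: "\<epsilon> \<le> \<epsilon>r v" for v unfolding \<epsilon>_def using fin by (intro Min_le) auto
  have \<epsilon>p: "\<epsilon> \<le> \<epsilon>p p" if "p \<in> atom_pairs" for p unfolding \<epsilon>_def using fin that by (intro Min_le) auto
  define q where "q = (\<Sum>v\<in>UNIV. Kr v) + (\<Sum>p\<in>atom_pairs. Kp p)"
  have off: "pmf_mean G off_atoms \<le> q * tv G" if G: "G \<in> \<C>" and small: "tv G < \<epsilon>" for G
  proof -
    have "pmf_mean G off_atoms = (\<Sum>v\<in>UNIV. pmf_mean G (\<lambda>\<eta>. \<bar>residual_form v \<bullet> \<eta>\<bar>)) +
       (\<Sum>p\<in>atom_pairs. pmf_mean G (\<lambda>\<eta>. \<bar>(z (fst p) \<bullet> \<eta>) * (z (snd p) \<bullet> \<eta>)\<bar>))"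
      unfolding off_atoms_def[abs_def] pmf_mean_add pmf_mean_sum ..
    also have "\<dots> \<le> (\<Sum>v\<in>UNIV. Kr v * tv G) + (\<Sum>p\<in>atom_pairs. Kp p * tv G)"
    proof (intro add_mono sum_mono)
      show "pmf_mean G (\<lambda>\<eta>. \<bar>residual_form v \<bullet> \<eta>\<bar>) \<le> Kr v * tv G" for v
        using r[OF G] small \<epsilon>r[of v] by simp
      show "pmf_mean G (\<lambda>\<eta>. \<bar>(z (fst p) \<bullet> \<eta>) * (z (snd p) \<bullet> \<eta>)\<bar>) \<le> Kp p * tv G"
        if "p \<in> atom_pairs" for p
        using p[OF that G] small \<epsilon>p[OF that] by simp
    qed
    finally show ?thesis by (simp add: q_def sum_distrib_right distrib_right)
  qed
  obtain c where c: "c \<ge> 0" "\<And>\<eta>. \<eta> \<in> prob_simplex \<Longrightarrow> \<exists>k\<in>?S. norm (\<eta> - k) \<le> c * off_atoms \<eta>"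
    using distance_le_off_atoms by blast
  then obtain \<tau> where \<tau>: "\<And>\<eta>. \<eta> \<in> prob_simplex \<Longrightarrow> \<tau> \<eta> \<in> ?S"
    "\<And>\<eta>. \<eta> \<in> prob_simplex \<Longrightarrow> norm (\<eta> - \<tau> \<eta>) \<le> c * off_atoms \<eta>" by metis
  define L where "L = (\<Sum>i\<in>?S. norm (z i))"
  have L0: "L \<ge> 0" unfolding L_def by (intro sum_nonneg) auto
  have gL: "\<bar>z i \<bullet> \<eta> - of_bool (k = i)\<bar> \<le> L * norm (\<eta> - k) powr 1"
    if i: "i \<in> ?S" and k: "k \<in> ?S" and \<eta>: "\<eta> \<in> prob_simplex" for i k \<eta>
  proof -
    have "norm (z i) * norm (\<eta> - k) \<le> L * norm (\<eta> - k)"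
      unfolding L_def using i G0_finite by (intro mult_right_mono member_le_sum) auto
    with dual_form_diff[OF i k, of \<eta>] show ?thesis by simp
  qed
  have N1: "1 \<le> N" using N by simp
  obtain K where K: "\<And>G \<tau>. simplex_pmf G \<Longrightarrow> (\<forall>\<eta>\<in>set_pmf G. \<tau> \<eta> \<in> ?S) \<Longrightarrow>
     pmf_mean G (\<lambda>\<eta>. norm (\<eta> - \<tau> \<eta>) powr 1) \<le> (c * q) * tv G \<Longrightarrow> wasserstein 1 G G0 powr 1 \<le> K * tv G"
    using wasserstein_control[OF zero_less_one N1 poly_bound_linear L0 gL, of "c * q"] by blast
  show ?thesis
  proof (rule small_tv_suffices[OF \<epsilon> zero_less_one \<C>(1)])
    fix G assume GC: "G \<in> \<C>" and small: "tv G < \<epsilon>"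
    have T: "set_pmf G \<subseteq> prob_simplex" using \<C>(1)[OF GC] by (simp add: simplex_pmf_def)
    have "pmf_mean G (\<lambda>\<eta>. norm (\<eta> - \<tau> \<eta>) powr 1) \<le> pmf_mean G (\<lambda>\<eta>. c * off_atoms \<eta>)"
      using \<tau>(2) T by (intro pmf_mean_mono) auto
    also have "\<dots> = c * pmf_mean G off_atoms" by (rule pmf_mean_cmult)
    also have "\<dots> \<le> c * (q * tv G)" using off[OF GC small] c(1) by (rule mult_left_mono)
    finally show "wasserstein 1 G G0 powr 1 \<le> K * tv G"
      using K[OF \<C>(1)[OF GC]] \<tau>(1) T by (auto simp: mult.assoc)
  qed
qed

text \<open>The products of two different dual forms vanish at the atoms of \<open>G0\<close>, and one more degree
  isolates their values at single atoms of \<open>G\<close>.\<close>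
theorem inverse_bound_W1_degree_3:
  assumes N: "3 \<le> N"
    and \<C>: "\<And>G. G \<in> \<C> \<Longrightarrow> simplex_pmf G" "\<And>G. G \<in> \<C> \<Longrightarrow> card (set_pmf G) = card (set_pmf G0)"
  shows "inverse_bound \<alpha> 1 N G0 \<C>"
proof (rule inverse_bound_W1_dual[OF _ \<C>])
  show "2 \<le> N" using N by simp
  fix p assume p: "p \<in> atom_pairs"
  have d: "Suc (1 + 1) \<le> N" using N by simp
  obtain \<epsilon> K where "\<epsilon> > 0" "K \<ge> 0" "\<forall>G. simplex_pmf G \<longrightarrow> card (set_pmf G) = card (set_pmf G0) \<longrightarrow> tv G < \<epsilon> \<longrightarrow>
       pmf_mean G (\<lambda>\<eta>. \<bar>(z (fst p) \<bullet> \<eta>) * (z (snd p) \<bullet> \<eta>)\<bar>) \<le> K * tv G"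
    using absolute_deviation[OF \<open>2 \<le> N\<close> d poly_bound_mult[OF poly_bound_linear poly_bound_linear] pair_product_atom[OF p]]
    by blast
  then show "\<exists>\<epsilon>>0. \<exists>K\<ge>0. \<forall>G\<in>\<C>. tv G < \<epsilon> \<longrightarrow>
       pmf_mean G (\<lambda>\<eta>. \<bar>(z (fst p) \<bullet> \<eta>) * (z (snd p) \<bullet> \<eta>)\<bar>) \<le> K * tv G"
    using \<C> by (intro exI[of _ \<epsilon>] conjI exI[of _ K] ballI) simp_all
qed auto

text \<open>If the products of dual forms are nonnegative, their signed mean is already their absolute mean.\<close>
theorem inverse_bound_W1_nonneg:
  assumes N: "2 \<le> N" and nonneg: "\<And>i \<eta>. i \<in> set_pmf G0 \<Longrightarrow> \<eta> \<in> prob_simplex \<Longrightarrow> 0 \<le> z i \<bullet> \<eta>"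
    and \<C>: "\<And>G. G \<in> \<C> \<Longrightarrow> simplex_pmf G" "\<And>G. G \<in> \<C> \<Longrightarrow> card (set_pmf G) = card (set_pmf G0)"
  shows "inverse_bound \<alpha> 1 N G0 \<C>"
proof -
  have cross: "pmf_mean G (\<lambda>\<eta>. \<bar>(z (fst p) \<bullet> \<eta>) * (z (snd p) \<bullet> \<eta>)\<bar>)
      \<le> \<kappa> * (norm (z (fst p)) * norm (z (snd p))) * tv G"
    if p: "p \<in> atom_pairs" and G: "G \<in> \<C>" for p G
  proof -
    let ?h = "\<lambda>\<eta>. (z (fst p) \<bullet> \<eta>) * (z (snd p) \<bullet> \<eta>)"
    have "0 \<le> ?h \<eta>" if "\<eta> \<in> set_pmf G" for \<eta>
    proof (rule mult_nonneg_nonneg)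
      have "\<eta> \<in> prob_simplex" using that \<C>(1)[OF G] by (auto simp: simplex_pmf_def)
      moreover have "fst p \<in> set_pmf G0" "snd p \<in> set_pmf G0" using p by (auto simp: atom_pairs_def)
      ultimately show "0 \<le> z (fst p) \<bullet> \<eta>" "0 \<le> z (snd p) \<bullet> \<eta>" by (auto intro: nonneg)
    qed
    then have 1: "pmf_mean G (\<lambda>\<eta>. \<bar>?h \<eta>\<bar>) = pmf_mean G ?h" by (intro pmf_mean_cong) simp
    have 2: "pmf_mean G0 ?h = 0"
      unfolding pmf_mean_def by (intro sum.neutral) (simp add: pair_product_atom[OF p])
    have "poly_bound (1 + 1) (norm (z (fst p)) * norm (z (snd p))) ?h"
      by (intro poly_bound_mult poly_bound_linear)
    moreover have "1 + 1 \<le> N" using N by simp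
    ultimately have "\<bar>pmf_mean G ?h - pmf_mean G0 ?h\<bar> \<le> \<kappa> * (norm (z (fst p)) * norm (z (snd p))) * tv G"
      by (intro poly_deviation \<C>(1) G)
    then show ?thesis unfolding 1 2 by simp
  qed
  show ?thesis
  proof (rule inverse_bound_W1_dual[OF N \<C>])
    fix p assume p: "p \<in> atom_pairs"
    show "\<exists>\<epsilon>>0. \<exists>K\<ge>0. \<forall>G\<in>\<C>. tv G < \<epsilon> \<longrightarrow>
       pmf_mean G (\<lambda>\<eta>. \<bar>(z (fst p) \<bullet> \<eta>) * (z (snd p) \<bullet> \<eta>)\<bar>) \<le> K * tv G"
      by (intro exI[of _ 1] exI[of _ "\<kappa> * (norm (z (fst p)) * norm (z (snd p)))"] conjI ballI impI cross[OF p])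
        (simp_all add: \<kappa>_nonneg)
  qed auto
qed

end

section \<open>Minimal document lengths\<close>
lemma independent_dual_family:
  fixes S :: "(real ^ 'v) set"
  assumes "independent S"
  obtains z where "\<And>i l. i \<in> S \<Longrightarrow> l \<in> S \<Longrightarrow> z i \<bullet> l = of_bool (i = l)"
proof -
  have "\<exists>w. \<forall>l\<in>S. w \<bullet> l = of_bool (i = l)" for i
  proof -
    obtain g :: "real ^ 'v \<Rightarrow> real" where g: "linear g" "\<forall>l\<in>S. g l = of_bool (i = l)"
      using linear_independent_extend[OF assms, of "\<lambda>l. of_bool (i = l) :: real"] by blast
    have "adjoint g 1 \<bullet> l = g l" for l
      using adjoint_works[OF g(1), of l 1] by (simp add: inner_commute)
    with g(2) show ?thesis by (intro exI[of _ "adjoint g 1"]) simp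
  qed
  then have "\<forall>i. \<exists>w. \<forall>l\<in>S. w \<bullet> l = of_bool (i = l)" by blast
  from choice[OF this] obtain z where "\<forall>i. \<forall>l\<in>S. z i \<bullet> l = of_bool (i = l)" by blast
  then show thesis by (intro that[of z]) simp
qed

lemma anchor_dual_family:
  fixes S :: "(real ^ 'v) set"
  assumes "anchor_word S"
  obtains z where "\<And>i l. i \<in> S \<Longrightarrow> l \<in> S \<Longrightarrow> z i \<bullet> l = of_bool (i = l)"
    "\<And>i \<eta>. i \<in> S \<Longrightarrow> \<eta> \<in> prob_simplex \<Longrightarrow> 0 \<le> z i \<bullet> \<eta>"
proof -
  obtain v where v: "\<And>i. i \<in> S \<Longrightarrow> i $ v i > 0" "\<And>i l. i \<in> S \<Longrightarrow> l \<in> S \<Longrightarrow> l \<noteq> i \<Longrightarrow> l $ v i = 0"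
    using assms unfolding anchor_word_def by metis
  let ?z = "\<lambda>i. axis (v i) (1 / (i $ v i))"
  have z: "?z i \<bullet> \<eta> = \<eta> $ v i / i $ v i" for i \<eta> by (simp add: inner_axis')
  show thesis
  proof (rule that[of ?z])
    show "?z i \<bullet> l = of_bool (i = l)" if "i \<in> S" "l \<in> S" for i l
      using v(1)[OF that(1)] v(2)[OF that] by (cases "i = l") (auto simp: z)
    show "0 \<le> ?z i \<bullet> \<eta>" if "i \<in> S" "\<eta> \<in> prob_simplex" for i \<eta>
      using v(1)[OF that(1)] prob_simplex_coord(1)[OF that(2)] by (auto simp: z)
  qed
qed

lemma N1_le:
  "1 \<le> N \<Longrightarrow> inverse_bound \<alpha> 1 N G0 (mixing_exact (card (set_pmf G0))) \<Longrightarrow> N1 \<alpha> G0 \<le> enat N"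
  unfolding N1_def by (intro Inf_lower) auto

lemma N2_le: "1 \<le> N \<Longrightarrow> inverse_bound \<alpha> 2 N G0 (mixing_atmost K) \<Longrightarrow> N2 \<alpha> G0 K \<le> enat N"
  unfolding N2_def by (intro Inf_lower) auto

lemma N2_all_le:
  "1 \<le> N \<Longrightarrow> (\<And>K. inverse_bound \<alpha> 2 N G0 (mixing_atmost K)) \<Longrightarrow> N2_all \<alpha> G0 \<le> enat N"
  unfolding N2_all_def by (intro Inf_lower) auto

theorem theorem2:
  fixes \<alpha> :: real and G0 :: "(real ^ 'v) pmf" and K0 :: nat
  assumes "\<alpha> > 0"
    and "G0 \<in> mixing_exact K0"
  shows "(N1 \<alpha> G0 \<le> enat (2 * K0 - 1) \<and> (\<forall>K>K0. N2 \<alpha> G0 K \<le> enat (K0 + K - 1)))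
    \<and> (independent (set_pmf G0) \<longrightarrow> N1 \<alpha> G0 \<le> 3 \<and> N2_all \<alpha> G0 \<le> 4)
    \<and> (anchor_word (set_pmf G0) \<longrightarrow> N1 \<alpha> G0 \<le> 2)"
proof (intro conjI impI allI)
  have G0: "simplex_pmf G0" and K0: "card (set_pmf G0) = K0"
    using assms(2) by (auto simp: mixing_exact_def simplex_pmf_def)
  have K0_pos: "K0 \<ge> 1"
    using G0 set_pmf_not_empty[of G0] unfolding K0[symmetric] simplex_pmf_def by (simp add: Suc_le_eq card_gt_0_iff)
  have ref: "lda_reference \<alpha> G0" using assms(1) G0 by unfold_locales
  have exact: "simplex_pmf G" "card (set_pmf G) = card (set_pmf G0)" if "G \<in> mixing_exact (card (set_pmf G0))" for G
    using that by (auto simp: mixing_exact_def simplex_pmf_def)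
  have atmost: "simplex_pmf G" if "G \<in> mixing_atmost K" for G :: "(real ^ 'v) pmf" and K
    using that by (auto simp: mixing_atmost_def mixing_exact_def simplex_pmf_def)
  show "N1 \<alpha> G0 \<le> enat (2 * K0 - 1)"
    by (rule N1_le, use K0_pos in simp, rule lda_reference.inverse_bound_W1[OF ref _ exact]) (simp_all add: K0)
  show "N2 \<alpha> G0 K \<le> enat (K0 + K - 1)" if "K > K0" for K
  proof (rule N2_le)
    show "1 \<le> K0 + K - 1" using K0_pos that by simp
    have "2 * card (set_pmf G0) \<le> K0 + K - 1" using that by (simp add: K0)
    then show "inverse_bound \<alpha> 2 (K0 + K - 1) G0 (mixing_atmost K)"
      by (rule lda_reference.inverse_bound_W2[OF ref _ atmost])
  qed
  show "N1 \<alpha> G0 \<le> 3" "N2_all \<alpha> G0 \<le> 4" if ind: "independent (set_pmf G0)"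
  proof -
    obtain z where "\<And>i l. i \<in> set_pmf G0 \<Longrightarrow> l \<in> set_pmf G0 \<Longrightarrow> z i \<bullet> l = of_bool (i = l)"
      using independent_dual_family[OF ind] by blast
    then have dual: "lda_dual \<alpha> G0 z" using ref by (simp add: lda_dual_def lda_dual_axioms_def)
    have "N1 \<alpha> G0 \<le> enat 3"
      by (rule N1_le, simp, rule lda_dual.inverse_bound_W1_degree_3[OF dual _ exact]) simp_all
    then show "N1 \<alpha> G0 \<le> 3" by (simp add: numeral_eq_enat)
    have "N2_all \<alpha> G0 \<le> enat 4"
      by (rule N2_all_le, simp, rule lda_dual.inverse_bound_W2_dual[OF dual _ atmost]) simp_all
    then show "N2_all \<alpha> G0 \<le> 4" by (simp add: numeral_eq_enat)
  qed
  show "N1 \<alpha> G0 \<le> 2" if anchor: "anchor_word (set_pmf G0)"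
  proof -
    obtain z where z: "\<And>i l. i \<in> set_pmf G0 \<Longrightarrow> l \<in> set_pmf G0 \<Longrightarrow> z i \<bullet> l = of_bool (i = l)"
      "\<And>i \<eta>. i \<in> set_pmf G0 \<Longrightarrow> \<eta> \<in> prob_simplex \<Longrightarrow> 0 \<le> z i \<bullet> \<eta>"
      using anchor_dual_family[OF anchor] by blast
    have dual: "lda_dual \<alpha> G0 z" using ref z(1) by (simp add: lda_dual_def lda_dual_axioms_def)
    have "N1 \<alpha> G0 \<le> enat 2"
      by (rule N1_le, simp, rule lda_dual.inverse_bound_W1_nonneg[OF dual _ z(2) exact]) simp_all
    then show "N1 \<alpha> G0 \<le> 2" by (simp add: numeral_eq_enat)
  qed
qed

end
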